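(* Let $n\ge 2$, let $\Omega_1,\ldots,\Omega_n$ be closed subsets of a Banach space $X$, $\bar x\in\bigcap_{i=1}^n\Omega_i$, $a_i\in X$ $(i=1,\ldots,n-1)$, $\varepsilon>0$ and $\varphi\in\mathcal{C}^1$. Suppose that $$\bigcap_{i=1}^{n-1}(\Omega_i-a_i)\cap\Omega_n=\emptyset$$ and $$\varphi\Big(\max_{1\le i\le n-1}\|a_i\|\Big)<\varphi\big(d(\Omega_1-a_1,\ldots,\Omega_{n-1}-a_{n-1},\Omega_n)\big)+\varepsilon.$$ Then, for any $\lambda>0$ and $\eta>0$: (i) there exist points $\omega_i\in\Omega_i\cap\mathbb{B}_\lambda(\bar x)$ $(i=1,\ldots,n-1)$ and $\omega_n\in\Omega_n\cap\mathbb{B}_\eta(\bar x)$ satisfying $$0<\max_{1\le i\le n-1}\|\omega_n+a_i-\omega_i\|\le\max_{1\le i\le n-1}\|a_i\|,$$ and vectors $x_i^*\in X^*$ $(i=1,\ldots,n)$ such that $$\sum_{i=1}^n x_i^*=0,\qquad\sum_{i=1}^{n-1}\|x_i^*\|=1,\tag{1}$$ $$\varphi'\Big(\max_{1\le i\le n-1}\|\omega_n+a_i-\omega_i\|\Big)\Big(\lambda\sum_{i=1}^{n-1}d\big(x_i^*,N_{\Omega_i}(\omega_i)\big)+\eta\, d\big(x_n^*,N_{\Omega_n}(\omega_n)\big)\Big)<\varepsilon,\tag{2}$$ $$\sum_{i=1}^{n-1}\langle x_i^*,\omega_n+a_i-\omega_i\rangle=\max_{1\le i\le n-1}\|\omega_n+a_i-\omega_i\|,$$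 where $N$ stands for the Clarke normal cone ($N=N^C$); (ii) if $X$ is Asplund, then, for any $\tau\in\,]0,1[$, there exist points $\omega_i\in\Omega_i\cap\mathbb{B}_\lambda(\bar x)$ $(i=1,\ldots,n-1)$ and $\omega_n\in\Omega_n\cap\mathbb{B}_\eta(\bar x)$ satisfying $$0<\max_{1\le i\le n-1}\|\omega_n+a_i-\omega_i\|<\varphi^{-1}\big(\varphi(d(\Omega_1-a_1,\ldots,\Omega_{n-1}-a_{n-1},\Omega_n))+\varepsilon\big),$$ and vectors $x_i^*\in X^*$ $(i=1,\ldots,n)$ satisfying (1), (2) with $N$ standing for the Fréchet normal cone ($N=N^F$), and $$\sum_{i=1}^{n-1}\langle x_i^*,\omega_n+a_i-\omega_i\rangle>\tau\max_{1\le i\le n-1}\|\omega_n+a_i-\omega_i\|.$$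
   Context: $\mathbb{B}_\delta(x)$ is the open ball with center $x$ and radius $\delta$; $d(x^*,S)$ is the norm distance from a point to a set. $\mathcal{C}^1$ is the family of all continuous strictly increasing functions $\varphi:\mathbb{R}_+\to\mathbb{R}_+$ with $\varphi(0)=0$, $\lim_{t\to+\infty}\varphi(t)=+\infty$, that are continuously differentiable on $]0,+\infty[$ with $\varphi'(t)>0$ for all $t>0$. For several sets, $$d(\Omega_1,\ldots,\Omega_n):=\inf_{u_i\in\Omega_i\,(i=1,\ldots,n)}\ \max_{1\le i\le n-1}\|u_n-u_i\|.$$ For $\Omega\subset X$ and $\omega\in\Omega$, the Fréchet normal cone is $$N^F_\Omega(\omega):=\Big\{x^*\in X^*\ \Big|\ \limsup_{\Omega\ni x\to\omega,\,x\ne\omega}\frac{\langle x^*,x-\omega\rangle}{\|x-\omega\|}\le0\Big\}$$ (equal to $X^*$ if $\omega$ is isolated in $\Omega$), and the Clarke normal cone is $N^C_\Omega(\omega):=\{x^*\in X^*\mid\langle x^*,z\rangle\le0\ \text{for all}\ z\in T^C_\Omega(\omega)\}$, where $T^C_\Omega(\omega)$ is the Clarke tangent cone (the set of $z\in X$ such that for all sequences $x_k\to\omega$ in $\Omega$ and $t_k\downarrow0$ there are $z_k\to z$ with $x_k+t_kz_k\in\Omega$ for all $k$). A Banach space is Asplund if every continuous convex function on an open convex set is Fréchet differentiable on a dense subset of it. *)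

theory Defs
  imports "HOL-Analysis.Analysis"
begin

(* Functions on the half-line are total functions on the reals of which only the
   restriction to {0..} matters. *)
definition class_C1 :: "(real \<Rightarrow> real) set" where
  "class_C1 = {\<phi>. \<phi> \<in> {0..} \<rightarrow> {0..} \<and> continuous_on {0..} \<phi> \<and> strict_mono_on {0..} \<phi> \<and>
     \<phi> 0 = 0 \<and> filterlim \<phi> at_top at_top \<and>
     (\<forall>t>0. \<phi> differentiable (at t)) \<and> continuous_on {0<..} (deriv \<phi>) \<and>
     (\<forall>t>0. deriv \<phi> t > 0)}"

(* The distance d(\<Omega> 1, ..., \<Omega> n), with the last set playing a distinguished role.
   It is meaningful for n \<ge> 2 and nonempty sets (the infimum over the empty set,
   + infinity in the extended reals, is not represented). *)
definition sets_dist :: "nat \<Rightarrow> (nat \<Rightarrow> 'a::real_normed_vector set) \<Rightarrow> real" where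
  "sets_dist n \<Omega> = Inf {MAX i\<in>{1..n-1}. norm (u n - u i) | u. \<forall>i\<in>{1..n}. u i \<in> \<Omega> i}"

(* For an isolated point \<omega> of \<Omega> the filter is trivial and the upper limit is - infinity,
   so that the cone is then the whole dual space. *)
definition frechet_normal_cone ::
    "'a::real_normed_vector set \<Rightarrow> 'a \<Rightarrow> ('a \<Rightarrow>\<^sub>L real) set" where
  "frechet_normal_cone \<Omega> \<omega> =
     {x'. Limsup (at \<omega> within \<Omega>)
            (\<lambda>x. ereal (blinfun_apply x' (x - \<omega>) / norm (x - \<omega>))) \<le> 0}"

definition clarke_tangent_cone :: "'a::real_normed_vector set \<Rightarrow> 'a \<Rightarrow> 'a set" where
  "clarke_tangent_cone \<Omega> \<omega> =
     {z. \<forall>(x :: nat \<Rightarrow> 'a) (t :: nat \<Rightarrow> real).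
           (\<forall>k. x k \<in> \<Omega>) \<and> x \<longlonglongrightarrow> \<omega> \<and> (\<forall>k. t k > 0) \<and> t \<longlonglongrightarrow> 0 \<longrightarrow>
           (\<exists>\<zeta>. \<zeta> \<longlonglongrightarrow> z \<and> (\<forall>k. x k + t k *\<^sub>R \<zeta> k \<in> \<Omega>))}"

definition clarke_normal_cone ::
    "'a::real_normed_vector set \<Rightarrow> 'a \<Rightarrow> ('a \<Rightarrow>\<^sub>L real) set" where
  "clarke_normal_cone \<Omega> \<omega> =
     {x'. \<forall>z\<in>clarke_tangent_cone \<Omega> \<omega>. blinfun_apply x' z \<le> 0}"

definition asplund_space :: "'a::banach itself \<Rightarrow> bool" where
  "asplund_space _ \<longleftrightarrow>
     (\<forall>(U :: 'a set) (f :: 'a \<Rightarrow> real).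
        open U \<and> convex U \<and> convex_on U f \<and> continuous_on U f \<longrightarrow>
        (\<exists>D\<subseteq>U. U \<subseteq> closure D \<and> (\<forall>x\<in>D. f differentiable (at x))))"

end

theory Submission
  imports Defs
begin

text \<open>Ekeland's principle, applied to \<open>\<phi> (MAX i\<in>{1..n-1}. norm (u n + a i - u i))\<close> on the product of
  the sets with the maximum norm weighted by \<open>lam\<close> and \<open>\<eta>\<close>, together with the differentiability
  of \<open>\<phi>\<close> gives a point of the product at which a convex Lipschitz function has a local minimum over it.

  For (i), convexity of the Clarke tangent cone lets the Hahn-Banach sandwich theorem separate the
  function from the tangent cones, which gives a Clarke normal. For (ii), the minimum has to be turned
  into a Frechet normal at a nearby point. In an Asplund space the dual of every separable subspace
  \<open>Y\<close> is separable. An infimal convolution with the conjugates of squared distances to a dense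
  sequence of functionals then approximates each convex Lipschitz function uniformly by one that is
  Frechet differentiable along \<open>Y\<close>, and a variational principle with such smooth perturbations of
  the norm produces a Frechet normal relative to \<open>Y\<close>. If \<open>Y\<close> is chosen closed under countably many
  selections, the normal can be replaced by one that is valid in the whole space.

  In both cases a second use of the sandwich theorem splits the normal into a subgradient of the maximum norm,
  whose normalised components are the multipliers, and a remainder whose size bounds their distance
  to the normal cones.\<close>

section \<open>Sublinear functionals and the sandwich theorem\<close>

text \<open>Since the translated sets have no common point, the maximum norm of the gaps is positive
  on the whole product, so \<open>\<phi>\<close> is linearised only where it is differentiable. Part
  (i) ends in an equality because the separating functional exists at the Ekeland point itself. In
  (ii) the base point moves by less than \<open>\<beta>\<close> and the subgradient inequality
  acquires errors of size \<open>\<beta>\<close>. This costs the factor \<open>\<tau>\<close>, and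
  the gaps may slightly exceed their value at the starting point while staying below the inverse of
  \<open>\<phi>\<close> at the larger level.

  The Asplund property is a property of \<open>'a\<close>, whereas the variational argument runs in
  a product. Separability of duals passes to finite products coordinate by coordinate, so the
  property enters only in that form. The separable subspace has to be fixed before any normal
  relative to it is known. Hence the selections under which it is closed may depend only on the
  sets, the objective and rational data, and never on a functional.\<close>

definition sublinear :: "('b::real_vector \<Rightarrow> real) \<Rightarrow> bool" where
  "sublinear p \<longleftrightarrow> (\<forall>x y. p (x + y) \<le> p x + p y) \<and> (\<forall>t>0. \<forall>x. p (t *\<^sub>R x) = t * p x)"

lemma sublinearI:
  assumes "\<And>x y. p (x + y) \<le> p x + p y" and "\<And>t x. t > 0 \<Longrightarrow> p (t *\<^sub>R x) \<le> t * p x"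
  shows "sublinear p"
proof -
  have "t * p x \<le> p (t *\<^sub>R x)" if "t > 0" for t x
  proof -
    have "p ((1/t) *\<^sub>R (t *\<^sub>R x)) \<le> (1/t) * p (t *\<^sub>R x)"
      using that by (intro assms(2)) auto
    then show ?thesis using that by (simp add: field_simps)
  qed
  then show ?thesis using assms by (auto simp: sublinear_def intro: antisym)
qed

lemma sublinear_add: "sublinear p \<Longrightarrow> p (x + y) \<le> p x + p y"
  and sublinear_scaleR: "sublinear p \<Longrightarrow> t > 0 \<Longrightarrow> p (t *\<^sub>R x) = t * p x"
  by (auto simp: sublinear_def)

lemma sublinear_zero: "sublinear p \<Longrightarrow> p 0 = 0"
  using sublinear_scaleR[of p 2 0] by simp

lemma sublinear_minus: "sublinear p \<Longrightarrow> - p (- x) \<le> p x"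
  using sublinear_add[of p x "- x"] sublinear_zero[of p] by simp

lemma sublinear_diff: "sublinear p \<Longrightarrow> p x - p y \<le> p (x - y)"
  using sublinear_add[of p "x - y" y] by simp

text \<open>The infimum of a chain is finite because every member satisfies
  \<open>- q0 (- x) \<le> q x\<close>. The floor \<open>l\<close> is an arbitrary function:
  \<open>D = {}\<close> leads to Hahn-Banach, and a support function prescribed on a dense subset of
  a separable subspace leads to a nowhere differentiable functional.\<close>

lemma minimal_sublinear:
  fixes q0 :: "'b::real_vector \<Rightarrow> real"
  assumes q0: "sublinear q0" "\<And>d. d \<in> D \<Longrightarrow> l d \<le> q0 d"
  obtains q where "sublinear q" "q \<le> q0" "\<And>d. d \<in> D \<Longrightarrow> l d \<le> q d"
    "\<And>q'. sublinear q' \<Longrightarrow> q' \<le> q \<Longrightarrow> (\<And>d. d \<in> D \<Longrightarrow> l d \<le> q' d) \<Longrightarrow> q' = q"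
proof -
  define A where "A = {q. sublinear q \<and> q \<le> q0 \<and> (\<forall>d\<in>D. l d \<le> q d)}"
  \<comment> \<open>The order is reversed so that the maximal element given by Zorn is a minimal
    functional.\<close>
  have po: "partial_order_on A (relation_of (\<lambda>a b. b \<le> a) A)"
    by (rule partial_order_on_relation_ofI) auto
  have "\<exists>u\<in>A. \<forall>a\<in>C. u \<le> a" if C: "C \<in> Chains (relation_of (\<lambda>a b. b \<le> a) A)" for C
  proof (cases "C = {}")
    case True
    then show ?thesis using q0 by (auto simp: A_def)
  next
    case False
    have sub: "C \<subseteq> A" and ch: "\<And>a b. a \<in> C \<Longrightarrow> b \<in> C \<Longrightarrow> a \<le> b \<or> b \<le> a"
      using C by (auto simp: Chains_def relation_of_def)
    define u where "u x = (INF q\<in>C. q x)" for x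
    have low: "- q0 (- x) \<le> q x" if "q \<in> C" for q x
      using that sub sublinear_minus[of q x] unfolding A_def le_fun_def
      by (smt (verit) mem_Collect_eq subset_iff)
    have bdd: "bdd_below ((\<lambda>q. q x) ` C)" for x
      using low by (auto intro!: bdd_belowI2)
    have ule: "u x \<le> q x" if "q \<in> C" for q x
      unfolding u_def using bdd that by (rule cINF_lower)
    have ug: "b \<le> u x" if "\<And>q. q \<in> C \<Longrightarrow> b \<le> q x" for b x
      unfolding u_def using False that by (rule cINF_greatest)
    have "sublinear u"
    proof (rule sublinearI)
      fix x y
      have uq: "u (x + y) \<le> q x + q' y" if qq: "q \<in> C" "q' \<in> C" for q q'
      proof -
        obtain r where r: "r \<in> C" "r \<le> q" "r \<le> q'" using ch[OF qq] qq by blast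
        have "u (x + y) \<le> r (x + y)" using ule r by auto
        also have "\<dots> \<le> r x + r y" using r sub by (auto simp: A_def intro: sublinear_add)
        also have "\<dots> \<le> q x + q' y" using r by (auto simp: le_fun_def intro: add_mono)
        finally show ?thesis .
      qed
      have "u (x + y) - q x \<le> u y" if "q \<in> C" for q
      proof (rule ug)
        show "u (x + y) - q x \<le> q' y" if "q' \<in> C" for q' using uq[OF \<open>q \<in> C\<close> that] by linarith
      qed
      then have "u (x + y) - u y \<le> u x" by (intro ug) (smt (verit))
      then show "u (x + y) \<le> u x + u y" by simp
    next
      fix t :: real and x assume t: "t > 0"
      have "u (t *\<^sub>R x) / t \<le> u x"
      proof (rule ug)
        fix q assume q: "q \<in> C"
        then have "q (t *\<^sub>R x) = t * q x" using sub t by (auto simp: A_def intro: sublinear_scaleR)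
        then show "u (t *\<^sub>R x) / t \<le> q x" using ule[OF q, of "t *\<^sub>R x"] t by (simp add: field_simps)
      qed
      then show "u (t *\<^sub>R x) \<le> t * u x" using t by (simp add: field_simps)
    qed
    moreover have "u \<le> q0"
    proof -
      obtain q where "q \<in> C" using False by auto
      then show ?thesis using ule sub unfolding A_def le_fun_def by (blast intro: order_trans)
    qed
    moreover have "\<forall>d\<in>D. l d \<le> u d" using sub by (auto simp: A_def intro!: ug)
    ultimately have "u \<in> A" by (auto simp: A_def)
    then show ?thesis using ule by (auto simp: le_fun_def)
  qed
  from predicate_Zorn[OF po this] obtain q where "q \<in> A" "\<forall>a\<in>A. a \<le> q \<longrightarrow> a = q" by blast
  then show thesis
    by (intro that[of q]) (auto simp: A_def dest: order_trans)
qed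

text \<open>The functional obtained is the largest sublinear one that lies below \<open>q\<close>
  and is at most \<open>c\<close> at \<open>s\<close> for each \<open>(s, c) \<in> K\<close>. By
  positive homogeneity, \<open>low\<close> is exactly the condition that keeps the infimum
  finite.\<close>

lemma sublinear_inf_cone:
  fixes q :: "'b::real_vector \<Rightarrow> real" and K :: "('b \<times> real) set"
  assumes q: "sublinear q" and K0: "(0, 0) \<in> K"
    and Kadd: "\<And>s c s' c'. (s, c) \<in> K \<Longrightarrow> (s', c') \<in> K \<Longrightarrow> (s + s', c + c') \<in> K"
    and Kscale: "\<And>t s c. t > 0 \<Longrightarrow> (s, c) \<in> K \<Longrightarrow> (t *\<^sub>R s, t * c) \<in> K"
    and low: "\<And>s c. (s, c) \<in> K \<Longrightarrow> 0 \<le> c + q (- s)"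
  obtains p where "sublinear p" "\<And>z s c. (s, c) \<in> K \<Longrightarrow> p z \<le> c + q (z - s)"
    "\<And>z b. (\<And>s c. (s, c) \<in> K \<Longrightarrow> b \<le> c + q (z - s)) \<Longrightarrow> b \<le> p z"
proof -
  define p where "p z = (INF (s, c)\<in>K. c + q (z - s))" for z
  have low': "- q (- z) \<le> c + q (z - s)" if "(s, c) \<in> K" for z s c
    using low[OF that] sublinear_add[OF q, of "z - s" "- z"] by simp
  have ple: "p z \<le> c + q (z - s)" if "(s, c) \<in> K" for z s c
  proof -
    have "bdd_below ((\<lambda>(s, c). c + q (z - s)) ` K)"
      using low' by (intro bdd_belowI2[where m = "- q (- z)"]) auto
    from cINF_lower[OF this that] show ?thesis by (simp add: p_def)
  qed
  have pg: "b \<le> p z" if "\<And>s c. (s, c) \<in> K \<Longrightarrow> b \<le> c + q (z - s)" for b z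
    unfolding p_def using K0 that by (intro cINF_greatest) auto
  have "sublinear p"
  proof (rule sublinearI)
    fix z z'
    have *: "p (z + z') \<le> (c + q (z - s)) + (c' + q (z' - s'))" if "(s, c) \<in> K" "(s', c') \<in> K" for s c s' c'
      using ple[OF Kadd[OF that], of "z + z'"] sublinear_add[OF q, of "z - s" "z' - s'"]
      by (simp add: algebra_simps)
    have "p (z + z') - (c + q (z - s)) \<le> p z'" if "(s, c) \<in> K" for s c
      using *[OF that] by (intro pg) (smt (verit))
    then have "p (z + z') - p z' \<le> p z" by (intro pg) (smt (verit))
    then show "p (z + z') \<le> p z + p z'" by simp
  next
    fix t :: real and z assume t: "t > 0"
    have "p (t *\<^sub>R z) / t \<le> p z"
    proof (rule pg)
      fix s c assume "(s, c) \<in> K"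
      from ple[OF Kscale[OF t this], of "t *\<^sub>R z"] show "p (t *\<^sub>R z) / t \<le> c + q (z - s)"
        using t sublinear_scaleR[OF q t, of "z - s"] by (simp add: scaleR_diff_right field_simps)
    qed
    then show "p (t *\<^sub>R z) \<le> t * p z" using t by (simp add: field_simps)
  qed
  then show thesis using ple pg that by blast
qed

text \<open>A minimal sublinear functional \<open>q\<close> is odd: the sublinear functional
  \<open>z \<mapsto> inf {q (z + s x) - s q x | s \<ge> 0}\<close> lies below \<open>q\<close>, hence equals \<open>q\<close>, and it takes at
  \<open>- x\<close> a value that is at most \<open>- q x\<close>.\<close>

lemma sublinear_dominates_linear:
  fixes p :: "'b::real_vector \<Rightarrow> real"
  assumes "sublinear p"
  obtains L where "linear L" "\<And>x. L x \<le> p x"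
proof -
  obtain q where q: "sublinear q" "q \<le> p"
    and min: "\<And>q'. sublinear q' \<Longrightarrow> q' \<le> q \<Longrightarrow> q' = q"
    using minimal_sublinear[OF assms, of "{}"] by auto
  have odd: "q (- x) \<le> - q x" for x
  proof -
    define K where "K = {(- (s *\<^sub>R x), - (s * q x)) | s. s \<ge> 0}"
    have K: "(- (s *\<^sub>R x), - (s * q x)) \<in> K" if "s \<ge> 0" for s using that by (auto simp: K_def)
    have sx: "q (s *\<^sub>R x) = s * q x" if "s \<ge> 0" for s
      using that sublinear_scaleR[OF q(1), of s x] sublinear_zero[OF q(1)] by (cases "s = 0") auto
    obtain r where r: "sublinear r" "\<And>z s c. (s, c) \<in> K \<Longrightarrow> r z \<le> c + q (z - s)"
    proof (rule sublinear_inf_cone[OF q(1), of K])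
      show "(0, 0) \<in> K" using K[of 0] by simp
      show "(s + s', c + c') \<in> K" if sc: "(s, c) \<in> K" "(s', c') \<in> K" for s c s' c'
      proof -
        obtain u u' where "s = - (u *\<^sub>R x)" "c = - (u * q x)" "u \<ge> 0" "s' = - (u' *\<^sub>R x)" "c' = - (u' * q x)" "u' \<ge> 0"
          using sc by (auto simp: K_def)
        then show ?thesis using K[of "u + u'"] by (simp add: algebra_simps)
      qed
      show "(t *\<^sub>R s, t * c) \<in> K" if sc: "t > 0" "(s, c) \<in> K" for t s c
      proof -
        obtain u where "s = - (u *\<^sub>R x)" "c = - (u * q x)" "u \<ge> 0" using sc(2) by (auto simp: K_def)
        then show ?thesis using K[of "t * u"] sc(1) by (simp add: mult.assoc)
      qed
      show "0 \<le> c + q (- s)" if "(s, c) \<in> K" for s c using that sx by (auto simp: K_def)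
    qed (rule that)
    have rle: "r z \<le> q (z + s *\<^sub>R x) - s * q x" if "s \<ge> 0" for z s using r(2)[OF K[OF that], of z] by simp
    have "r \<le> q" using rle[of 0] by (auto simp: le_fun_def)
    with r(1) have "r = q" by (rule min)
    then show ?thesis using rle[of 1 "- x"] sublinear_zero[OF q(1)] by simp
  qed
  have neg: "q (- x) = - q x" for x
    using odd[of x] sublinear_minus[OF q(1), of x] by simp
  have "linear q"
  proof (rule linearI)
    fix x y
    have "- q (x + y) \<le> - q x + - q y"
      using sublinear_add[OF q(1), of "- x" "- y"] neg by (metis minus_add_distrib)
    then show "q (x + y) = q x + q y" using sublinear_add[OF q(1), of x y] by simp
  next
    fix r x
    show "q (r *\<^sub>R x) = r *\<^sub>R q x"
    proof (cases "r > 0 \<or> r = 0")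
      case True
      then show ?thesis using sublinear_scaleR[OF q(1)] sublinear_zero[OF q(1)] by auto
    next
      case False
      then have "q ((- r) *\<^sub>R x) = (- r) * q x" by (intro sublinear_scaleR[OF q(1)]) auto
      then show ?thesis using neg[of "(- r) *\<^sub>R x"] by simp
    qed
  qed
  then show thesis using q(2) that[of q] by (auto simp: le_fun_def)
qed

lemma linear_le_norm_blinfun:
  fixes L :: "'b::real_normed_vector \<Rightarrow> real"
  assumes "linear L" "\<And>x. L x \<le> K * norm x"
  obtains x' :: "'b \<Rightarrow>\<^sub>L real" where "\<And>x. blinfun_apply x' x = L x"
proof -
  have "\<bar>L x\<bar> \<le> K * norm x" for x
    using assms(2)[of x] assms(2)[of "- x"] linear_neg[OF assms(1), of x] by auto
  then have "bounded_linear L"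
    using assms(1) by (intro bounded_linear_intro[of L K]) (auto simp: linear_add linear_scale mult.commute)
  then show thesis using that[of "Blinfun L"] by (simp add: bounded_linear_Blinfun_apply)
qed

lemma blinfun_norm_leI:
  fixes x' :: "'b::real_normed_vector \<Rightarrow>\<^sub>L real"
  assumes "K \<ge> 0" "\<And>x. blinfun_apply x' x \<le> K * norm x"
  shows "norm x' \<le> K"
proof (rule norm_blinfun_bound[OF assms(1)])
  fix x show "norm (blinfun_apply x' x) \<le> K * norm x"
    using assms(2)[of x] assms(2)[of "- x"] by (auto simp: blinfun.minus_right)
qed

lemma blinfun_le_norm: "blinfun_apply (x' :: 'b::real_normed_vector \<Rightarrow>\<^sub>L real) x \<le> norm x' * norm x"
  using norm_blinfun[of x' x] by auto

text \<open>Hahn-Banach is applied to the sublinear functional \<open>h \<mapsto> inf (c + q (s + t h)) / t\<close> over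
  \<open>t > 0\<close> and \<open>(s, c) \<in> K\<close>.\<close>

lemma convex_sandwich:
  fixes q :: "'b::real_normed_vector \<Rightarrow> real" and K :: "('b \<times> real) set"
  assumes cq: "convex_on UNIV q" and Lq: "\<And>x y. q x - q y \<le> L * norm (x - y)"
    and K0: "(0, 0) \<in> K"
    and Kadd: "\<And>s c s' c'. (s, c) \<in> K \<Longrightarrow> (s', c') \<in> K \<Longrightarrow> (s + s', c + c') \<in> K"
    and Kscale: "\<And>t s c. t > 0 \<Longrightarrow> (s, c) \<in> K \<Longrightarrow> (t *\<^sub>R s, t * c) \<in> K"
    and Kq: "\<And>s c. (s, c) \<in> K \<Longrightarrow> 0 \<le> c + q s"
  obtains x' :: "'b \<Rightarrow>\<^sub>L real" where "\<And>s c. (s, c) \<in> K \<Longrightarrow> blinfun_apply x' s \<le> c"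
    "\<And>h. - blinfun_apply x' h \<le> q h"
proof -
  define I where "I = {(t, s, c). t > (0::real) \<and> (s, c) \<in> K}"
  define P where "P h = (\<lambda>(t, s, c). (c + q (s + t *\<^sub>R h)) / t)" for h
  define p where "p h = (INF i\<in>I. P h i)" for h
  have I0: "(1, 0, 0) \<in> I" using K0 by (auto simp: I_def)
  have low: "- (L * norm h) \<le> P h i" if iI: "i \<in> I" for h i
  proof -
    obtain t s c where i: "i = (t, s, c)" "t > 0" "(s, c) \<in> K" using iI by (auto simp: I_def)
    have "q s - q (s + t *\<^sub>R h) \<le> t * (L * norm h)" using Lq[of s "s + t *\<^sub>R h"] i by (simp add: ac_simps)
    then have "- (t * (L * norm h)) \<le> c + q (s + t *\<^sub>R h)" using Kq[OF i(3)] by linarith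
    then show ?thesis using i by (simp add: P_def field_simps)
  qed
  have ple: "p h \<le> (c + q (s + t *\<^sub>R h)) / t" if "t > 0" "(s, c) \<in> K" for t s c h
  proof -
    have "p h \<le> P h (t, s, c)" unfolding p_def using that low
      by (intro cINF_lower bdd_belowI2[where m = "- (L * norm h)"]) (auto simp: I_def)
    then show ?thesis by (simp add: P_def)
  qed
  have pg: "b \<le> p h" if *: "\<And>t s c. t > 0 \<Longrightarrow> (s, c) \<in> K \<Longrightarrow> b \<le> (c + q (s + t *\<^sub>R h)) / t" for b h
  proof -
    have "b \<le> P h i" if "i \<in> I" for i using that * by (auto simp: I_def P_def)
    then show ?thesis unfolding p_def using I0 by (intro cINF_greatest) auto
  qed
  have "sublinear p"
  proof (rule sublinearI)
    fix h h'
    have *: "p (h + h') \<le> (c + q (s + t *\<^sub>R h)) / t + (c' + q (s' + t' *\<^sub>R h')) / t'"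
      if t: "t > 0" "t' > 0" and K: "(s, c) \<in> K" "(s', c') \<in> K" for t t' s s' c c'
    proof -
      \<comment> \<open>This value makes \<open>T / t + T / t' = 1\<close>, so that the convexity of
        \<open>q\<close> applies to the two rescaled points.\<close>
      define T where "T = t * t' / (t + t')"
      have T: "T > 0" "T / t = t' / (t + t')" "T / t' = t / (t + t')" using t by (auto simp: T_def)
      have T1: "T / t + T / t' = 1" using t T by (simp add: add_divide_distrib[symmetric] add.commute)
      have TT: "T * x / t = (T / t) * x" "T * x / t' = (T / t') * x" for x by auto
      have K2: "((T/t) *\<^sub>R s + (T/t') *\<^sub>R s', (T/t) * c + (T/t') * c') \<in> K"
        using K T t by (intro Kadd Kscale) auto
      have "(T/t) *\<^sub>R s + (T/t') *\<^sub>R s' + T *\<^sub>R (h + h')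
          = (T/t) *\<^sub>R (s + t *\<^sub>R h) + (T/t') *\<^sub>R (s' + t' *\<^sub>R h')"
        using t by (simp add: algebra_simps)
      then have "q ((T/t) *\<^sub>R s + (T/t') *\<^sub>R s' + T *\<^sub>R (h + h'))
          \<le> (T/t) * q (s + t *\<^sub>R h) + (T/t') * q (s' + t' *\<^sub>R h')"
        using cq T1 T t unfolding convex_on_def by (metis UNIV_I divide_nonneg_pos less_imp_le)
      then have "(T/t) * c + (T/t') * c' + q ((T/t) *\<^sub>R s + (T/t') *\<^sub>R s' + T *\<^sub>R (h + h'))
          \<le> T * ((c + q (s + t *\<^sub>R h)) / t + (c' + q (s' + t' *\<^sub>R h')) / t')"
        by (simp add: algebra_simps add_divide_distrib)
      then show ?thesis using ple[OF T(1) K2, of "h + h'"] T(1)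
        by (smt (verit) mult.commute pos_divide_le_eq)
    qed
    have "p (h + h') - (c + q (s + t *\<^sub>R h)) / t \<le> p h'" if "t > 0" "(s, c) \<in> K" for t s c
      using *[OF that(1) _ that(2)] by (intro pg) (smt (verit))
    then have "p (h + h') - p h' \<le> p h" by (intro pg) (smt (verit))
    then show "p (h + h') \<le> p h + p h'" by simp
  next
    fix r :: real and h assume r: "r > 0"
    have "p (r *\<^sub>R h) / r \<le> p h"
    proof (rule pg)
      fix t s c assume t: "t > (0::real)" "(s, c) \<in> K"
      have "p (r *\<^sub>R h) \<le> (c + q (s + (t/r) *\<^sub>R (r *\<^sub>R h))) / (t/r)" using t r by (intro ple) auto
      then show "p (r *\<^sub>R h) / r \<le> (c + q (s + t *\<^sub>R h)) / t" using r t by (simp add: field_simps)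
    qed
    then show "p (r *\<^sub>R h) \<le> r * p h" using r by (simp add: field_simps)
  qed
  then obtain l where l: "linear l" "\<And>x. l x \<le> p x" using sublinear_dominates_linear by blast
  \<comment> \<open>As \<open>q\<close> is merely convex, \<open>q 0\<close> may be positive; the
    error \<open>q 0 / t\<close> disappears as \<open>t\<close> tends to infinity.\<close>
  have lim: "x \<le> y" if "\<And>t. t > 0 \<Longrightarrow> x \<le> y + q 0 / t" for x y
  proof (rule tendsto_lowerbound)
    show "((\<lambda>t. y + q 0 / t) \<longlongrightarrow> y) at_top"
      using tendsto_add[OF tendsto_const[of y] tendsto_divide_0[OF tendsto_const[of "q 0"]
        filterlim_at_top_imp_at_infinity[OF filterlim_ident]]] by simp
    show "\<forall>\<^sub>F t in at_top. x \<le> y + q 0 / t" using eventually_gt_at_top[of 0] by eventually_elim (rule that)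
  qed auto
  have "l h \<le> L * norm h" for h
  proof (rule lim)
    fix t :: real assume t: "t > 0"
    have "l h \<le> q (t *\<^sub>R h) / t" using l(2)[of h] ple[OF t K0, of h] by simp
    moreover have "q (t *\<^sub>R h) \<le> q 0 + t * (L * norm h)" using Lq[of "t *\<^sub>R h" 0] t by (simp add: ac_simps)
    ultimately show "l h \<le> L * norm h + q 0 / t" using t by (smt (verit) add_divide_distrib divide_right_mono nonzero_mult_div_cancel_left)
  qed
  then obtain l' :: "'b \<Rightarrow>\<^sub>L real" where l': "\<And>x. blinfun_apply l' x = l x"
    using linear_le_norm_blinfun[OF l(1)] by blast
  have "blinfun_apply (- l') s \<le> c" if "(s, c) \<in> K" for s c
  proof (rule lim)
    fix t :: real assume t: "t > 0"
    have "l (- s) \<le> (t * c + q (t *\<^sub>R s + t *\<^sub>R (- s))) / t"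
      using l(2)[of "- s"] ple[OF t Kscale[OF t that], of "- s"] by simp
    then show "blinfun_apply (- l') s \<le> c + q 0 / t"
      using t linear_neg[OF l(1)] by (simp add: blinfun.minus_left l' add_divide_distrib)
  qed
  moreover have "- blinfun_apply (- l') h \<le> q h" for h
    using l(2)[of h] ple[of 1 0 0 h] K0 by (simp add: blinfun.minus_left l')
  ultimately show thesis using that by blast
qed

section \<open>Shifts and subgradients of convex functions\<close>

lemma convex_on_shift:
  fixes g :: "'b::real_vector \<Rightarrow> real"
  assumes "convex_on UNIV g"
  shows "convex_on UNIV (\<lambda>h. g (x + h))"
proof (rule convex_onI)
  fix t :: real and h h' :: 'b assume t: "0 < t" "t < 1"
  have "x + ((1 - t) *\<^sub>R h + t *\<^sub>R h') = (1 - t) *\<^sub>R (x + h) + t *\<^sub>R (x + h')" by (simp add: algebra_simps)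
  then show "g (x + ((1 - t) *\<^sub>R h + t *\<^sub>R h')) \<le> (1 - t) * g (x + h) + t * g (x + h')"
    using convex_onD[OF assms(1), of t "x + h" "x + h'"] t by simp
qed auto

lemma convex_on_norm_UNIV: "convex_on UNIV (norm :: 'b::real_normed_vector \<Rightarrow> real)"
proof (rule convex_onI)
  fix t :: real and x y :: 'b assume t: "0 < t" "t < 1"
  then show "norm ((1 - t) *\<^sub>R x + t *\<^sub>R y) \<le> (1 - t) * norm x + t * norm y"
    using norm_triangle_ineq[of "(1 - t) *\<^sub>R x" "t *\<^sub>R y"] by simp
qed auto

lemma convex_subgradient:
  fixes q :: "'b::real_normed_vector \<Rightarrow> real"
  assumes "convex_on UNIV q" "\<And>x y. q x - q y \<le> L * norm (x - y)"
  obtains y' :: "'b \<Rightarrow>\<^sub>L real" where "\<And>h. blinfun_apply y' h \<le> q (x + h) - q x"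
proof -
  have c: "convex_on UNIV (\<lambda>h. q (x + h) - q x)"
    using convex_on_add[OF convex_on_shift[OF assms(1), of x], of "\<lambda>_. - q x"] by (simp add: convex_on_const)
  obtain x' :: "'b \<Rightarrow>\<^sub>L real" where "\<And>h. - blinfun_apply x' h \<le> q (x + h) - q x"
  proof (rule convex_sandwich[OF c, of L "{(0, 0)}"])
    show "(q (x + h) - q x) - (q (x + h') - q x) \<le> L * norm (h - h')" for h h'
      using assms(2)[of "x + h" "x + h'"] by simp
  qed auto
  then show thesis using that[of "- x'"] by (simp add: blinfun.minus_left)
qed

section \<open>Smooth approximation of convex functions\<close>

text \<open>A subgradient already bounds the increment from below, so for convex \<open>G\<close>
  the upper estimate alone expresses Frechet differentiability at \<open>x\<close> in the directions
  of \<open>Y\<close>. The base point \<open>x\<close> itself need not lie in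
  \<open>Y\<close>.\<close>

definition smooth_along :: "'b::real_normed_vector set \<Rightarrow> ('b \<Rightarrow> real) \<Rightarrow> bool" where
  "smooth_along Y G \<longleftrightarrow> (\<forall>x (y' :: 'b \<Rightarrow>\<^sub>L real). (\<forall>h. blinfun_apply y' h \<le> G (x + h) - G x) \<longrightarrow>
     (\<forall>\<epsilon>>0. \<exists>\<rho>>0. \<forall>h\<in>Y. norm h < \<rho> \<longrightarrow> G (x + h) - G x \<le> blinfun_apply y' h + \<epsilon> * norm h))"

text \<open>\<open>G\<close> is the infimal convolution of \<open>g\<close> with the functions \<open>\<theta> j\<close> on \<open>Y\<close>, where \<open>c j\<close> runs
  through \<open>C\<close>; its conjugate is that of \<open>g\<close> plus \<open>\<Sum>j. w j * (norm (y' - c j))\<^sup>2\<close>.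
  A subgradient \<open>y'\<close> at \<open>x\<close> with \<open>norm (y' - c j) \<le> \<kappa>\<close> forces \<open>norm (z j) \<le> 6 w j \<kappa>\<close> in every nearly
  optimal decomposition of \<open>x\<close>, and moving \<open>z j\<close> alone bounds \<open>G (x + h)\<close> from above.\<close>

lemma smooth_approximation:
  fixes g :: "'b::real_normed_vector \<Rightarrow> real" and C :: "('b \<Rightarrow>\<^sub>L real) set"
  assumes cg: "convex_on UNIV g" and L: "L \<ge> 0" and Lg: "\<And>x y. g x - g y \<le> L * norm (x - y)"
    and Y: "subspace Y" and C: "countable C"
    and approx: "\<And>x' \<epsilon>. \<epsilon> > 0 \<Longrightarrow> \<exists>c\<in>C. \<forall>y\<in>Y. \<bar>blinfun_apply x' y - blinfun_apply c y\<bar> \<le> \<epsilon> * norm y"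
    and \<delta>: "\<delta> > 0"
  obtains G where "convex_on UNIV G" "\<And>x y. G x - G y \<le> L * norm (x - y)"
    "\<And>x. g x - \<delta> \<le> G x" "\<And>x. G x \<le> g x" "smooth_along Y G"
proof -
  have "C \<noteq> {}" using approx[of 1 0] by auto
  then obtain c :: "nat \<Rightarrow> 'b \<Rightarrow>\<^sub>L real" where c: "range c = C"
    using range_from_nat_into[of C] C by blast
  \<comment> \<open>The weights give every functional of norm at most \<open>L\<close> a total
    penalty of at most \<open>\<delta>\<close>, since the \<open>j\<close>-th one is at most
    \<open>\<delta> * (1/2) ^ Suc j\<close>. This is what yields
    \<open>g x - \<delta> \<le> G x\<close>. The summand \<open>1\<close> keeps the denominator
    positive.\<close>
  define w where "w j = \<delta> * (1/2) ^ Suc j / (norm (c j) + L + 1)\<^sup>2" for j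
  define \<theta> where "\<theta> j v = blinfun_apply (c j) v + (norm v)\<^sup>2 / (4 * w j)" for j v
  \<comment> \<open>A decomposition is a finitely supported sequence together with a bound
    \<open>N\<close> on its support. The value does not depend on the bound, so two decompositions
    can be given a common length.\<close>
  define I where "I = {(N::nat, z). \<forall>j. z j \<in> Y \<and> (j \<ge> N \<longrightarrow> z j = 0)}"
  define V where "V x = (\<lambda>(N, z). g (x - (\<Sum>j<N. z j)) + (\<Sum>j<N. \<theta> j (z j)))" for x
  define G where "G x = (INF i\<in>I. V x i)" for x
  have den: "norm (c j) + L + 1 > 0" for j using L norm_ge_zero[of "c j"] by linarith
  have w: "w j > 0" for j unfolding w_def using \<delta> den[of j] by simp
  have wb: "w j * (norm (c j) + L)\<^sup>2 \<le> \<delta> * (1/2) ^ Suc j" for j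
  proof -
    have "(norm (c j) + L)\<^sup>2 \<le> (norm (c j) + L + 1)\<^sup>2"
      using L norm_ge_zero[of "c j"] by (intro power_mono) auto
    then have "p * (norm (c j) + L)\<^sup>2 / (norm (c j) + L + 1)\<^sup>2 \<le> p" if "p \<ge> 0" for p :: real
      using den[of j] that by (simp add: divide_le_eq mult_left_mono)
    from this[of "\<delta> * (1/2) ^ Suc j"] show ?thesis using \<delta> by (simp add: w_def)
  qed
  have \<theta>0 [simp]: "\<theta> j 0 = 0" for j by (simp add: \<theta>_def)
  have extend: "V x (M, z) = V x (N, z)" if "(N, z) \<in> I" "N \<le> M" for x M N z
  proof -
    have z0: "z i = 0" if "i \<notin> {..<N}" for i using \<open>(N, z) \<in> I\<close> that by (auto simp: I_def)
    have "(\<Sum>j<M. z j) = (\<Sum>j<N. z j)" "(\<Sum>j<M. \<theta> j (z j)) = (\<Sum>j<N. \<theta> j (z j))"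
      by (rule sum.mono_neutral_right; use that(2) z0 in force)+
    then show ?thesis by (simp add: V_def)
  qed
  have extendI: "(M, z) \<in> I" if "(N, z) \<in> I" "N \<le> M" for M N z using that by (auto simp: I_def)
  have amgm: "- (w j * a\<^sup>2) \<le> X\<^sup>2 / (4 * w j) - a * X" for j a X
  proof -
    have "0 \<le> (X - 2 * w j * a)\<^sup>2 / (4 * w j)" using w[of j] by simp
    also have "\<dots> = X\<^sup>2 / (4 * w j) - a * X + w j * a\<^sup>2"
      using w[of j] by (simp add: power2_eq_square field_simps)
    finally show ?thesis by simp
  qed
  \<comment> \<open>A subgradient of \<open>g\<close> at \<open>x\<close> has norm at most
    \<open>L\<close>. It replaces \<open>g\<close> by an affine minorant, after which each
    \<open>z j\<close> is minimised out separately by completing the square.\<close>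
  have low: "g x - \<delta> \<le> V x i" if iI: "i \<in> I" for x i
  proof -
    obtain N z where i: "i = (N, z)" by (cases i)
    obtain y' :: "'b \<Rightarrow>\<^sub>L real" where y': "\<And>h. blinfun_apply y' h \<le> g (x + h) - g x"
      using convex_subgradient[OF cg Lg] by blast
    have ny: "norm y' \<le> L"
    proof (rule blinfun_norm_leI[OF L])
      fix h show "blinfun_apply y' h \<le> L * norm h" using y'[of h] Lg[of "x + h" x] by simp
    qed
    have \<theta>b: "- (\<delta> * (1/2) ^ Suc j) \<le> \<theta> j v - blinfun_apply y' v" for j v
    proof -
      have "norm (y' - c j) \<le> norm (c j) + L" using ny norm_triangle_ineq4[of y' "c j"] by linarith
      then have "blinfun_apply (y' - c j) v \<le> (norm (c j) + L) * norm v"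
        using blinfun_le_norm[of "y' - c j" v] by (meson mult_right_mono norm_ge_zero order_trans)
      then show ?thesis using amgm[of j "norm (c j) + L" "norm v"] wb[of j]
        by (simp add: \<theta>_def blinfun.diff_left)
    qed
    have "(\<Sum>j<N. \<delta> * (1/2) ^ Suc j) = \<delta> * (1 - (1/2) ^ N)"
    proof (induction N)
      case (Suc N) then show ?case by (simp add: algebra_simps)
    qed simp
    also have "\<dots> \<le> \<delta>" using \<delta> by simp
    finally have "- \<delta> \<le> (\<Sum>j<N. - (\<delta> * (1/2) ^ Suc j))" by (simp add: sum_negf)
    also have "\<dots> \<le> (\<Sum>j<N. \<theta> j (z j) - blinfun_apply y' (z j))" by (intro sum_mono \<theta>b)
    also have "\<dots> = (\<Sum>j<N. \<theta> j (z j)) - blinfun_apply y' (\<Sum>j<N. z j)"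
      by (simp add: sum_subtractf blinfun.sum_right)
    finally show ?thesis using y'[of "- (\<Sum>j<N. z j)"] by (simp add: V_def i blinfun.minus_right)
  qed
  have Gle: "G x \<le> V x i" if "i \<in> I" for x i
    unfolding G_def using that low by (intro cINF_lower bdd_belowI2[where m = "g x - \<delta>"]) auto
  have I0: "(0, \<lambda>_. 0) \<in> I" using subspace_0[OF Y] by (auto simp: I_def)
  have Gge: "b \<le> G x" if "\<And>i. i \<in> I \<Longrightarrow> b \<le> V x i" for b x
    unfolding G_def using I0 that by (intro cINF_greatest) auto
  have near: "\<exists>N z. (N, z) \<in> I \<and> V x (N, z) < G x + e" if "e > 0" for x e
    using Gge[of "G x + e" x] that by (metis add_le_same_cancel1 linorder_not_less surj_pair)
  have convG: "convex_on UNIV G"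
  proof (rule convex_onI)
    fix t :: real and x y :: 'b assume t: "0 < t" "t < 1"
    show "G ((1 - t) *\<^sub>R x + t *\<^sub>R y) \<le> (1 - t) * G x + t * G y"
    proof (rule field_le_epsilon)
      fix e :: real assume e: "e > 0"
      obtain N1 z1 where 1: "(N1, z1) \<in> I" "V x (N1, z1) < G x + e" using near[OF e] by blast
      obtain N2 z2 where 2: "(N2, z2) \<in> I" "V y (N2, z2) < G y + e" using near[OF e] by blast
      define N where "N = max N1 N2"
      define z where "z j = (1 - t) *\<^sub>R z1 j + t *\<^sub>R z2 j" for j
      have zI: "(N, z) \<in> I" using 1(1) 2(1) Y
        by (auto simp: I_def N_def z_def intro!: subspace_add subspace_scale)
      have zs: "(\<Sum>j<N. z j) = (1 - t) *\<^sub>R (\<Sum>j<N. z1 j) + t *\<^sub>R (\<Sum>j<N. z2 j)"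
        by (simp only: z_def sum.distrib scaleR_sum_right)
      have "g ((1 - t) *\<^sub>R x + t *\<^sub>R y - (\<Sum>j<N. z j))
          = g ((1 - t) *\<^sub>R (x - (\<Sum>j<N. z1 j)) + t *\<^sub>R (y - (\<Sum>j<N. z2 j)))"
        unfolding zs by (simp add: algebra_simps)
      also have "\<dots> \<le> (1 - t) * g (x - (\<Sum>j<N. z1 j)) + t * g (y - (\<Sum>j<N. z2 j))"
        using convex_onD[OF cg, of t] t by simp
      finally have a: "g ((1 - t) *\<^sub>R x + t *\<^sub>R y - (\<Sum>j<N. z j)) \<le> \<dots>" .
      have "\<theta> j (z j) \<le> (1 - t) * \<theta> j (z1 j) + t * \<theta> j (z2 j)" for j
      proof -
        have "norm (z j) \<le> (1 - t) * norm (z1 j) + t * norm (z2 j)"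
          using t norm_triangle_ineq[of "(1 - t) *\<^sub>R z1 j" "t *\<^sub>R z2 j"] by (simp add: z_def)
        then have "(norm (z j))\<^sup>2 \<le> ((1 - t) * norm (z1 j) + t * norm (z2 j))\<^sup>2"
          by (intro power_mono) auto
        also have "\<dots> \<le> (1 - t) * (norm (z1 j))\<^sup>2 + t * (norm (z2 j))\<^sup>2"
        proof -
          have "0 \<le> t * (1 - t) * (norm (z1 j) - norm (z2 j))\<^sup>2" using t by simp
          then show ?thesis by (simp add: power2_eq_square algebra_simps)
        qed
        finally have "(norm (z j))\<^sup>2 / (4 * w j) \<le> \<dots> / (4 * w j)"
          using w[of j] by (intro divide_right_mono) auto
        then have "(norm (z j))\<^sup>2 / (4 * w j)
            \<le> (1 - t) * ((norm (z1 j))\<^sup>2 / (4 * w j)) + t * ((norm (z2 j))\<^sup>2 / (4 * w j))"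
          by (simp only: add_divide_distrib times_divide_eq_right)
        moreover have "blinfun_apply (c j) (z j)
            = (1 - t) * blinfun_apply (c j) (z1 j) + t * blinfun_apply (c j) (z2 j)"
          by (simp add: z_def blinfun.add_right blinfun.scaleR_right)
        ultimately show ?thesis unfolding \<theta>_def distrib_left by linarith
      qed
      then have "(\<Sum>j<N. \<theta> j (z j)) \<le> (\<Sum>j<N. (1 - t) * \<theta> j (z1 j) + t * \<theta> j (z2 j))"
        by (intro sum_mono)
      then have b: "(\<Sum>j<N. \<theta> j (z j)) \<le> (1 - t) * (\<Sum>j<N. \<theta> j (z1 j)) + t * (\<Sum>j<N. \<theta> j (z2 j))"
        by (simp add: sum.distrib sum_distrib_left)
      have "G ((1 - t) *\<^sub>R x + t *\<^sub>R y) \<le> V ((1 - t) *\<^sub>R x + t *\<^sub>R y) (N, z)" by (rule Gle[OF zI])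
      also have "\<dots> \<le> (1 - t) * V x (N, z1) + t * V y (N, z2)"
        using a b by (simp add: V_def algebra_simps)
      also have "\<dots> \<le> (1 - t) * (G x + e) + t * (G y + e)"
        using 1 2 t extend[OF 1(1), of N x] extend[OF 2(1), of N y]
        by (intro add_mono mult_left_mono) (auto simp: N_def)
      finally show "G ((1 - t) *\<^sub>R x + t *\<^sub>R y) \<le> (1 - t) * G x + t * G y + e"
        by (simp add: algebra_simps)
    qed
  qed auto
  have LG: "G x - G y \<le> L * norm (x - y)" for x y
  proof -
    have "G x - L * norm (x - y) \<le> G y"
    proof (rule Gge)
      fix i assume i: "i \<in> I"
      obtain N z where iz: "i = (N, z)" by (cases i)
      have "V x i - V y i \<le> L * norm (x - y)"
        using Lg[of "x - (\<Sum>j<N. z j)" "y - (\<Sum>j<N. z j)"] by (simp add: V_def iz)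
      then show "G x - L * norm (x - y) \<le> V y i" using Gle[OF i, of x] by linarith
    qed
    then show ?thesis by simp
  qed
  have smooth: "\<exists>\<rho>>0. \<forall>h\<in>Y. norm h < \<rho> \<longrightarrow> G (x + h) - G x \<le> blinfun_apply y' h + \<epsilon> * norm h"
    if y': "\<And>h. blinfun_apply y' h \<le> G (x + h) - G x" and \<epsilon>: "\<epsilon> > 0" for x y' and \<epsilon> :: real
  proof -
    \<comment> \<open>The six parts are one for the slack \<open>e\<close>, one for replacing
      \<open>y'\<close> by \<open>c j\<close>, and four for the quadratic term.\<close>
    define \<kappa> where "\<kappa> = \<epsilon> / 6"
    have \<kappa>: "\<kappa> > 0" using \<epsilon> by (simp add: \<kappa>_def)
    obtain j where j: "\<And>y. y \<in> Y \<Longrightarrow> \<bar>blinfun_apply y' y - blinfun_apply (c j) y\<bar> \<le> \<kappa> * norm y"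
      using approx[OF \<kappa>, of y'] c by blast
    have "G (x + h) - G x \<le> blinfun_apply y' h + \<epsilon> * norm h"
      if h: "h \<in> Y" "norm h < 4 * w j * \<kappa>" for h
    proof (cases "h = 0")
      case False
      \<comment> \<open>The first bound makes the slack small relative to \<open>norm h\<close>; the
        second keeps the estimate of \<open>norm (z j)\<close> independent of
        \<open>h\<close>.\<close>
      define e where "e = min (\<kappa> * norm h) (w j * \<kappa>\<^sup>2)"
      have e: "e > 0" using False \<kappa> w[of j] by (simp add: e_def)
      obtain N0 z where Nz0: "(N0, z) \<in> I" "V x (N0, z) < G x + e" using near[OF e] by blast
      define N where "N = max N0 (Suc j)"
      have Nz: "(N, z) \<in> I" "V x (N, z) < G x + e" "j < N"
        using Nz0 extend[OF Nz0(1), of N] extendI[OF Nz0(1), of N] by (auto simp: N_def)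
      have zY: "z k \<in> Y" for k using Nz by (auto simp: I_def)
      have step: "G (x + v) - G x \<le> e + blinfun_apply (c j) v + ((norm (z j + v))\<^sup>2 - (norm (z j))\<^sup>2) / (4 * w j)"
        if v: "v \<in> Y" for v
      proof -
        define z' where "z' = z(j := z j + v)"
        have "(N, z') \<in> I" using Nz v Y by (auto simp: I_def z'_def intro: subspace_add)
        then have "G (x + v) \<le> V (x + v) (N, z')" by (rule Gle)
        moreover have "(\<Sum>k<N. z' k) = (\<Sum>k<N. z k) + v"
          using Nz(3) by (simp add: z'_def sum.remove[of "{..<N}" j] algebra_simps)
        moreover have "(\<Sum>k<N. \<theta> k (z' k)) = (\<Sum>k<N. \<theta> k (z k)) + \<theta> j (z j + v) - \<theta> j (z j)"
          using Nz(3) by (simp add: z'_def sum.remove[of "{..<N}" j] algebra_simps)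
        ultimately show ?thesis using Nz(2)
          by (simp add: V_def \<theta>_def blinfun.add_right diff_divide_distrib)
      qed
      define X where "X = norm (z j)"
      \<comment> \<open>Deleting \<open>z j\<close> from the decomposition can lower the value only
        slightly, because \<open>y'\<close> is a subgradient close to \<open>c j\<close>. This is a
        quadratic inequality for \<open>X\<close>.\<close>
      have "- (\<kappa> * X) \<le> e - X\<^sup>2 / (4 * w j)"
        using step[of "- z j"] y'[of "- z j"] j[OF zY[of j]] subspace_neg[OF Y zY[of j]]
        by (simp add: X_def blinfun.minus_right)
      then have "X\<^sup>2 \<le> (e + \<kappa> * X) * (4 * w j)" using w[of j] by (simp add: field_simps)
      also have "\<dots> \<le> (w j * \<kappa>\<^sup>2 + \<kappa> * X) * (4 * w j)"
        using w[of j] by (intro mult_right_mono) (auto simp: e_def)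
      finally have X2: "X * X \<le> 4 * (w j * \<kappa>) * (w j * \<kappa>) + 4 * (w j * \<kappa>) * X"
        by (simp add: power2_eq_square algebra_simps)
      have X: "X \<le> 6 * (w j * \<kappa>)"
      proof (rule ccontr)
        assume n: "\<not> X \<le> 6 * (w j * \<kappa>)"
        have p: "w j * \<kappa> > 0" using w \<kappa> by simp
        have "(w j * \<kappa>) * (6 * (w j * \<kappa>)) \<le> (w j * \<kappa>) * X" using n p by (intro mult_left_mono) auto
        moreover have "6 * (w j * \<kappa>) * X < X * X" using n p by (intro mult_strict_right_mono) auto
        moreover have "X > 0" using n p by linarith
        then have "(w j * \<kappa>) * X > 0" using p by simp
        ultimately show False using X2 by (simp add: algebra_simps)
      qed
      have "(norm (z j + h))\<^sup>2 \<le> (X + norm h)\<^sup>2"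
        unfolding X_def by (intro power_mono norm_triangle_ineq) auto
      then have "((norm (z j + h))\<^sup>2 - (norm (z j))\<^sup>2) / (4 * w j) \<le> (2 * X + norm h) * norm h / (4 * w j)"
        using w[of j] by (intro divide_right_mono) (auto simp: X_def power2_eq_square algebra_simps)
      also have "\<dots> \<le> (16 * (w j * \<kappa>)) * norm h / (4 * w j)"
        using X h(2) w[of j] by (intro divide_right_mono mult_right_mono) auto
      also have "\<dots> = 4 * \<kappa> * norm h" using w[of j] by (simp add: field_simps)
      finally have "((norm (z j + h))\<^sup>2 - (norm (z j))\<^sup>2) / (4 * w j) \<le> 4 * \<kappa> * norm h" .
      moreover have "e \<le> \<kappa> * norm h" by (simp add: e_def)
      moreover have "\<epsilon> * norm h = 6 * \<kappa> * norm h" by (simp add: \<kappa>_def)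
      ultimately show ?thesis using step[OF h(1)] j[OF h(1)] by linarith
    qed simp
    then show ?thesis using w[of j] \<kappa> by (intro exI[of _ "4 * w j * \<kappa>"]) auto
  qed
  have up: "G x \<le> g x" for x using Gle[OF I0, of x] by (simp add: V_def)
  have "smooth_along Y G" unfolding smooth_along_def using smooth by blast
  then show thesis using that[OF convG LG Gge[OF low] up] by blast
qed

section \<open>Variational principles\<close>

lemma near_minimizer:
  fixes f :: "'c \<Rightarrow> real"
  assumes "x0 \<in> M" "\<And>z. z \<in> M \<Longrightarrow> b \<le> f z" "e > 0"
  obtains x where "x \<in> M" "\<And>z. z \<in> M \<Longrightarrow> f x \<le> f z + e"
proof -
  have bdd: "bdd_below (f ` M)" using assms(2) by (auto intro!: bdd_belowI2)
  have "M \<noteq> {}" using assms(1) by auto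
  moreover have "(INF z\<in>M. f z) < (INF z\<in>M. f z) + e" using assms(3) by simp
  ultimately obtain x where x: "x \<in> M" "f x < (INF z\<in>M. f z) + e"
    using cINF_less_iff[OF _ bdd] by blast
  have "f x \<le> f z + e" if "z \<in> M" for z using cINF_lower[OF bdd that] x(2) by linarith
  then show thesis using that x(1) by blast
qed

text \<open>A principle of Borwein-Preiss type in which the penalties only approximate the norm, to
  within \<open>d k\<close>, and may therefore be smooth. Comparing consecutive near-minimisers
  bounds their distance by \<open>d k + (\<sigma> k + \<sigma> (Suc k)) / c k\<close>, and
  summability of \<open>e\<close> makes them converge.\<close>

lemma variational_principle:
  fixes f :: "'b::banach \<Rightarrow> real" and N :: "nat \<Rightarrow> 'b \<Rightarrow> real"
  assumes M: "closed M" "u0 \<in> M" and cont: "continuous_on M f"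
    and low: "\<And>z. z \<in> M \<Longrightarrow> f u0 \<le> f z + \<sigma> 0"
    and c: "\<And>k. c k > 0" "summable c" and \<sigma>: "\<And>k. \<sigma> k > 0"
    and Lip: "\<And>k x y. N k x - N k y \<le> norm (x - y)"
    and N: "\<And>k x. N k x \<le> norm x" "\<And>k x. norm x - d k \<le> N k x"
    and e: "\<And>k. d k + (\<sigma> k + \<sigma> (Suc k)) / c k \<le> e k" "summable e"
  obtains u v where "u \<in> M" "norm (u - u0) \<le> suminf e"
    "\<And>z. z \<in> M \<Longrightarrow> f u + (\<Sum>k. c k * N k (u - v k)) \<le> f z + (\<Sum>k. c k * N k (z - v k))"
    "\<And>z. summable (\<lambda>k. c k * N k (z - v k))"
proof -
  have d0: "0 \<le> d k" for k using N(1)[of k 0] N(2)[of 0 k] by simp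
  \<comment> \<open>A state is the current perturbed function with a point minimising it up to
    \<open>\<sigma> k\<close>; the clause for \<open>k = 0\<close> fixes the initial state.\<close>
  define P where "P k = (\<lambda>(g :: 'b \<Rightarrow> real, u). u \<in> M \<and> (\<forall>z\<in>M. g u \<le> g z + \<sigma> k) \<and> (k = 0 \<longrightarrow> g = f \<and> u = u0))" for k
  define Q where "Q k = (\<lambda>(g :: 'b \<Rightarrow> real, u) (g', u' :: 'b). g' = (\<lambda>z. g z + c k * N k (z - u)))" for k
  have "\<exists>s. \<forall>k. P k (s k) \<and> Q k (s k) (s (Suc k))"
  proof (rule dependent_nat_choice)
    show "\<exists>x. P 0 x" using M low by (intro exI[of _ "(f, u0)"]) (auto simp: P_def)
  next
    fix x :: "('b \<Rightarrow> real) \<times> 'b" and k assume Px: "P k x"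
    obtain g u where x: "x = (g, u)" by (cases x)
    define g' where "g' z = g z + c k * N k (z - u)" for z
    have gm: "u \<in> M" "\<And>z. z \<in> M \<Longrightarrow> g u \<le> g z + \<sigma> k" using Px by (auto simp: P_def x)
    have "g u - \<sigma> k - c k * d k \<le> g' z" if "z \<in> M" for z
    proof -
      have "- d k \<le> N k (z - u)" using N(2)[of "z - u" k] norm_ge_zero[of "z - u"] by linarith
      then have "c k * (- d k) \<le> c k * N k (z - u)"
        by (rule mult_left_mono) (simp add: c(1) less_imp_le)
      then show ?thesis using gm(2)[OF that] by (simp add: g'_def)
    qed
    then obtain u' where "u' \<in> M" "\<And>z. z \<in> M \<Longrightarrow> g' u' \<le> g' z + \<sigma> (Suc k)"
      using near_minimizer[OF gm(1), of "g u - \<sigma> k - c k * d k" g' "\<sigma> (Suc k)"] \<sigma> by blast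
    then have "P (Suc k) (g', u')" by (simp add: P_def)
    moreover have "Q k x (g', u')" by (simp add: Q_def x g'_def fun_eq_iff)
    ultimately show "\<exists>y. P (Suc k) y \<and> Q k x y" by blast
  qed
  then obtain s where s: "\<And>k. P k (s k)" "\<And>k. Q k (s k) (s (Suc k))" by blast
  define F where "F k = fst (s k)" for k
  define v where "v k = snd (s k)" for k
  have sk: "s k = (F k, v k)" for k by (simp add: F_def v_def)
  have F0: "F 0 = f" "v 0 = u0" using s(1)[of 0] by (auto simp: P_def sk)
  have FS: "F (Suc k) z = F k z + c k * N k (z - v k)" for k z using s(2)[of k] by (auto simp: Q_def sk)
  have vM: "v k \<in> M" and vmin: "z \<in> M \<Longrightarrow> F k (v k) \<le> F k z + \<sigma> k" for k z
    using s(1)[of k] by (auto simp: P_def sk)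
  have Fsum: "F k z = f z + (\<Sum>j<k. c j * N j (z - v j))" for k z
    by (induction k) (auto simp: F0 FS)
  have step: "norm (v (Suc k) - v k) \<le> e k" for k
  proof -
    have "F k (v (Suc k)) + c k * N k (v (Suc k) - v k) \<le> F k (v k) + c k * N k 0 + \<sigma> (Suc k)"
      using vmin[OF vM[of k], of "Suc k"] by (simp add: FS)
    moreover have "c k * N k 0 \<le> 0" using c(1)[of k] N(1)[of k 0] by (simp add: mult_nonneg_nonpos)
    moreover have "F k (v k) \<le> F k (v (Suc k)) + \<sigma> k" by (intro vmin vM)
    ultimately have "c k * N k (v (Suc k) - v k) \<le> \<sigma> k + \<sigma> (Suc k)" by simp
    then have "N k (v (Suc k) - v k) \<le> (\<sigma> k + \<sigma> (Suc k)) / c k" using c(1)[of k] by (simp add: field_simps)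
    then show ?thesis using N(2)[of "v (Suc k) - v k" k] e(1)[of k] by linarith
  qed
  have e0: "0 \<le> e k" for k using step[of k] norm_ge_zero order_trans by blast
  have sn: "summable (\<lambda>k. norm (v (Suc k) - v k))"
    by (rule summable_comparison_test'[OF e(2), of 0]) (simp add: step)
  have dist: "norm (v k - u0) \<le> suminf e" for k
  proof -
    have "norm (v k - u0) \<le> (\<Sum>j<k. e j)"
    proof (induction k)
      case (Suc k)
      have "norm (v (Suc k) - u0) \<le> norm (v (Suc k) - v k) + norm (v k - u0)"
        using norm_triangle_ineq[of "v (Suc k) - v k" "v k - u0"] by simp
      then show ?case using Suc step[of k] by simp
    qed (simp add: F0)
    also have "\<dots> \<le> suminf e" using e0 e(2) by (intro sum_le_suminf) auto
    finally show ?thesis .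
  qed
  have "summable (\<lambda>k. v (Suc k) - v k)" using sn by (rule summable_norm_cancel)
  then have "convergent (\<lambda>k. \<Sum>j<k. v (Suc j) - v j)" by (simp add: summable_iff_convergent)
  moreover have "(\<Sum>j<k. v (Suc j) - v j) = v k - u0" for k using sum_lessThan_telescope[of v k] F0 by simp
  ultimately obtain l where "(\<lambda>k. v k - u0) \<longlonglongrightarrow> l" by (auto simp: convergent_def)
  then have "(\<lambda>k. (v k - u0) + u0) \<longlonglongrightarrow> l + u0" by (intro tendsto_add tendsto_const)
  then obtain u where u: "v \<longlonglongrightarrow> u" by auto
  have uM: "u \<in> M" using closed_sequentially[OF M(1) vM u] .
  have nu: "norm (u - u0) \<le> suminf e"
    by (rule Lim_bounded[of "\<lambda>k. norm (v k - u0)" _ 0]) (use dist u in \<open>auto intro!: tendsto_intros\<close>)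
  have dM: "d k \<le> suminf e" for k
  proof -
    have "0 \<le> (\<sigma> k + \<sigma> (Suc k)) / c k" using c(1)[of k] \<sigma>[of k] \<sigma>[of "Suc k"] by simp
    then have "d k \<le> e k" using e(1)[of k] by linarith
    also have "\<dots> \<le> suminf e" using sum_le_suminf[OF e(2), of "{k}"] e0 by auto
    finally show ?thesis .
  qed
  have Nb: "\<bar>N k (z - v k)\<bar> \<le> norm (z - u0) + 2 * suminf e" for k z
  proof -
    have "norm (z - v k) \<le> norm (z - u0) + norm (v k - u0)"
      using norm_triangle_ineq4[of "z - u0" "v k - u0"] by simp
    then show ?thesis using N(1)[of k "z - v k"] N(2)[of "z - v k" k] dist[of k] dM[of k] d0[of k]
        norm_ge_zero[of "z - v k"] by linarith
  qed
  have sm: "summable (\<lambda>k. c k * N k (z - v k))" for z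
  proof (rule summable_comparison_test'[where N = 0])
    show "summable (\<lambda>k. c k * (norm (z - u0) + 2 * suminf e))" using c(2) by (rule summable_mult2)
    show "norm (c k * N k (z - v k)) \<le> c k * (norm (z - u0) + 2 * suminf e)" for k
      using Nb[of k z] c(1)[of k] by (simp add: abs_mult)
  qed
  define \<rho> where "\<rho> z = (\<Sum>k. c k * N k (z - v k))" for z
  have "f u + \<rho> u \<le> f z + \<rho> z" if z: "z \<in> M" for z
  proof (rule LIMSEQ_le)
    show "(\<lambda>k. F k z + \<sigma> k) \<longlonglongrightarrow> f z + \<rho> z"
    proof -
      have "(\<lambda>k. F k z) \<longlonglongrightarrow> f z + \<rho> z"
        unfolding Fsum \<rho>_def using sm by (intro tendsto_add tendsto_const summable_LIMSEQ)
      moreover have "\<sigma> \<longlonglongrightarrow> 0"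
      proof (rule Lim_null_comparison[where g = "\<lambda>k. e k * c k"])
        have "\<sigma> k \<le> e k * c k" for k
        proof -
          have "(\<sigma> k + \<sigma> (Suc k)) / c k \<le> e k" using e(1)[of k] d0[of k] by linarith
          then show ?thesis using c(1)[of k] \<sigma>[of "Suc k"] by (simp add: field_simps)
        qed
        then show "\<forall>\<^sub>F k in sequentially. norm (\<sigma> k) \<le> e k * c k"
          using \<sigma> by (simp add: less_imp_le)
        show "(\<lambda>k. e k * c k) \<longlonglongrightarrow> 0"
          using tendsto_mult[OF summable_LIMSEQ_zero[OF e(2)] summable_LIMSEQ_zero[OF c(2)]] by simp
      qed
      ultimately show ?thesis using tendsto_add by fastforce
    qed
    show "(\<lambda>k. F k (v k)) \<longlonglongrightarrow> f u + \<rho> u"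
    proof -
      have "(\<lambda>k. f (v k)) \<longlonglongrightarrow> f u"
        using cont u uM vM by (auto simp: continuous_on_sequentially o_def)
      moreover have "(\<lambda>k. F k u - f u) \<longlonglongrightarrow> \<rho> u"
        unfolding Fsum \<rho>_def using summable_LIMSEQ[OF sm] by simp
      \<comment> \<open>All partial sums of penalties share the Lipschitz constant
        \<open>suminf c\<close>, so evaluating them at \<open>v k\<close> instead of
        \<open>u\<close> costs nothing in the limit.\<close>
      moreover have "(\<lambda>k. (F k (v k) - f (v k)) - (F k u - f u)) \<longlonglongrightarrow> 0"
      proof (rule Lim_null_comparison[where g = "\<lambda>k. suminf c * norm (v k - u)"])
        have "\<bar>(F k (v k) - f (v k)) - (F k u - f u)\<bar> \<le> suminf c * norm (v k - u)" for k
        proof -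
          have "(F k (v k) - f (v k)) - (F k u - f u) = (\<Sum>j<k. c j * (N j (v k - v j) - N j (u - v j)))"
            by (simp add: Fsum sum_subtractf algebra_simps)
          also have "\<bar>\<dots>\<bar> \<le> (\<Sum>j<k. \<bar>c j * (N j (v k - v j) - N j (u - v j))\<bar>)" by (rule sum_abs)
          also have "\<dots> \<le> (\<Sum>j<k. c j * norm (v k - u))"
          proof (rule sum_mono)
            fix j
            have "\<bar>N j (v k - v j) - N j (u - v j)\<bar> \<le> norm (v k - u)"
              using Lip[of j "v k - v j" "u - v j"] Lip[of j "u - v j" "v k - v j"]
              by (simp add: abs_le_iff norm_minus_commute)
            then show "\<bar>c j * (N j (v k - v j) - N j (u - v j))\<bar> \<le> c j * norm (v k - u)"
              using c(1)[of j] by (simp add: abs_mult)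
          qed
          also have "\<dots> \<le> suminf c * norm (v k - u)"
            using c sum_le_suminf[OF c(2), of "{..<k}"]
            by (simp add: sum_distrib_right[symmetric] mult_right_mono less_imp_le)
          finally show ?thesis .
        qed
        then show "\<forall>\<^sub>F k in sequentially. norm ((F k (v k) - f (v k)) - (F k u - f u)) \<le> suminf c * norm (v k - u)"
          by simp
        have "(\<lambda>k. norm (v k - u)) \<longlonglongrightarrow> 0" using u by (simp add: LIM_zero tendsto_norm_zero)
        then show "(\<lambda>k. suminf c * norm (v k - u)) \<longlonglongrightarrow> 0" by (rule tendsto_mult_right_zero)
      qed
      ultimately have "(\<lambda>k. f (v k) + (F k u - f u) + ((F k (v k) - f (v k)) - (F k u - f u))) \<longlonglongrightarrow> f u + \<rho> u + 0"
        by (intro tendsto_add)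
      then show ?thesis by simp
    qed
    show "\<exists>K. \<forall>k\<ge>K. F k (v k) \<le> F k z + \<sigma> k" using vmin[OF z] by blast
  qed
  then show thesis using that[OF uM nu _ sm] by (simp add: \<rho>_def)
qed

text \<open>The sets \<open>S u\<close> are the lower sections of the order in which
  \<open>z\<close> precedes \<open>u\<close> if
  \<open>f z + \<epsilon> * norm (z - u) \<le> f u\<close>. Along successive near-minimisers over
  these nested sections the values decrease and control the distances, and the limit is a minimal
  element.\<close>

lemma ekeland:
  fixes f :: "'b::banach \<Rightarrow> real"
  assumes M: "closed M" "u0 \<in> M" and cont: "continuous_on M f"
    and low: "\<And>z. z \<in> M \<Longrightarrow> b \<le> f z" and \<epsilon>: "\<epsilon> > 0"
  obtains u where "u \<in> M" "f u + \<epsilon> * norm (u - u0) \<le> f u0"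
    "\<And>z. z \<in> M \<Longrightarrow> f u \<le> f z + \<epsilon> * norm (z - u)"
proof -
  define S where "S u = {z \<in> M. f z + \<epsilon> * norm (z - u) \<le> f u}" for u
  have trans: "z \<in> S u" if "z \<in> S v" "v \<in> S u" for u v z
  proof -
    have "\<epsilon> * norm (z - u) \<le> \<epsilon> * norm (z - v) + \<epsilon> * norm (v - u)"
      using \<epsilon> norm_triangle_ineq[of "z - v" "v - u"] by (simp add: distrib_left[symmetric])
    then show ?thesis using that by (auto simp: S_def)
  qed
  have "\<exists>v. \<forall>k. (v k \<in> M \<and> (k = 0 \<longrightarrow> v k = u0)) \<and>
      v (Suc k) \<in> S (v k) \<and> (\<forall>z\<in>S (v k). f (v (Suc k)) \<le> f z + (1/2) ^ k)"
  proof (rule dependent_nat_choice)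
    show "\<exists>u. u \<in> M \<and> ((0::nat) = 0 \<longrightarrow> u = u0)" using M by blast
    fix u and k :: nat assume "u \<in> M \<and> (k = 0 \<longrightarrow> u = u0)"
    then have "u \<in> S u" by (simp add: S_def)
    moreover have "b \<le> f z" if "z \<in> S u" for z using low that by (simp add: S_def)
    ultimately obtain v where "v \<in> S u" "\<And>z. z \<in> S u \<Longrightarrow> f v \<le> f z + (1/2) ^ k"
      using near_minimizer[of u "S u" b f "(1/2) ^ k"] by auto
    then show "\<exists>v. (v \<in> M \<and> (Suc k = 0 \<longrightarrow> v = u0)) \<and> v \<in> S u \<and> (\<forall>z\<in>S u. f v \<le> f z + (1/2) ^ k)"
      by (auto simp: S_def)
  qed
  then obtain v where vM: "\<And>k. v k \<in> M" and v0: "v 0 = u0" and vS: "\<And>k. v (Suc k) \<in> S (v k)"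
    and vmin: "\<And>k z. z \<in> S (v k) \<Longrightarrow> f (v (Suc k)) \<le> f z + (1/2) ^ k" by metis
  have tail: "v m \<in> S (v k)" if "k \<le> m" for k m
    using that
  proof (induction m rule: dec_induct)
    case base
    then show ?case using vM by (simp add: S_def)
  next
    case (step m)
    then show ?case using trans vS by blast
  qed
  then have diff: "\<epsilon> * norm (v m - v k) \<le> f (v k) - f (v m)" if "k \<le> m" for k m
    using that by (force simp: S_def)
  have "decseq (\<lambda>k. f (v k))"
    unfolding decseq_def using diff \<epsilon> by (smt (verit) mult_nonneg_nonneg norm_ge_zero)
  then obtain l where l: "(\<lambda>k. f (v k)) \<longlonglongrightarrow> l" "\<And>k. l \<le> f (v k)"
    using decseq_convergent[of "\<lambda>k. f (v k)" b] low vM by blast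
  have "Cauchy v"
  proof (rule CauchyI')
    fix e :: real assume e: "e > 0"
    then have "\<forall>\<^sub>F k in sequentially. f (v k) < l + \<epsilon> * e" using l(1) \<epsilon> by (intro order_tendstoD(2)) auto
    then obtain K where K: "\<And>k. k \<ge> K \<Longrightarrow> f (v k) < l + \<epsilon> * e" by (auto simp: eventually_sequentially)
    have "norm (v k - v m) < e" if "k \<ge> K" "m > k" for k m
    proof -
      have "\<epsilon> * norm (v m - v k) < \<epsilon> * e" using diff[of k m] that K[of k] l(2)[of m] by simp
      then show ?thesis using \<epsilon> by (simp add: norm_minus_commute)
    qed
    then show "\<exists>K. \<forall>k\<ge>K. \<forall>m>k. dist (v k) (v m) < e" by (auto simp: dist_norm)
  qed
  then obtain u where u: "v \<longlonglongrightarrow> u" using Cauchy_convergent convergent_def by blast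
  have uM: "u \<in> M" using closed_sequentially[OF M(1) vM u] .
  have fu: "(\<lambda>k. f (v k)) \<longlonglongrightarrow> f u" using cont u uM vM by (auto simp: continuous_on_sequentially o_def)
  have uS: "u \<in> S (v k)" for k
  proof -
    have "f u + \<epsilon> * norm (u - v k) \<le> f (v k)"
    proof (rule tendsto_upperbound)
      show "(\<lambda>m. f (v m) + \<epsilon> * norm (v m - v k)) \<longlonglongrightarrow> f u + \<epsilon> * norm (u - v k)"
        by (intro tendsto_intros fu u)
      show "\<forall>\<^sub>F m in sequentially. f (v m) + \<epsilon> * norm (v m - v k) \<le> f (v k)"
        using eventually_ge_at_top[of k] by eventually_elim (use diff in force)
    qed simp
    then show ?thesis using uM by (simp add: S_def)
  qed
  show thesis
  proof (rule that[OF uM])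
    show "f u + \<epsilon> * norm (u - u0) \<le> f u0" using uS[of 0] v0 by (simp add: S_def)
    fix z assume z: "z \<in> M"
    show "f u \<le> f z + \<epsilon> * norm (z - u)"
    proof (rule ccontr)
      \<comment> \<open>A violating \<open>z\<close> precedes \<open>u\<close>, hence lies in every
        \<open>S (v k)\<close>. The near-minimality of the sequence then forces
        \<open>f u \<le> f z\<close>, which contradicts the violation.\<close>
      assume n: "\<not> ?thesis"
      then have "z \<in> S u" using z by (simp add: S_def)
      then have "f (v (Suc k)) \<le> f z + (1/2) ^ k" for k using trans[OF _ uS] vmin by blast
      moreover have "(\<lambda>k. f z + (1/2) ^ k) \<longlonglongrightarrow> f z + 0" by (intro tendsto_intros LIMSEQ_power_zero) simp
      ultimately have "f u \<le> f z" using LIMSEQ_le[OF LIMSEQ_Suc[OF fu]] by (metis add.right_neutral)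
      moreover have "0 \<le> \<epsilon> * norm (z - u)" using \<epsilon> by simp
      ultimately show False using n by linarith
    qed
  qed
qed

section \<open>Frechet normals at perturbed minima\<close>

text \<open>A Loewenheim-Skolem argument. Binary operations cover both rational linear combinations
  and, by ignoring an argument, selections that depend on one point.\<close>

lemma countable_operation_closure:
  fixes ops :: "'i::countable \<Rightarrow> 'b \<Rightarrow> 'b \<Rightarrow> 'b"
  assumes A: "countable A" "A \<subseteq> E" and E: "\<And>i x y. x \<in> E \<Longrightarrow> y \<in> E \<Longrightarrow> ops i x y \<in> E"
  obtains D where "countable D" "A \<subseteq> D" "D \<subseteq> E" "\<And>i x y. x \<in> D \<Longrightarrow> y \<in> D \<Longrightarrow> ops i x y \<in> D"
proof -
  define step where "step S = S \<union> (\<Union>i. \<Union>x\<in>S. \<Union>y\<in>S. {ops i x y})" for S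
  define T where "T k = (step ^^ k) A" for k
  have T0: "T 0 = A" and TS: "T (Suc k) = step (T k)" for k by (simp_all add: T_def)
  have cT: "countable (T k)" for k
    by (induction k) (auto simp: T0 TS step_def A intro!: countable_Un countable_UN)
  have TE: "T k \<subseteq> E" for k
  proof (induction k)
    case (Suc k) then show ?case using E by (simp add: TS step_def) blast
  qed (use A T0 in auto)
  have "T k \<subseteq> T (Suc k)" for k by (auto simp: TS step_def)
  then have mono: "T k \<subseteq> T m" if "k \<le> m" for k m using that by (rule lift_Suc_mono_le)
  show thesis
  proof (rule that[of "\<Union>k. T k"])
    show "countable (\<Union>k. T k)" using cT by (intro countable_UN) auto
    show "A \<subseteq> (\<Union>k. T k)" using T0 by blast
    show "(\<Union>k. T k) \<subseteq> E" using TE by blast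
    fix i x y assume "x \<in> (\<Union>k. T k)" "y \<in> (\<Union>k. T k)"
    then obtain k m where "x \<in> T k" "y \<in> T m" by blast
    then have "x \<in> T (max k m)" "y \<in> T (max k m)" using mono[of k "max k m"] mono[of m "max k m"] by auto
    then have "ops i x y \<in> T (Suc (max k m))" by (auto simp: TS step_def)
    then show "ops i x y \<in> (\<Union>k. T k)" by blast
  qed
qed

text \<open>Approximation from strictly above keeps rational substitutes of nonnegative coefficients
  nonnegative.\<close>

lemma rational_sequence:
  obtains r :: "nat \<Rightarrow> rat" where "(\<lambda>n. of_rat (r n) :: real) \<longlonglongrightarrow> x" "\<And>n. x < of_rat (r n)"
proof -
  have "\<exists>q. x < of_rat q \<and> of_rat q < x + inverse (real (Suc n))" for n
    by (intro of_rat_dense) simp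
  then obtain r where r: "\<And>n. x < of_rat (r n)" "\<And>n. of_rat (r n) < x + inverse (real (Suc n))" by metis
  have "(\<lambda>n. of_rat (r n) :: real) \<longlonglongrightarrow> x"
  proof (rule tendsto_sandwich[of "\<lambda>_. x"])
    show "(\<lambda>n. x + inverse (real (Suc n))) \<longlonglongrightarrow> x"
      using tendsto_add[OF tendsto_const[of x] LIMSEQ_inverse_real_of_nat] by simp
    show "\<forall>\<^sub>F n in sequentially. x \<le> of_rat (r n)"
      using r(1) by (intro always_eventually allI less_imp_le)
    show "\<forall>\<^sub>F n in sequentially. of_rat (r n) \<le> x + inverse (real (Suc n))"
      using r(2) by (intro always_eventually allI less_imp_le)
  qed simp
  then show thesis using r that by blast
qed

lemma subspace_closure_rational:
  fixes D :: "'b::real_normed_vector set"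
  assumes ne: "D \<noteq> {}" and D: "\<And>r s x y. x \<in> D \<Longrightarrow> y \<in> D \<Longrightarrow> of_rat r *\<^sub>R x + of_rat s *\<^sub>R y \<in> D"
  shows "subspace (closure D)"
proof (rule subspaceI)
  obtain x where "x \<in> D" using ne by auto
  then show "0 \<in> closure D" using D[of x x 0 0] closure_subset by auto
next
  fix x y assume "x \<in> closure D" "y \<in> closure D"
  then obtain f g where f: "\<And>n. f n \<in> D" "f \<longlonglongrightarrow> x" and g: "\<And>n. g n \<in> D" "g \<longlonglongrightarrow> y"
    unfolding closure_sequential by metis
  have "f n + g n \<in> D" for n using D[OF f(1)[of n] g(1)[of n], of 1 1] by simp
  then show "x + y \<in> closure D" using tendsto_add[OF f(2) g(2)] unfolding closure_sequential by metis
next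
  fix c :: real and x assume "x \<in> closure D"
  then obtain f where f: "\<And>n. f n \<in> D" "f \<longlonglongrightarrow> x" unfolding closure_sequential by metis
  obtain r where r: "(\<lambda>n. of_rat (r n) :: real) \<longlonglongrightarrow> c" using rational_sequence by blast
  have "of_rat (r n) *\<^sub>R f n \<in> D" for n using D[OF f(1)[of n] f(1)[of n], of "r n" 0] by simp
  then show "c *\<^sub>R x \<in> closure D" using tendsto_scaleR[OF r f(2)]
    unfolding closure_sequential by (intro exI[of _ "\<lambda>n. of_rat (r n) *\<^sub>R f n"]) auto
qed

lemma uniform_positive_bound:
  fixes a :: "nat \<Rightarrow> real"
  assumes "\<And>j. j < m \<Longrightarrow> 0 < a j"
  obtains e where "0 < e" "\<And>j. j < m \<Longrightarrow> e \<le> a j"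
proof (rule that[of "Min (insert 1 (a ` {..<m}))"])
  show "0 < Min (insert 1 (a ` {..<m}))" using assms by (subst Min_gr_iff) auto
qed (auto intro!: Min_le)

section \<open>Approximate subgradients and separable reduction\<close>

lemma continuous_on_one_sided_lipschitz:
  fixes f :: "'b::real_normed_vector \<Rightarrow> real"
  assumes "\<And>x y. f x - f y \<le> L * norm (x - y)" "L \<ge> 0"
  shows "continuous_on A f"
proof (rule lipschitz_on_continuous_on[OF lipschitz_onI])
  show "dist (f x) (f y) \<le> L * dist x y" for x y
    using assms(1)[of x y] assms(1)[of y x] by (simp add: dist_norm abs_le_iff norm_minus_commute)
qed (rule assms(2))

text \<open>The bound that defines approximate subgradients of \<open>g\<close> at \<open>u\<close>.
  The constant error stems from replacing \<open>g\<close> by a uniform approximation, the error in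
  the slope from the perturbation added by the variational principle.\<close>

definition subgradient_bound :: "('b::real_normed_vector \<Rightarrow> real) \<Rightarrow> real \<Rightarrow> 'b \<Rightarrow> 'b \<Rightarrow> real" where
  "subgradient_bound g \<beta> u h = g (u + h) - g u + \<beta> + \<beta> * norm h"

lemma subgradient_bound_convex:
  fixes g :: "'b::real_normed_vector \<Rightarrow> real"
  assumes "convex_on UNIV g" "\<beta> \<ge> 0"
  shows "convex_on UNIV (subgradient_bound g \<beta> u)"
proof -
  have "convex_on UNIV (\<lambda>h. (g (u + h) + (\<beta> - g u)) + \<beta> * norm h)"
    using assms by (intro convex_on_add convex_on_cmul convex_on_norm_UNIV convex_on_shift[OF assms(1), of u])
      (simp_all add: convex_on_const)
  then show ?thesis by (simp add: subgradient_bound_def[abs_def] algebra_simps)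
qed

lemma subgradient_bound_lipschitz:
  assumes "\<And>x y. g x - g y \<le> L * norm (x - y)" "\<beta> \<ge> 0"
  shows "subgradient_bound g \<beta> u h - subgradient_bound g \<beta> u h' \<le> (L + \<beta>) * norm (h - h')"
proof -
  have "\<beta> * norm h - \<beta> * norm h' \<le> \<beta> * norm (h - h')"
    using assms(2) norm_triangle_ineq2[of h h'] by (simp add: right_diff_distrib[symmetric] mult_left_mono)
  then show ?thesis using assms(1)[of "u + h" "u + h'"]
    by (simp add: subgradient_bound_def algebra_simps)
qed

lemma subgradient_bound_lipschitz2:
  assumes g: "\<And>x y. g x - g y \<le> L * norm (x - y)" and "\<beta> \<ge> 0"
  shows "subgradient_bound g \<beta> u h - subgradient_bound g \<beta> u' h'
    \<le> 2 * L * norm (u - u') + (L + \<beta>) * norm (h - h')"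
proof -
  have "g (u + h') - g (u' + h') \<le> L * norm (u - u')" "g u' - g u \<le> L * norm (u - u')"
    using g[of "u + h'" "u' + h'"] g[of u' u] by (simp_all add: norm_minus_commute)
  then have "subgradient_bound g \<beta> u h' - subgradient_bound g \<beta> u' h' \<le> 2 * L * norm (u - u')"
    by (simp add: subgradient_bound_def)
  then show ?thesis using subgradient_bound_lipschitz[OF assms, of u h h'] by linarith
qed

definition frechet_normal :: "'b::real_normed_vector set \<Rightarrow> 'b \<Rightarrow> ('b \<Rightarrow>\<^sub>L real) \<Rightarrow> bool" where
  "frechet_normal S u x' \<longleftrightarrow>
     (\<forall>\<epsilon>>0. \<exists>\<delta>>0. \<forall>s\<in>S. norm (s - u) < \<delta> \<longrightarrow> blinfun_apply x' (s - u) \<le> \<epsilon> * norm (s - u))"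

text \<open>By the sandwich theorem, a normal at \<open>u\<close> subject to the bound fails to exist exactly when
  finitely many points of \<open>S\<close> near \<open>u\<close> violate a strict inequality. The countable set \<open>D\<close> is closed
  under choosing such points for all rational data, so that a violation in \<open>S\<close> entails one in the
  separable part of \<open>S\<close>.\<close>

lemma separable_reduction:
  fixes g :: "'b::real_normed_vector \<Rightarrow> real"
  assumes E0: "subspace E0" "S \<subseteq> E0" "\<omega> \<in> E0"
    and cg: "convex_on UNIV g" and L: "L \<ge> 0" and Lg: "\<And>x y. g x - g y \<le> L * norm (x - y)" and \<beta>: "\<beta> > 0"
  obtains D where "countable D" "D \<subseteq> E0" "\<omega> \<in> D" "subspace (closure D)"
    "\<And>u y'. u \<in> S \<Longrightarrow> u \<in> closure D \<Longrightarrow> frechet_normal (S \<inter> closure D) u y' \<Longrightarrow>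
       (\<And>h. - blinfun_apply y' h \<le> subgradient_bound g \<beta> u h) \<Longrightarrow>
       \<exists>x'. frechet_normal S u x' \<and> (\<forall>h. - blinfun_apply x' h \<le> subgradient_bound g \<beta> u h)"
proof -
  let ?q = "subgradient_bound g \<beta>"
  define lc where "lc l s u = (\<Sum>j<length l. (of_rat (fst (l ! j)) :: real) *\<^sub>R (s j - u))"
    for l :: "(rat \<times> rat) list" and s :: "nat \<Rightarrow> 'b" and u
  \<comment> \<open>Each list entry holds a rational coefficient and a rational radius. No
    functional occurs here, so one selection serves every normal that may later arise on the
    separable part.\<close>
  define viol where "viol l b u s \<longleftrightarrow> (\<forall>j<length l. s j \<in> S \<and> norm (s j - u) < of_rat (snd (l ! j)))
      \<and> ?q u (lc l s u) < of_rat b" for l :: "(rat \<times> rat) list" and b :: rat and u s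
  define pick where "pick l b u = (SOME s. viol l b u s)" for l b u
  define ops where "ops i x y = (case i of Inl (r, s) \<Rightarrow> of_rat r *\<^sub>R x + of_rat s *\<^sub>R y
      | Inr (l, b, j) \<Rightarrow> if (\<exists>s. viol l b x s) \<and> j < length l then pick l b x j else x)"
    for i :: "(rat \<times> rat) + ((rat \<times> rat) list \<times> rat \<times> nat)" and x y
  have pick: "viol l b u (pick l b u)" if "\<exists>s. viol l b u s" for l b u
    unfolding pick_def using that by (rule someI_ex)
  have opsE: "ops i x y \<in> E0" if "x \<in> E0" "y \<in> E0" for i x y
  proof (cases i)
    case (Inl p)
    then show ?thesis using that E0(1) by (cases p) (auto simp: ops_def intro: subspace_add subspace_scale)
  next
    case (Inr p)
    obtain l b j where p: "p = (l, b, j)" by (cases p)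
    show ?thesis
    proof (cases "(\<exists>s. viol l b x s) \<and> j < length l")
      case True
      then have "viol l b x (pick l b x)" by (intro pick) auto
      then have "pick l b x j \<in> S" using True unfolding viol_def by blast
      then show ?thesis using True E0(2) by (auto simp: ops_def Inr p)
    next
      case False
      then show ?thesis using that by (auto simp: ops_def Inr p)
    qed
  qed
  obtain D where D: "countable D" "{\<omega>} \<subseteq> D" "D \<subseteq> E0" and Dops: "\<And>i x y. x \<in> D \<Longrightarrow> y \<in> D \<Longrightarrow> ops i x y \<in> D"
    using countable_operation_closure[of "{\<omega>}" E0 ops] E0(3) opsE by auto
  have "of_rat r *\<^sub>R x + of_rat s *\<^sub>R y \<in> D" if "x \<in> D" "y \<in> D" for r s x y
    using Dops[OF that, of "Inl (r, s)"] by (simp add: ops_def)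
  then have sub: "subspace (closure D)" using D(2) by (intro subspace_closure_rational) auto
  have Dpick: "pick l b x j \<in> D" if "x \<in> D" "\<exists>s. viol l b x s" "j < length l" for l b x j
    using Dops[OF that(1) that(1), of "Inr (l, b, j)"] that by (simp add: ops_def)
  have "\<exists>x'. frechet_normal S u x' \<and> (\<forall>h. - blinfun_apply x' h \<le> ?q u h)"
    if u: "u \<in> S" "u \<in> closure D" and fn: "frechet_normal (S \<inter> closure D) u y'"
      and y': "\<And>h. - blinfun_apply y' h \<le> ?q u h" for u y'
  proof -
    \<comment> \<open>These rational pairs record how fast \<open>y'\<close> grows near
      \<open>u\<close> on the separable part of \<open>S\<close>. The functional \<open>x'\<close>
      is required to obey the same bounds on all of \<open>S\<close>, which suffices for
      normality.\<close>
    define C where "C = {(c :: rat, \<rho> :: rat). \<forall>s\<in>S \<inter> closure D. norm (s - u) < of_rat \<rho> \<longrightarrow>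
        blinfun_apply y' (s - u) \<le> of_rat c}"
    define ok where "ok = (\<lambda>(l :: real, s, c, \<rho>). l \<ge> 0 \<and> s \<in> S \<and> (c, \<rho>) \<in> C \<and> norm (s - u) < of_rat \<rho>)"
    define vec where "vec = (\<lambda>(l :: real, s, c :: rat, \<rho> :: rat). l *\<^sub>R (s - u))"
    define cst where "cst = (\<lambda>(l :: real, s :: 'b, c :: rat, \<rho> :: rat). l * of_rat c)"
    define K where "K = {(sum_list (map vec xs), sum_list (map cst xs)) | xs. \<forall>x\<in>set xs. ok x}"
    have "0 \<le> c + ?q u s" if sc: "(s, c) \<in> K" for s c
    proof (rule ccontr)
      assume neg: "\<not> 0 \<le> c + ?q u s"
      obtain xs where xs: "s = sum_list (map vec xs)" "c = sum_list (map cst xs)" "\<And>x. x \<in> set xs \<Longrightarrow> ok x"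
        using sc by (auto simp: K_def)
      define m where "m = length xs"
      define lam where "lam j = fst (xs ! j)" for j
      define p where "p j = fst (snd (xs ! j))" for j
      define cc where "cc j = fst (snd (snd (xs ! j)))" for j
      define \<rho> where "\<rho> j = snd (snd (snd (xs ! j)))" for j
      have xsj: "xs ! j = (lam j, p j, cc j, \<rho> j)" for j by (simp add: lam_def p_def cc_def \<rho>_def)
      have okc: "ok (xs ! j)" if "j < m" for j using that by (intro xs(3)) (simp add: m_def)
      have okj: "lam j \<ge> 0" "p j \<in> S" "(cc j, \<rho> j) \<in> C" "norm (p j - u) < of_rat (\<rho> j)" if "j < m" for j
        using okc[OF that] by (auto simp: xsj ok_def)
      have s: "s = (\<Sum>j<m. lam j *\<^sub>R (p j - u))" and c: "c = (\<Sum>j<m. lam j * of_rat (cc j))"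
        by (simp_all add: xs sum_list_sum_nth m_def xsj vec_def cst_def atLeast0LessThan)
      have "\<exists>r :: nat \<Rightarrow> rat. (\<lambda>n. of_rat (r n) :: real) \<longlonglongrightarrow> lam j \<and> (\<forall>n. lam j < of_rat (r n))" for j
        using rational_sequence by metis
      then obtain r where r: "\<And>j. (\<lambda>n. of_rat (r j n) :: real) \<longlonglongrightarrow> lam j" "\<And>j n. lam j < of_rat (r j n)"
        by metis
      have qcont: "continuous_on UNIV (?q u)"
        using subgradient_bound_lipschitz[OF Lg] \<beta> L
        by (intro continuous_on_one_sided_lipschitz[of _ "L + \<beta>"]) auto
      have "(\<lambda>n. (\<Sum>j<m. of_rat (r j n) * of_rat (cc j)) + ?q u (\<Sum>j<m. of_rat (r j n) *\<^sub>R (p j - u)))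
          \<longlonglongrightarrow> c + ?q u s"
        unfolding s c
        by (intro tendsto_add tendsto_sum tendsto_mult r tendsto_const
            continuous_on_tendsto_compose[OF qcont] tendsto_scaleR) auto
      then have "\<forall>\<^sub>F n in sequentially.
          (\<Sum>j<m. of_rat (r j n) * of_rat (cc j)) + ?q u (\<Sum>j<m. of_rat (r j n) *\<^sub>R (p j - u)) < 0"
        using neg by (intro order_tendstoD(2)[where a = 0]) auto
      then obtain n where n: "(\<Sum>j<m. of_rat (r j n) * of_rat (cc j)) + ?q u (\<Sum>j<m. of_rat (r j n) *\<^sub>R (p j - u)) < 0"
        by (auto simp: eventually_sequentially)
      define mu where "mu j = r j n" for j
      define mr where "mr j = (of_rat (mu j) :: real)" for j
      have mr0: "mr j \<ge> 0" if "j < m" for j using okj(1)[OF that] r(2)[of j n] unfolding mr_def mu_def by linarith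
      have "?q u (\<Sum>j<m. mr j *\<^sub>R (p j - u)) < - (\<Sum>j<m. mr j * of_rat (cc j))"
        using n by (simp add: mr_def mu_def)
      then obtain b where b: "?q u (\<Sum>j<m. mr j *\<^sub>R (p j - u)) < of_rat b"
          "of_rat b < - (\<Sum>j<m. mr j * of_rat (cc j))"
        using of_rat_dense by blast
      \<comment> \<open>The intermediate radius leaves room on both sides: for moving the base point
        from \<open>u\<close> to a point of \<open>D\<close>, and for moving back.\<close>
      have "\<exists>q. norm (p j - u) < of_rat q \<and> of_rat q < (of_rat (\<rho> j) :: real)" if "j < m" for j
        by (rule of_rat_dense[OF okj(4)[OF that]])
      then obtain \<rho>' where \<rho>': "\<And>j. j < m \<Longrightarrow> norm (p j - u) < of_rat (\<rho>' j)"
          "\<And>j. j < m \<Longrightarrow> of_rat (\<rho>' j) < (of_rat (\<rho> j) :: real)" by metis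
      \<comment> \<open>A Lipschitz constant, uniform in the points \<open>z j\<close>, of the bound
        as a function of the base point: \<open>2 * L\<close> from the base point proper and the
        rest from the shifted combination.\<close>
      define K1 where "K1 = 2 * L + (L + \<beta>) * (\<Sum>j<m. mr j) + 1"
      have ms: "0 \<le> (\<Sum>j<m. mr j)" using mr0 by (intro sum_nonneg) auto
      have K1: "K1 > 0" using L \<beta> ms by (simp add: K1_def add_nonneg_pos)
      obtain e1 where e1: "e1 > 0" "\<And>j. j < m \<Longrightarrow> e1 \<le> of_rat (\<rho>' j) - norm (p j - u)"
        using uniform_positive_bound[of m "\<lambda>j. of_rat (\<rho>' j) - norm (p j - u)"] \<rho>'(1) by auto
      obtain e2 :: real where e2: "e2 > 0" "\<And>j. j < m \<Longrightarrow> e2 \<le> of_rat (\<rho> j) - of_rat (\<rho>' j)"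
        using uniform_positive_bound[of m "\<lambda>j. of_rat (\<rho> j) - of_rat (\<rho>' j)"] \<rho>'(2) by auto
      define g1 where "g1 = of_rat b - ?q u (\<Sum>j<m. mr j *\<^sub>R (p j - u))"
      define g2 where "g2 = - (\<Sum>j<m. mr j * of_rat (cc j)) - of_rat b"
      have g12: "g1 > 0" "g2 > 0" using b by (simp_all add: g1_def g2_def)
      \<comment> \<open>The quantities \<open>e1\<close> and \<open>g1\<close> let the given points
        violate the inequality at \<open>u'\<close>; \<open>e2\<close> and \<open>g2\<close> carry
        the violation by the selected points back to \<open>u\<close>.\<close>
      define e where "e = min (min e1 e2) (min (g1 / K1) (g2 / K1))"
      have "e > 0" using e1(1) e2(1) g12 K1 by (simp add: e_def)
      then obtain u' where u': "u' \<in> D" "dist u' u < e" using u(2) by (auto simp: closure_approachable)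
      have nu: "norm (u' - u) < e1" "norm (u' - u) < e2" "norm (u' - u) * K1 < g1" "norm (u' - u) * K1 < g2"
        using u'(2) K1 by (auto simp: e_def dist_norm pos_less_divide_eq)
      have shift: "?q v (\<Sum>j<m. mr j *\<^sub>R (z j - v)) - ?q v' (\<Sum>j<m. mr j *\<^sub>R (z j - v')) \<le> norm (v - v') * K1"
        for v v' z
      proof -
        have "(\<Sum>j<m. mr j *\<^sub>R (z j - v)) - (\<Sum>j<m. mr j *\<^sub>R (z j - v')) = (\<Sum>j<m. mr j) *\<^sub>R (v' - v)"
          by (simp add: sum_subtractf[symmetric] scaleR_sum_left algebra_simps)
        then have "norm ((\<Sum>j<m. mr j *\<^sub>R (z j - v)) - (\<Sum>j<m. mr j *\<^sub>R (z j - v'))) = (\<Sum>j<m. mr j) * norm (v - v')"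
          using ms by (simp add: norm_minus_commute)
        then have "?q v (\<Sum>j<m. mr j *\<^sub>R (z j - v)) - ?q v' (\<Sum>j<m. mr j *\<^sub>R (z j - v'))
            \<le> 2 * L * norm (v - v') + (L + \<beta>) * ((\<Sum>j<m. mr j) * norm (v - v'))"
          using subgradient_bound_lipschitz2[OF Lg, of \<beta> v "\<Sum>j<m. mr j *\<^sub>R (z j - v)" v'
              "\<Sum>j<m. mr j *\<^sub>R (z j - v')"] \<beta> by simp
        also have "\<dots> \<le> norm (v - v') * K1" by (simp add: K1_def algebra_simps)
        finally show ?thesis .
      qed
      define l where "l = map (\<lambda>j. (mu j, \<rho>' j)) [0..<m]"
      have len: "length l = m" and lj: "\<And>j. j < m \<Longrightarrow> l ! j = (mu j, \<rho>' j)" by (simp_all add: l_def)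
      have lc: "lc l z v = (\<Sum>j<m. mr j *\<^sub>R (z j - v))" for z v
        unfolding lc_def len by (intro sum.cong) (auto simp: lj mr_def)
      have "viol l b u' p"
        unfolding viol_def len lc
      proof (intro conjI allI impI)
        fix j assume j: "j < m"
        show "p j \<in> S" by (rule okj(2)[OF j])
        have "norm (p j - u') \<le> norm (p j - u) + norm (u' - u)"
          using norm_triangle_ineq4[of "p j - u" "u' - u"] by simp
        then show "norm (p j - u') < of_rat (snd (l ! j))" using e1(2)[OF j] nu(1) by (simp add: lj[OF j])
      next
        show "?q u' (\<Sum>j<m. mr j *\<^sub>R (p j - u')) < of_rat b"
          using shift[of u' p u] nu(3) by (simp add: g1_def)
      qed
      then have ex: "\<exists>s. viol l b u' s" by blast
      define s' where "s' = pick l b u'"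
      have "viol l b u' s'" unfolding s'_def by (rule pick[OF ex])
      then have s': "\<And>j. j < m \<Longrightarrow> s' j \<in> S" "\<And>j. j < m \<Longrightarrow> norm (s' j - u') < of_rat (\<rho>' j)"
          "?q u' (\<Sum>j<m. mr j *\<^sub>R (s' j - u')) < of_rat b"
        by (auto simp: viol_def len lc lj)
      have s'D: "s' j \<in> closure D" if "j < m" for j
        using Dpick[OF u'(1) ex, of j] that closure_subset by (auto simp: s'_def len)
      have yc: "blinfun_apply y' (s' j - u) \<le> of_rat (cc j)" if j: "j < m" for j
      proof -
        have "norm (s' j - u) \<le> norm (s' j - u') + norm (u' - u)"
          using norm_triangle_ineq[of "s' j - u'" "u' - u"] by simp
        then have "norm (s' j - u) < of_rat (\<rho> j)" using s'(2)[OF j] e2(2)[OF j] nu(2) by simp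
        then show ?thesis using okj(3)[OF j] s'(1)[OF j] s'D[OF j] by (auto simp: C_def)
      qed
      \<comment> \<open>The selected points belong to \<open>closure D\<close>, where the bounds
        recorded in \<open>C\<close> hold for \<open>y'\<close> itself, so the violation contradicts
        the assumption on \<open>y'\<close>.\<close>
      have "?q u (\<Sum>j<m. mr j *\<^sub>R (s' j - u)) < - (\<Sum>j<m. mr j * of_rat (cc j))"
        using shift[of u s' u'] nu(4) s'(3) by (simp add: g2_def norm_minus_commute)
      also have "\<dots> \<le> - (\<Sum>j<m. mr j * blinfun_apply y' (s' j - u))"
        using yc mr0 by (auto intro!: sum_mono mult_left_mono)
      also have "\<dots> = - blinfun_apply y' (\<Sum>j<m. mr j *\<^sub>R (s' j - u))"
        by (simp add: blinfun.sum_right blinfun.scaleR_right)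
      also have "\<dots> \<le> ?q u (\<Sum>j<m. mr j *\<^sub>R (s' j - u))" by (rule y')
      finally show False by simp
    qed
    moreover have "(0, 0) \<in> K" unfolding K_def by (auto intro!: exI[of _ "[]"])
    moreover have "(s + s', c + c') \<in> K" if "(s, c) \<in> K" "(s', c') \<in> K" for s c s' c'
    proof -
      obtain xs ys where "s = sum_list (map vec xs)" "c = sum_list (map cst xs)" "\<forall>x\<in>set xs. ok x"
          "s' = sum_list (map vec ys)" "c' = sum_list (map cst ys)" "\<forall>x\<in>set ys. ok x"
        using \<open>(s, c) \<in> K\<close> \<open>(s', c') \<in> K\<close> by (auto simp: K_def)
      then show ?thesis unfolding K_def by (auto intro!: exI[of _ "xs @ ys"])
    qed
    moreover have "(t *\<^sub>R s, t * c) \<in> K" if t: "t > 0" and sc: "(s, c) \<in> K" for t s c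
    proof -
      obtain xs where xs: "s = sum_list (map vec xs)" "c = sum_list (map cst xs)" "\<forall>x\<in>set xs. ok x"
        using sc by (auto simp: K_def)
      define T where "T = (\<lambda>(l, s :: 'b, c :: rat, \<rho> :: rat). (t * l, s, c, \<rho>))"
      have T: "vec (T x) = t *\<^sub>R vec x" "cst (T x) = t * cst x" "ok x \<Longrightarrow> ok (T x)" for x
        using t by (auto simp: vec_def cst_def T_def ok_def split: prod.split)
      have "sum_list (map vec (map T ys)) = t *\<^sub>R sum_list (map vec ys)" for ys
        by (induction ys) (simp_all add: T scaleR_add_right)
      moreover have "sum_list (map cst (map T ys)) = t * sum_list (map cst ys)" for ys
        by (induction ys) (simp_all add: T distrib_left)
      ultimately have "t *\<^sub>R s = sum_list (map vec (map T xs))" "t * c = sum_list (map cst (map T xs))"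
          "\<forall>x\<in>set (map T xs). ok x"
        using xs T(3) by auto
      then show ?thesis unfolding K_def by blast
    qed
    ultimately obtain x' where x': "\<And>s c. (s, c) \<in> K \<Longrightarrow> blinfun_apply x' s \<le> c"
        "\<And>h. - blinfun_apply x' h \<le> ?q u h"
      using convex_sandwich[of "?q u" "L + \<beta>" K] subgradient_bound_convex[OF cg, of \<beta> u]
        subgradient_bound_lipschitz[OF Lg, of \<beta> u] \<beta> by (metis less_imp_le)
    have xC: "blinfun_apply x' (s - u) \<le> of_rat c"
      if "s \<in> S" "(c, \<rho>) \<in> C" "norm (s - u) < of_rat \<rho>" for s c \<rho>
    proof (rule x')
      show "(s - u, of_rat c) \<in> K" unfolding K_def using that
        by (auto intro!: exI[of _ "[(1, s, c, \<rho>)]"] simp: vec_def cst_def ok_def)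
    qed
    have "frechet_normal S u x'"
      unfolding frechet_normal_def
    proof (intro allI impI)
      fix \<epsilon> :: real assume \<epsilon>: "\<epsilon> > 0"
      obtain \<delta> where \<delta>: "\<delta> > 0" "\<And>s. s \<in> S \<inter> closure D \<Longrightarrow> norm (s - u) < \<delta> \<Longrightarrow>
          blinfun_apply y' (s - u) \<le> \<epsilon> / 4 * norm (s - u)"
        using fn \<epsilon> unfolding frechet_normal_def by (metis divide_pos_pos zero_less_numeral)
      have "blinfun_apply x' (s - u) \<le> \<epsilon> * norm (s - u)" if s: "s \<in> S" "norm (s - u) < \<delta>" for s
      proof (cases "s = u")
        case False
        define t where "t = norm (s - u)"
        have t: "t > 0" using False by (simp add: t_def)
        \<comment> \<open>Within the radius \<open>\<rho>\<close>, which is below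
          \<open>2 * t\<close>, the functional \<open>y'\<close> is at most
          \<open>\<epsilon> / 4 * (2 * t)\<close>. A rational \<open>c\<close> between this and
          \<open>\<epsilon> * t\<close> turns the smallness of \<open>y'\<close> into a bound
          recorded in \<open>C\<close>.\<close>
        obtain \<rho> where \<rho>: "t < of_rat \<rho>" "of_rat \<rho> < min (2 * t) \<delta>"
          using of_rat_dense[of t "min (2 * t) \<delta>"] t s(2) by (auto simp: t_def)
        obtain c where c: "\<epsilon> / 2 * t < of_rat c" "of_rat c < \<epsilon> * t"
          using of_rat_dense[of "\<epsilon> / 2 * t" "\<epsilon> * t"] t \<epsilon> by auto
        have "(c, \<rho>) \<in> C" unfolding C_def
        proof (clarify)
          fix s' assume s': "s' \<in> S" "s' \<in> closure D" "norm (s' - u) < of_rat \<rho>"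
          have "blinfun_apply y' (s' - u) \<le> \<epsilon> / 4 * norm (s' - u)" using s' \<rho>(2) by (intro \<delta>(2)) auto
          also have "\<dots> \<le> \<epsilon> / 4 * (2 * t)" using s' \<rho>(2) \<epsilon> by (intro mult_left_mono) auto
          also have "\<dots> \<le> of_rat c" using c(1) by simp
          finally show "blinfun_apply y' (s' - u) \<le> of_rat c" .
        qed
        then show ?thesis using xC[OF s(1), of c \<rho>] \<rho>(1) c(2) by (simp add: t_def)
      qed simp
      then show "\<exists>\<delta>>0. \<forall>s\<in>S. norm (s - u) < \<delta> \<longrightarrow> blinfun_apply x' (s - u) \<le> \<epsilon> * norm (s - u)"
        using \<delta>(1) by blast
    qed
    then show ?thesis using x'(2) by blast
  qed
  then show thesis using that[OF D(1) D(3) _ sub] D(2) by blast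
qed

text \<open>The common linear bound makes the tail of the series uniformly small relative to
  \<open>norm h\<close>, and the finitely many remaining terms share a radius.\<close>

lemma weighted_sum_small_o:
  fixes D :: "nat \<Rightarrow> 'b::real_normed_vector \<Rightarrow> real"
  assumes c: "\<And>k. c k \<ge> 0" "summable c" and B: "B \<ge> 0"
    and D: "\<And>k h. 0 \<le> D k h" "\<And>k h. D k h \<le> B * norm h"
    and o: "\<And>k \<epsilon>. \<epsilon> > 0 \<Longrightarrow> \<exists>\<rho>>0. \<forall>h\<in>Y. norm h < \<rho> \<longrightarrow> D k h \<le> \<epsilon> * norm h"
    and \<epsilon>: "\<epsilon> > 0"
  shows "\<exists>\<rho>>0. \<forall>h\<in>Y. norm h < \<rho> \<longrightarrow> (\<Sum>k. c k * D k h) \<le> \<epsilon> * norm h"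
proof -
  define \<eta> where "\<eta> = \<epsilon> / (2 * (suminf c + 1))"
  have sc: "suminf c \<ge> 0" using c by (intro suminf_nonneg) auto
  have \<eta>: "\<eta> > 0" "suminf c * \<eta> \<le> \<epsilon> / 2" using sc \<epsilon> by (auto simp: \<eta>_def field_simps)
  obtain K where K: "norm (\<Sum>i. c (i + K)) < \<epsilon> / (2 * (B + 1))"
    using suminf_exist_split[OF _ c(2), of "\<epsilon> / (2 * (B + 1))"] \<epsilon> B by auto
  obtain \<rho> where \<rho>: "\<And>k. \<rho> k > 0" "\<And>k h. h \<in> Y \<Longrightarrow> norm h < \<rho> k \<Longrightarrow> D k h \<le> \<eta> * norm h"
    using o[OF \<eta>(1)] by metis
  obtain e where e: "e > 0" "\<And>k. k < K \<Longrightarrow> e \<le> \<rho> k"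
    using uniform_positive_bound[of K \<rho>] \<rho>(1) by auto
  have "(\<Sum>k. c k * D k h) \<le> \<epsilon> * norm h" if h: "h \<in> Y" "norm h < e" for h
  proof -
    have s: "summable (\<lambda>k. c k * D k h)"
    proof (rule summable_comparison_test'[where N = 0])
      show "summable (\<lambda>k. c k * (B * norm h))" using c(2) by (rule summable_mult2)
      show "norm (c k * D k h) \<le> c k * (B * norm h)" for k
        using c(1)[of k] D(1)[of k h] D(2)[of k h] by (simp add: abs_mult mult_left_mono)
    qed
    have "(\<Sum>k<K. c k * D k h) \<le> (\<Sum>k<K. c k * (\<eta> * norm h))"
    proof (rule sum_mono)
      fix k assume "k \<in> {..<K}"
      then show "c k * D k h \<le> c k * (\<eta> * norm h)"
        using \<rho>(2)[of h k] h e(2)[of k] c(1)[of k] by (intro mult_left_mono) auto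
    qed
    also have "\<dots> = (\<Sum>k<K. c k) * \<eta> * norm h" by (simp add: sum_distrib_right mult.assoc)
    also have "\<dots> \<le> suminf c * \<eta> * norm h"
      using c \<eta>(1) by (intro mult_right_mono sum_le_suminf) auto
    also have "\<dots> \<le> \<epsilon> / 2 * norm h" using \<eta>(2) by (intro mult_right_mono) auto
    finally have a: "(\<Sum>k<K. c k * D k h) \<le> \<epsilon> / 2 * norm h" .
    have "(\<Sum>i. c (i + K) * D (i + K) h) \<le> (\<Sum>i. c (i + K) * (B * norm h))"
    proof (rule suminf_le)
      show "c (i + K) * D (i + K) h \<le> c (i + K) * (B * norm h)" for i
        using c(1) D(2) by (intro mult_left_mono) auto
      show "summable (\<lambda>i. c (i + K) * D (i + K) h)" using s by (rule summable_ignore_initial_segment)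
      show "summable (\<lambda>i. c (i + K) * (B * norm h))"
        using summable_ignore_initial_segment[OF c(2)] by (rule summable_mult2)
    qed
    also have "\<dots> = (\<Sum>i. c (i + K)) * (B * norm h)"
      using suminf_mult2[OF summable_ignore_initial_segment[OF c(2), of K], of "B * norm h"] by simp
    also have "\<dots> \<le> \<epsilon> / (2 * (B + 1)) * (B * norm h)" using K B by (intro mult_right_mono) auto
    also have "\<dots> \<le> \<epsilon> / 2 * norm h"
    proof -
      have "\<epsilon> / (2 * (B + 1)) * B \<le> \<epsilon> / 2" using B \<epsilon> by (simp add: field_simps)
      from mult_right_mono[OF this norm_ge_zero[of h]] show ?thesis by (simp add: mult.assoc)
    qed
    finally show ?thesis using a suminf_split_initial_segment[OF s, of K] by simp
  qed
  then show ?thesis using e(1) by blast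
qed

text \<open>Both the approximation of \<open>g\<close> and the perturbations are smooth along
  \<open>Y\<close>. At a minimum of their sum over \<open>S \<inter> Y\<close> the derivative is
  therefore the negative of a Frechet normal, with no sum rule involved.\<close>

lemma smooth_minimum:
  fixes g :: "'b::banach \<Rightarrow> real" and C :: "('b \<Rightarrow>\<^sub>L real) set"
  assumes Y: "subspace Y" "closed Y" and C: "countable C"
    and approx: "\<And>x' \<epsilon>. \<epsilon> > 0 \<Longrightarrow> \<exists>c\<in>C. \<forall>y\<in>Y. \<bar>blinfun_apply x' y - blinfun_apply c y\<bar> \<le> \<epsilon> * norm y"
    and S: "closed S" and \<omega>: "\<omega> \<in> S" "\<omega> \<in> Y"
    and cg: "convex_on UNIV g" and L: "L \<ge> 0" and Lg: "\<And>x y. g x - g y \<le> L * norm (x - y)"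
    and r: "r > 0" and min: "\<And>z. z \<in> S \<Longrightarrow> norm (z - \<omega>) \<le> r \<Longrightarrow> g \<omega> \<le> g z" and \<beta>: "\<beta> > 0"
  obtains u y' where "u \<in> S" "u \<in> Y" "norm (u - \<omega>) < \<beta>" "frechet_normal (S \<inter> Y) u y'"
    "\<And>h. - blinfun_apply y' h \<le> subgradient_bound g \<beta> u h"
proof -
  \<comment> \<open>The sum \<open>2 * a\<close> of \<open>e\<close> is below both \<open>r\<close>
    and \<open>\<beta>\<close>, so \<open>u\<close> stays in the interior of the ball. The sum
    \<open>\<beta> / 2\<close> of \<open>c\<close> bounds the slope of the perturbation. The decay
    of \<open>\<sigma>\<close> by factors \<open>1/4\<close> leaves a factor \<open>1/2\<close>
    after division by \<open>c\<close>, and \<open>b\<close> is small enough for that quotient to be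
    at most \<open>a / 2 * (1/2) ^ k\<close>.\<close>
  define a where "a = min r \<beta> / 4"
  define c where "c k = \<beta> / 4 * (1/2) ^ k" for k :: nat
  define e where "e k = a * (1/2) ^ k" for k :: nat
  define d where "d k = a / 2 * (1/2) ^ k" for k :: nat
  define b where "b = min \<beta> (a * \<beta> / 16)"
  define \<sigma> where "\<sigma> k = b * (1/4) ^ k" for k :: nat
  have a: "a > 0" using r \<beta> by (simp add: a_def)
  have b: "b > 0" using a \<beta> by (simp add: b_def)
  have geo: "(\<lambda>k. x * (1/2) ^ k) sums (2 * x)" for x :: real
    using sums_mult[OF geometric_sums[of "1/2 :: real"], of x] by (simp add: mult.commute)
  have cs: "c sums (2 * (\<beta> / 4))" and es: "e sums (2 * a)" unfolding c_def e_def by (rule geo)+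
  have c0: "c k > 0" for k using \<beta> by (simp add: c_def)
  obtain G where cG: "convex_on UNIV G" and LG: "\<And>x y. G x - G y \<le> L * norm (x - y)"
    and Gl: "\<And>x. g x - b \<le> G x" and Gu: "\<And>x. G x \<le> g x"
    and Gs: "smooth_along Y G"
    using smooth_approximation[OF cg L Lg Y(1) C approx b] by blast
  have "\<exists>N :: 'b \<Rightarrow> real. convex_on UNIV N \<and> (\<forall>x y. N x - N y \<le> 1 * norm (x - y)) \<and>
      (\<forall>x. norm x - d k \<le> N x) \<and> (\<forall>x. N x \<le> norm x) \<and> smooth_along Y N" for k
  proof -
    have d: "d k > 0" using a by (simp add: d_def)
    have n: "norm x - norm y \<le> 1 * norm (x - y)" for x y :: 'b using norm_triangle_ineq2[of x y] by simp
    show ?thesis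
      by (rule smooth_approximation[OF convex_on_norm_UNIV zero_le_one n Y(1) C approx d]) (assumption, blast)
  qed
  then obtain N :: "nat \<Rightarrow> 'b \<Rightarrow> real" where cN: "\<And>k. convex_on UNIV (N k)"
    and LN1: "\<And>k x y. N k x - N k y \<le> 1 * norm (x - y)"
    and Nl: "\<And>k x. norm x - d k \<le> N k x" and Nu: "\<And>k x. N k x \<le> norm x"
    and Ns: "\<And>k. smooth_along Y (N k)"
    by metis
  have LN: "N k x - N k y \<le> norm (x - y)" for k x y using LN1[of k x y] by simp
  define M where "M = S \<inter> Y \<inter> cball \<omega> r"
  have M: "closed M" "\<omega> \<in> M" using S Y \<omega> r by (auto simp: M_def)
  have contG: "continuous_on M G" using LG L by (rule continuous_on_one_sided_lipschitz)
  \<comment> \<open>Replacing \<open>g\<close> by \<open>G\<close> costs at most \<open>b\<close>,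
    which is \<open>\<sigma> 0\<close>; thus \<open>\<omega>\<close> is an admissible starting
    point.\<close>
  have low: "G \<omega> \<le> G z + \<sigma> 0" if "z \<in> M" for z
  proof -
    have "g \<omega> \<le> g z" using that by (intro min) (auto simp: M_def dist_norm norm_minus_commute)
    then show ?thesis using Gu[of \<omega>] Gl[of z] by (simp add: \<sigma>_def)
  qed
  have \<sigma>0: "\<sigma> k > 0" for k using b by (simp add: \<sigma>_def)
  have eb: "d k + (\<sigma> k + \<sigma> (Suc k)) / c k \<le> e k" for k
  proof -
    have "(1/4 :: real) ^ k = (1/2) ^ k * (1/2) ^ k" by (simp add: power_mult_distrib[symmetric])
    then have "(\<sigma> k + \<sigma> (Suc k)) / c k = 5 * b / \<beta> * (1/2) ^ k"
      using \<beta> by (simp add: \<sigma>_def c_def field_simps)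
    also have "\<dots> \<le> a / 2 * (1/2) ^ k"
    proof (rule mult_right_mono)
      have "b \<le> a * \<beta> / 16" by (simp add: b_def)
      moreover have "a * \<beta> > 0" using a \<beta> by simp
      ultimately have "10 * b \<le> a * \<beta>" by linarith
      then show "5 * b / \<beta> \<le> a / 2" using \<beta> by (simp add: field_simps)
    qed simp
    finally show ?thesis unfolding d_def e_def by linarith
  qed
  obtain u v where u: "u \<in> M" "norm (u - \<omega>) \<le> suminf e"
    and umin: "\<And>z. z \<in> M \<Longrightarrow> G u + (\<Sum>k. c k * N k (u - v k)) \<le> G z + (\<Sum>k. c k * N k (z - v k))"
    and sm: "\<And>z. summable (\<lambda>k. c k * N k (z - v k))"
  proof (rule variational_principle[OF M contG low c0 sums_summable[OF cs] \<sigma>0 LN Nu Nl eb sums_summable[OF es]])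
    fix u v assume "u \<in> M" "norm (u - \<omega>) \<le> suminf e"
      "\<And>z. z \<in> M \<Longrightarrow> G u + (\<Sum>k. c k * N k (u - v k)) \<le> G z + (\<Sum>k. c k * N k (z - v k))"
      "\<And>z. summable (\<lambda>k. c k * N k (z - v k))"
    then show thesis by (rule that)
  qed
  have nu: "norm (u - \<omega>) < r" "norm (u - \<omega>) < \<beta>"
    using u(2) sums_unique[OF es] r \<beta> by (auto simp: a_def)
  obtain y0 :: "'b \<Rightarrow>\<^sub>L real" where y0: "\<And>h. blinfun_apply y0 h \<le> G (u + h) - G u"
    using convex_subgradient[OF cG LG, of u] by blast
  have "\<exists>y :: 'b \<Rightarrow>\<^sub>L real. \<forall>h. blinfun_apply y h \<le> N k ((u - v k) + h) - N k (u - v k)" for k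
    using convex_subgradient[OF cN LN1, where x = "u - v k"] by blast
  then obtain y :: "nat \<Rightarrow> 'b \<Rightarrow>\<^sub>L real" where y: "\<And>k h. blinfun_apply (y k) h \<le> N k ((u - v k) + h) - N k (u - v k)"
    by metis
  have yn: "blinfun_apply (y k) h \<le> norm h" for k h using y[of k h] LN[of k "u - v k + h" "u - v k"] by simp
  have ny: "norm (y k) \<le> 1" for k using yn by (intro blinfun_norm_leI) auto
  have sy: "summable (\<lambda>k. c k *\<^sub>R y k)"
  proof (rule summable_norm_cancel, rule summable_comparison_test'[OF sums_summable[OF cs], of 0])
    show "norm (norm (c k *\<^sub>R y k)) \<le> c k" for k
      using ny[of k] c0[of k] mult_left_mono[of "norm (y k)" 1 "c k"] by simp
  qed
  \<comment> \<open>The subgradients are arbitrary, since smoothness along \<open>Y\<close> turns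
    any choice into the derivative in the directions of \<open>Y\<close>.\<close>
  define Z where "Z = y0 + (\<Sum>k. c k *\<^sub>R y k)"
  have bl: "bounded_linear (\<lambda>x'. blinfun_apply x' h)" for h :: 'b
    by (rule bounded_linear_blinfun_apply bounded_bilinear.bounded_linear_left[OF bounded_bilinear_blinfun_apply])
  have sh: "summable (\<lambda>k. c k * blinfun_apply (y k) h)" for h
    using bounded_linear.summable[OF bl[of h] sy] by (simp add: blinfun.scaleR_left)
  have Zh: "blinfun_apply Z h = blinfun_apply y0 h + (\<Sum>k. c k * blinfun_apply (y k) h)" for h
    using bounded_linear.suminf[OF bl[of h] sy] by (simp add: Z_def blinfun.add_left blinfun.scaleR_left)
  show thesis
  proof (rule that[of u "- Z"])
    show "u \<in> S" "u \<in> Y" using u by (auto simp: M_def)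
    show "norm (u - \<omega>) < \<beta>" by (rule nu)
    fix h
    have "(\<Sum>k. c k * blinfun_apply (y k) h) \<le> (\<Sum>k. c k * norm h)"
      using yn c0 sums_summable[OF cs] by (intro suminf_le sh summable_mult2 mult_left_mono) (auto intro: less_imp_le)
    also have "\<dots> = suminf c * norm h" using suminf_mult2[OF sums_summable[OF cs]] by simp
    also have "\<dots> \<le> \<beta> * norm h" using sums_unique[OF cs] \<beta> by (intro mult_right_mono) auto
    finally have "blinfun_apply Z h \<le> G (u + h) - G u + \<beta> * norm h" using y0[of h] by (simp add: Zh)
    moreover have "b \<le> \<beta>" by (simp add: b_def)
    ultimately show "- blinfun_apply (- Z) h \<le> subgradient_bound g \<beta> u h"
      using Gu[of "u + h"] Gl[of u] by (simp add: subgradient_bound_def blinfun.minus_left)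
  next
    show "frechet_normal (S \<inter> Y) u (- Z)"
      unfolding frechet_normal_def
    proof (intro allI impI)
      fix \<epsilon> :: real assume \<epsilon>: "\<epsilon> > 0"
      define D where "D k h = N k ((u - v k) + h) - N k (u - v k) - blinfun_apply (y k) h" for k h
      have "\<exists>\<rho>>0. \<forall>h\<in>Y. norm h < \<rho> \<longrightarrow> (\<Sum>k. c k * D k h) \<le> \<epsilon> / 2 * norm h"
      proof (rule weighted_sum_small_o[where B = 2])
        show "c k \<ge> 0" for k using c0[of k] by simp
        show "0 \<le> D k h" for k h using y[of k h] by (simp add: D_def)
        show "D k h \<le> 2 * norm h" for k h
          using LN[of k "u - v k + h" "u - v k"] yn[of k "- h"] by (simp add: D_def blinfun.minus_right)
        show "\<exists>\<rho>>0. \<forall>h\<in>Y. norm h < \<rho> \<longrightarrow> D k h \<le> \<epsilon> * norm h" if "\<epsilon> > 0" for k \<epsilon>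
        proof -
          have "\<exists>\<rho>>0. \<forall>h\<in>Y. norm h < \<rho> \<longrightarrow>
              N k ((u - v k) + h) - N k (u - v k) \<le> blinfun_apply (y k) h + \<epsilon> * norm h"
            using Ns[of k] y[of k] that unfolding smooth_along_def by meson
          then show ?thesis unfolding D_def diff_le_eq[of "_ - _"] by (simp add: add.commute)
        qed
      qed (use sums_summable[OF cs] \<epsilon> in auto)
      then obtain \<rho>1 where \<rho>1: "\<rho>1 > 0" "\<And>h. h \<in> Y \<Longrightarrow> norm h < \<rho>1 \<Longrightarrow> (\<Sum>k. c k * D k h) \<le> \<epsilon> / 2 * norm h"
        by blast
      have "\<epsilon> / 2 > 0" using \<epsilon> by simp
      then obtain \<rho>2 where \<rho>2: "\<rho>2 > 0"
          "\<And>h. h \<in> Y \<Longrightarrow> norm h < \<rho>2 \<Longrightarrow> G (u + h) - G u \<le> blinfun_apply y0 h + \<epsilon> / 2 * norm h"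
        using Gs y0 unfolding smooth_along_def by meson
      define \<delta> where "\<delta> = min (min \<rho>1 \<rho>2) (r - norm (u - \<omega>))"
      have \<delta>: "\<delta> > 0" using \<rho>1(1) \<rho>2(1) nu by (simp add: \<delta>_def)
      have "blinfun_apply (- Z) (s - u) \<le> \<epsilon> * norm (s - u)" if s: "s \<in> S \<inter> Y" "norm (s - u) < \<delta>" for s
      proof -
        define h where "h = s - u"
        have hY: "h \<in> Y" using s u Y(1) by (auto simp: h_def M_def intro: subspace_diff)
        have "norm (s - \<omega>) \<le> norm (s - u) + norm (u - \<omega>)" using norm_triangle_ineq[of "s - u" "u - \<omega>"] by simp
        then have "s \<in> M" using s by (auto simp: M_def \<delta>_def dist_norm norm_minus_commute)
        then have 0: "0 \<le> G s - G u + ((\<Sum>k. c k * N k (s - v k)) - (\<Sum>k. c k * N k (u - v k)))"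
          using umin by fastforce
        have "(\<Sum>k. c k * N k (s - v k)) - (\<Sum>k. c k * N k (u - v k)) - (\<Sum>k. c k * blinfun_apply (y k) h)
            = (\<Sum>k. c k * D k h)"
          unfolding suminf_diff[OF sm sm] suminf_diff[OF summable_diff[OF sm sm] sh]
          by (simp add: D_def h_def algebra_simps)
        then show ?thesis using 0 \<rho>1(2)[OF hY] \<rho>2(2)[OF hY] s(2) Zh[of h]
          by (simp add: h_def \<delta>_def blinfun.minus_left)
      qed
      then show "\<exists>\<delta>>0. \<forall>s\<in>S \<inter> Y. norm (s - u) < \<delta> \<longrightarrow> blinfun_apply (- Z) (s - u) \<le> \<epsilon> * norm (s - u)"
        using \<delta> by blast
    qed
  qed
qed

text \<open>For a subspace \<open>D\<close> this is separability of its dual. The approximating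
  functionals live on the whole space, which makes the notion meaningful for arbitrary subsets and
  easy to carry over to closures and products.\<close>

definition separable_dual_on :: "'b::real_normed_vector set \<Rightarrow> bool" where
  "separable_dual_on D \<longleftrightarrow> (\<exists>C. countable C \<and>
     (\<forall>(x' :: 'b \<Rightarrow>\<^sub>L real). \<forall>\<epsilon>>0. \<exists>c\<in>C. \<forall>y\<in>D. \<bar>blinfun_apply x' y - blinfun_apply c y\<bar> \<le> \<epsilon> * norm y))"

lemma separable_dual_on_closure:
  assumes "separable_dual_on D"
  shows "separable_dual_on (closure D)"
proof -
  have "\<bar>blinfun_apply x' y - blinfun_apply c y\<bar> \<le> \<epsilon> * norm y"
    if D: "\<forall>y\<in>D. \<bar>blinfun_apply x' y - blinfun_apply c y\<bar> \<le> \<epsilon> * norm y" and y: "y \<in> closure D"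
    for x' c :: "'a \<Rightarrow>\<^sub>L real" and \<epsilon> y
  proof -
    obtain f where f: "\<And>n. f n \<in> D" "f \<longlonglongrightarrow> y" using y unfolding closure_sequential by metis
    show ?thesis
    proof (rule LIMSEQ_le)
      show "(\<lambda>n. \<bar>blinfun_apply x' (f n) - blinfun_apply c (f n)\<bar>) \<longlonglongrightarrow> \<bar>blinfun_apply x' y - blinfun_apply c y\<bar>"
        "(\<lambda>n. \<epsilon> * norm (f n)) \<longlonglongrightarrow> \<epsilon> * norm y" using f(2) by (auto intro!: tendsto_intros)
    qed (use D f(1) in blast)
  qed
  then show ?thesis using assms unfolding separable_dual_on_def by meson
qed

text \<open>Separability is demanded only for countable subsets of \<open>E0\<close>, because the
  ambient space of bounded functions is much larger than the finite product that matters.\<close>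

lemma fuzzy_minimum:
  fixes g :: "'b::banach \<Rightarrow> real"
  assumes E0: "subspace E0" "S \<subseteq> E0" and S: "closed S" "\<omega> \<in> S"
    and sd: "\<And>D. countable D \<Longrightarrow> D \<subseteq> E0 \<Longrightarrow> separable_dual_on D"
    and cg: "convex_on UNIV g" and L: "L \<ge> 0" and Lg: "\<And>x y. g x - g y \<le> L * norm (x - y)"
    and r: "r > 0" and min: "\<And>z. z \<in> S \<Longrightarrow> norm (z - \<omega>) \<le> r \<Longrightarrow> g \<omega> \<le> g z" and \<beta>: "\<beta> > 0"
  obtains u x' where "u \<in> S" "norm (u - \<omega>) < \<beta>" "frechet_normal S u x'"
    "\<And>h. - blinfun_apply x' h \<le> subgradient_bound g \<beta> u h"
proof -
  have \<omega>: "\<omega> \<in> E0" using E0 S by auto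
  obtain D where D: "countable D" "D \<subseteq> E0" "\<omega> \<in> D" "subspace (closure D)"
    and red: "\<And>u y'. u \<in> S \<Longrightarrow> u \<in> closure D \<Longrightarrow> frechet_normal (S \<inter> closure D) u y' \<Longrightarrow>
       (\<And>h. - blinfun_apply y' h \<le> subgradient_bound g \<beta> u h) \<Longrightarrow>
       \<exists>x'. frechet_normal S u x' \<and> (\<forall>h. - blinfun_apply x' h \<le> subgradient_bound g \<beta> u h)"
    using separable_reduction[OF E0 \<omega> cg L Lg \<beta>] by metis
  obtain C where C: "countable C" "\<And>(x' :: 'b \<Rightarrow>\<^sub>L real) \<epsilon>. \<epsilon> > 0 \<Longrightarrow>
      \<exists>c\<in>C. \<forall>y\<in>closure D. \<bar>blinfun_apply x' y - blinfun_apply c y\<bar> \<le> \<epsilon> * norm y"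
    using separable_dual_on_closure[OF sd[OF D(1,2)]] unfolding separable_dual_on_def by blast
  have "\<omega> \<in> closure D" using D(3) closure_subset by auto
  from smooth_minimum[OF D(4) closed_closure C S this cg L Lg r min \<beta>]
  obtain u y' where "u \<in> S" "u \<in> closure D" "norm (u - \<omega>) < \<beta>" "frechet_normal (S \<inter> closure D) u y'"
    "\<And>h. - blinfun_apply y' h \<le> subgradient_bound g \<beta> u h" by blast
  then show thesis using red[of u y'] that by blast
qed

section \<open>Duals of separable subspaces of Asplund spaces\<close>

text \<open>With the graph of \<open>a\<close> on \<open>Y\<close> as cone, a linear functional
  below the resulting sublinear one is at most \<open>a\<close> on \<open>Y\<close>; since
  \<open>Y\<close> is symmetric, it equals \<open>a\<close> there.\<close>

lemma extend_dominated:
  fixes q :: "'b::real_normed_vector \<Rightarrow> real" and a :: "'b \<Rightarrow>\<^sub>L real"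
  assumes q: "sublinear q" "\<And>x. q x \<le> norm x" and Y: "subspace Y"
    and a: "\<And>y. y \<in> Y \<Longrightarrow> blinfun_apply a y \<le> q y"
  obtains a' :: "'b \<Rightarrow>\<^sub>L real" where "\<And>y. y \<in> Y \<Longrightarrow> blinfun_apply a' y = blinfun_apply a y"
    "\<And>x. blinfun_apply a' x \<le> q x"
proof -
  define K where "K = {(y, blinfun_apply a y) | y. y \<in> Y}"
  obtain p where p: "sublinear p" "\<And>z y c. (y, c) \<in> K \<Longrightarrow> p z \<le> c + q (z - y)"
  proof (rule sublinear_inf_cone[OF q(1), of K])
    show "(0, 0) \<in> K" using subspace_0[OF Y] by (force simp: K_def blinfun.zero_right)
    show "(s + s', c + c') \<in> K" if "(s, c) \<in> K" "(s', c') \<in> K" for s c s' c'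
      using that subspace_add[OF Y] by (auto simp: K_def blinfun.add_right)
    show "(t *\<^sub>R s, t * c) \<in> K" if "t > 0" "(s, c) \<in> K" for t s c
      using that subspace_scale[OF Y] by (auto simp: K_def blinfun.scaleR_right)
    show "0 \<le> c + q (- s)" if "(s, c) \<in> K" for s c
      using that a[of "- s"] subspace_neg[OF Y] by (auto simp: K_def blinfun.minus_right)
  qed (rule that)
  have ple: "p z \<le> q (z - y) + blinfun_apply a y" if "y \<in> Y" for z y
    using p(2)[of y "blinfun_apply a y" z] that by (auto simp: K_def)
  obtain l where l: "linear l" "\<And>x. l x \<le> p x" using sublinear_dominates_linear[OF p(1)] by blast
  have lq: "l x \<le> q x" for x using l(2)[of x] ple[OF subspace_0[OF Y], of x] by simp
  have "l x \<le> 1 * norm x" for x using lq[of x] q(2)[of x] by simp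
  then obtain l' :: "'b \<Rightarrow>\<^sub>L real" where l': "\<And>x. blinfun_apply l' x = l x"
    using linear_le_norm_blinfun[OF l(1)] by blast
  have le: "l y \<le> blinfun_apply a y" if "y \<in> Y" for y
    using l(2)[of y] ple[OF that, of y] sublinear_zero[OF q(1)] by simp
  have "l y = blinfun_apply a y" if "y \<in> Y" for y
    using le[OF that] le[OF subspace_neg[OF Y that]] linear_neg[OF l(1)] by (simp add: blinfun.minus_right)
  then show thesis using that[of l'] l' lq by simp
qed

text \<open>Elements of \<open>A\<close> extend to the whole space below a minimal sublinear \<open>q\<close> dominating \<open>A\<close> on
  \<open>D\<close>. Cutting off a slice of \<open>q\<close> at \<open>x\<close> destroys domination, by minimality, so every slice of \<open>q\<close>
  contains two extensions that are \<open>\<epsilon>\<close>-apart on \<open>D\<close>.\<close>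

lemma nowhere_differentiable_sublinear:
  fixes A :: "('b::real_normed_vector \<Rightarrow>\<^sub>L real) set"
  assumes D: "subspace (closure D)" "0 \<in> D"
    and A: "A \<noteq> {}" "\<And>a. a \<in> A \<Longrightarrow> norm a \<le> 1" and \<epsilon>: "\<epsilon> > 0"
    and slice: "\<And>a d t. a \<in> A \<Longrightarrow> d \<in> D \<Longrightarrow> t < blinfun_apply a d \<Longrightarrow>
      \<exists>b\<in>A. \<exists>c\<in>A. t < blinfun_apply b d \<and> t < blinfun_apply c d \<and>
        (\<exists>y\<in>D. \<epsilon> * norm y < blinfun_apply b y - blinfun_apply c y)"
  obtains q :: "'b \<Rightarrow> real" where "sublinear q" "\<And>x. q x \<le> norm x"
    "\<And>x t \<eta>. t > 0 \<Longrightarrow> \<eta> > 0 \<Longrightarrow> \<exists>h. norm h = t \<and> \<epsilon> * t - \<eta> \<le> q (x + h) + q (x - h) - 2 * q x"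
proof -
  define p where "p d = (SUP a\<in>A. blinfun_apply a d)" for d :: 'b
  have ab: "blinfun_apply a x \<le> norm x" if "a \<in> A" for a x
    using blinfun_le_norm[of a x] mult_right_mono[OF A(2)[OF that] norm_ge_zero[of x]] by simp
  have pge: "blinfun_apply a d \<le> p d" if "a \<in> A" for a d
    unfolding p_def using that ab by (intro cSUP_upper bdd_aboveI2[where M = "norm d"]) auto
  have p0: "0 \<le> p 0" using A(1) pge[of _ 0] by (auto simp: blinfun.zero_right)
  have ple: "p d \<le> norm d" for d unfolding p_def using A(1) ab by (intro cSUP_least) auto
  have psup: "\<exists>a\<in>A. t < blinfun_apply a d" if "t < p d" for t d
  proof -
    have "bdd_above ((\<lambda>a. blinfun_apply a d) ` A)" using ab by (intro bdd_aboveI2[where M = "norm d"])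
    then show ?thesis using that less_cSUP_iff[OF A(1)] unfolding p_def by blast
  qed
  have "sublinear (norm :: 'b \<Rightarrow> real)" by (rule sublinearI) (auto intro: norm_triangle_ineq)
  then obtain q :: "'b \<Rightarrow> real" where q: "sublinear q" "q \<le> norm" "\<And>d. d \<in> D \<Longrightarrow> p d \<le> q d"
    and min: "\<And>q'. sublinear q' \<Longrightarrow> q' \<le> q \<Longrightarrow> (\<And>d. d \<in> D \<Longrightarrow> p d \<le> q' d) \<Longrightarrow> q' = q"
    using minimal_sublinear[of norm D p] ple by blast
  have qn: "q x \<le> norm x" for x using q(2) by (auto simp: le_fun_def)
  have qL: "q x - q y \<le> 1 * norm (x - y)" for x y using sublinear_diff[OF q(1), of x y] qn[of "x - y"] by simp
  have aq: "blinfun_apply a y \<le> q y" if a: "a \<in> A" and y: "y \<in> closure D" for a y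
  proof -
    obtain f where f: "\<And>n. f n \<in> D" "f \<longlonglongrightarrow> y" using y unfolding closure_sequential by metis
    show ?thesis
    proof (rule LIMSEQ_le)
      show "(\<lambda>n. blinfun_apply a (f n)) \<longlonglongrightarrow> blinfun_apply a y" using f(2) by (auto intro!: tendsto_intros)
      show "(\<lambda>n. q (f n)) \<longlonglongrightarrow> q y"
        using continuous_on_tendsto_compose[OF continuous_on_one_sided_lipschitz[OF qL, of UNIV] f(2)] by simp
      show "\<exists>N. \<forall>n\<ge>N. blinfun_apply a (f n) \<le> q (f n)"
        using pge[OF a] q(3)[OF f(1)] by (meson order_trans)
    qed
  qed
  have main: "\<exists>h. norm h = t \<and> \<epsilon> * t - \<eta> \<le> q (x + h) + q (x - h) - 2 * q x" if t: "t > 0" and \<eta>: "\<eta> > 0" for x t \<eta>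
  proof -
    \<comment> \<open>Two functionals with value at least \<open>m\<close> at \<open>x\<close> lose
      at most \<open>\<eta>\<close> together in the second difference.\<close>
    define m where "m = q x - \<eta> / 2"
    \<comment> \<open>Otherwise the largest sublinear functional below \<open>q\<close> with value
      at most \<open>m\<close> at \<open>x\<close> would still dominate \<open>p\<close> on
      \<open>D\<close>. By minimality it would be \<open>q\<close>, although
      \<open>m < q x\<close>.\<close>
    have "\<exists>d\<in>D. \<exists>s\<ge>0. q (d - s *\<^sub>R x) + s * m < p d"
    proof (rule ccontr)
      assume "\<not> ?thesis"
      then have neg: "p d \<le> q (d - s *\<^sub>R x) + s * m" if "d \<in> D" "s \<ge> 0" for d s
        using that by (meson linorder_not_less)
      define K where "K = {(s *\<^sub>R x, s * m) | s. s \<ge> 0}"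
      have K: "(s *\<^sub>R x, s * m) \<in> K" if "s \<ge> 0" for s using that by (auto simp: K_def)
      obtain r where r: "sublinear r" "\<And>z s c. (s, c) \<in> K \<Longrightarrow> r z \<le> c + q (z - s)"
        "\<And>z b. (\<And>s c. (s, c) \<in> K \<Longrightarrow> b \<le> c + q (z - s)) \<Longrightarrow> b \<le> r z"
      proof (rule sublinear_inf_cone[OF q(1), of K])
        show "(0, 0) \<in> K" using K[of 0] by simp
        show "(s + s', c + c') \<in> K" if sc: "(s, c) \<in> K" "(s', c') \<in> K" for s c s' c'
        proof -
          obtain u u' where "s = u *\<^sub>R x" "c = u * m" "u \<ge> 0" "s' = u' *\<^sub>R x" "c' = u' * m" "u' \<ge> 0"
            using sc by (auto simp: K_def)
          then show ?thesis using K[of "u + u'"] by (simp add: algebra_simps)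
        qed
        show "(t *\<^sub>R s, t * c) \<in> K" if sc: "t > 0" "(s, c) \<in> K" for t s c
        proof -
          obtain u where "s = u *\<^sub>R x" "c = u * m" "u \<ge> 0" using sc(2) by (auto simp: K_def)
          then show ?thesis using K[of "t * u"] sc(1) by (simp add: mult.assoc)
        qed
        show "0 \<le> c + q (- s)" if "(s, c) \<in> K" for s c
          using that neg[OF D(2)] p0 by (fastforce simp: K_def)
      next
        fix r assume "sublinear r" "\<And>z s c. (s, c) \<in> K \<Longrightarrow> r z \<le> c + q (z - s)"
          "\<And>z b. (\<And>s c. (s, c) \<in> K \<Longrightarrow> b \<le> c + q (z - s)) \<Longrightarrow> b \<le> r z"
        then show thesis by (rule that)
      qed
      have rle: "r z \<le> q (z - s *\<^sub>R x) + s * m" if "s \<ge> 0" for z s using r(2)[OF K[OF that], of z] by simp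
      have "r \<le> q" using rle[of 0] by (auto simp: le_fun_def)
      moreover have "p d \<le> r d" if "d \<in> D" for d
        using neg[OF that] by (intro r(3)) (auto simp: K_def algebra_simps)
      ultimately have "r = q" by (rule min[OF r(1)])
      then show False using rle[of 1 x] sublinear_zero[OF q(1)] \<eta> by (simp add: m_def)
    qed
    then obtain d s where ds: "d \<in> D" "s \<ge> 0" "q (d - s *\<^sub>R x) + s * m < p d" by blast
    obtain a where a: "a \<in> A" "q (d - s *\<^sub>R x) + s * m < blinfun_apply a d" using psup[OF ds(3)] by blast
    obtain b c y where bc: "b \<in> A" "c \<in> A" "q (d - s *\<^sub>R x) + s * m < blinfun_apply b d"
      "q (d - s *\<^sub>R x) + s * m < blinfun_apply c d"
      and y: "y \<in> D" "\<epsilon> * norm y < blinfun_apply b y - blinfun_apply c y" using slice[OF a(1) ds(1) a(2)] by blast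
    have ext: "\<exists>b'. (\<forall>y\<in>D. blinfun_apply b' y = blinfun_apply b y) \<and> (\<forall>x. blinfun_apply b' x \<le> q x) \<and> m \<le> blinfun_apply b' x"
      if b: "b \<in> A" "q (d - s *\<^sub>R x) + s * m < blinfun_apply b d" for b
    proof -
      obtain b' :: "'b \<Rightarrow>\<^sub>L real" where b': "\<And>y. y \<in> closure D \<Longrightarrow> blinfun_apply b' y = blinfun_apply b y"
          "\<And>x. blinfun_apply b' x \<le> q x"
        using extend_dominated[OF q(1) qn D(1) aq[OF b(1)]] by blast
      have D': "blinfun_apply b' y = blinfun_apply b y" if "y \<in> D" for y using b'(1) that closure_subset by auto
      \<comment> \<open>Being below \<open>q\<close> at \<open>d - s *\<^sub>R x\<close> while large
        at \<open>d\<close> forces the extension to be at least \<open>m\<close> at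
        \<open>x\<close>: the slice of \<open>A\<close> at \<open>d\<close> extends into the slice
        of \<open>q\<close> at \<open>x\<close>.\<close>
      have "blinfun_apply b' d = blinfun_apply b' (d - s *\<^sub>R x) + s * blinfun_apply b' x"
        by (simp add: blinfun.diff_right blinfun.scaleR_right)
      then have "s * m < s * blinfun_apply b' x" using b(2) b'(2)[of "d - s *\<^sub>R x"] D'[OF ds(1)] by linarith
      then have "m \<le> blinfun_apply b' x" using ds(2) by (simp add: mult_less_cancel_left)
      then show ?thesis using b'(2) D' by blast
    qed
    obtain b' where b': "\<And>y. y \<in> D \<Longrightarrow> blinfun_apply b' y = blinfun_apply b y" "\<And>x. blinfun_apply b' x \<le> q x"
      "m \<le> blinfun_apply b' x" using ext[OF bc(1,3)] by blast
    obtain c' where c': "\<And>y. y \<in> D \<Longrightarrow> blinfun_apply c' y = blinfun_apply c y" "\<And>x. blinfun_apply c' x \<le> q x"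
      "m \<le> blinfun_apply c' x" using ext[OF bc(2,4)] by blast
    have y0: "y \<noteq> 0" using y(2) by (auto simp: blinfun.zero_right)
    \<comment> \<open>The direction in which the two functionals differ, rescaled to norm
      \<open>t\<close>; \<open>b'\<close> then supports \<open>q\<close> at \<open>x + h\<close> and
      \<open>c'\<close> at \<open>x - h\<close>, from below.\<close>
    define h where "h = (t / norm y) *\<^sub>R y"
    have nh: "norm h = t" using t y0 by (simp add: h_def)
    have "blinfun_apply b' h - blinfun_apply c' h = (t / norm y) * (blinfun_apply b y - blinfun_apply c y)"
      by (simp add: h_def blinfun.scaleR_right b'(1)[OF y(1)] c'(1)[OF y(1)] right_diff_distrib diff_divide_distrib)
    also have "\<dots> \<ge> (t / norm y) * (\<epsilon> * norm y)" using y(2) t by (intro mult_left_mono) auto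
    also have "(t / norm y) * (\<epsilon> * norm y) = \<epsilon> * t" using y0 by simp
    finally have "\<epsilon> * t \<le> blinfun_apply b' h - blinfun_apply c' h" .
    moreover have "blinfun_apply b' (x + h) \<le> q (x + h)" "blinfun_apply c' (x - h) \<le> q (x - h)"
      by (rule b'(2) c'(2))+
    ultimately have "\<epsilon> * t - \<eta> \<le> q (x + h) + q (x - h) - 2 * q x"
      using b'(3) c'(3) by (simp add: m_def blinfun.add_right blinfun.diff_right)
    then show ?thesis using nh by blast
  qed
  show thesis using that[OF q(1) qn main] by blast
qed

section \<open>From nowhere differentiable functionals to separable duals\<close>

lemma sublinear_convex_on: "sublinear q \<Longrightarrow> convex_on UNIV q"
proof (rule convex_onI)
  fix t :: real and x y assume q: "sublinear q" and t: "0 < t" "t < 1"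
  have "q ((1 - t) *\<^sub>R x + t *\<^sub>R y) \<le> q ((1 - t) *\<^sub>R x) + q (t *\<^sub>R y)" by (rule sublinear_add[OF q])
  then show "q ((1 - t) *\<^sub>R x + t *\<^sub>R y) \<le> (1 - t) * q x + t * q y" using sublinear_scaleR[OF q] t by simp
qed auto

lemma differentiable_second_difference:
  fixes q :: "'b::real_normed_vector \<Rightarrow> real"
  assumes "q differentiable (at x)" "e > 0"
  obtains t where "t > 0" "\<And>h. norm h = t \<Longrightarrow> q (x + h) + q (x - h) - 2 * q x \<le> e * t"
proof -
  obtain q' where q': "(q has_derivative q') (at x)" using assms(1) by (auto simp: differentiable_def)
  then obtain d where d: "d > 0" "\<And>y. norm (y - x) < d \<Longrightarrow> norm (q y - q x - q' (y - x)) \<le> e / 2 * norm (y - x)"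
    using assms(2) unfolding has_derivative_at_alt by (metis half_gt_zero)
  have lin: "q' (- h) = - q' h" for h using q' by (simp add: has_derivative_linear linear_neg)
  show thesis
  proof (rule that[of "d / 2"])
    show "d / 2 > 0" using d by simp
    fix h :: 'b assume h: "norm h = d / 2"
    have n: "norm (x + h - x) = d / 2" "norm (x - h - x) = d / 2" using h by simp_all
    have "norm (q (x + h) - q x - q' (x + h - x)) \<le> e / 2 * (d / 2)"
      using d(2)[of "x + h"] d(1) unfolding n by simp
    moreover have "norm (q (x - h) - q x - q' (x - h - x)) \<le> e / 2 * (d / 2)"
      using d(2)[of "x - h"] d(1) unfolding n by simp
    ultimately have "q (x + h) - q x - q' (x + h - x) \<le> e / 2 * (d / 2)"
        "q (x - h) - q x - q' (x - h - x) \<le> e / 2 * (d / 2)"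
      unfolding real_norm_def abs_le_iff by blast+
    then have "q (x + h) - q x - q' h \<le> e / 2 * (d / 2)" "q (x - h) - q x - q' (- h) \<le> e / 2 * (d / 2)"
      by simp_all
    then show "q (x + h) + q (x - h) - 2 * q x \<le> e * (d / 2)" unfolding lin by (simp add: field_simps)
  qed
qed

lemma exists_maximal_separated:
  fixes dd :: "'c \<Rightarrow> 'c \<Rightarrow> bool"
  assumes "\<And>a b. dd a b \<Longrightarrow> dd b a"
  obtains A where "A \<subseteq> U" "\<And>a b. a \<in> A \<Longrightarrow> b \<in> A \<Longrightarrow> a \<noteq> b \<Longrightarrow> dd a b"
    "\<And>x. x \<in> U \<Longrightarrow> x \<in> A \<or> (\<exists>a\<in>A. \<not> dd a x)"
proof -
  define F where "F = {A. A \<subseteq> U \<and> (\<forall>a\<in>A. \<forall>b\<in>A. a \<noteq> b \<longrightarrow> dd a b)}"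
  have "\<Union>C \<in> F" if C: "subset.chain F C" for C
  proof -
    have "dd a b" if ab: "a \<in> \<Union>C" "b \<in> \<Union>C" "a \<noteq> b" for a b
    proof -
      obtain X Z where XZ: "X \<in> C" "a \<in> X" "Z \<in> C" "b \<in> Z" using ab by blast
      then have "X \<subseteq> Z \<or> Z \<subseteq> X" using C by (auto simp: subset_chain_def)
      then show ?thesis using XZ C ab(3) unfolding subset_chain_def F_def by blast
    qed
    moreover have "\<Union>C \<subseteq> U" using C by (auto simp: subset_chain_def F_def)
    ultimately show ?thesis by (auto simp: F_def)
  qed
  then obtain A where A: "A \<in> F" "\<And>X. X \<in> F \<Longrightarrow> A \<subseteq> X \<Longrightarrow> X = A" using subset_Zorn'[of F] by blast
  have "x \<in> A \<or> (\<exists>a\<in>A. \<not> dd a x)" if x: "x \<in> U" for x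
  proof (rule ccontr)
    assume n: "\<not> ?thesis"
    then have "insert x A \<in> F" using A(1) x assms by (auto simp: F_def)
    then show False using A(2)[of "insert x A"] n by auto
  qed
  then show thesis using A(1) that by (auto simp: F_def)
qed

text \<open>An uncountable separated family keeps uncountable slices after all its countable slices
  are discarded. Each slice then contains two separated elements, and the convex function built from
  them has no point of differentiability at all.\<close>

lemma asplund_countable_separated:
  fixes D :: "'b::banach set" and A :: "('b \<Rightarrow>\<^sub>L real) set"
  assumes asp: "asplund_space TYPE('b)" and D: "countable D" "0 \<in> D" "subspace (closure D)" and \<epsilon>: "\<epsilon> > 0"
    and A: "\<And>a. a \<in> A \<Longrightarrow> norm a \<le> 1"
    and sep: "\<And>a b. a \<in> A \<Longrightarrow> b \<in> A \<Longrightarrow> a \<noteq> b \<Longrightarrow> \<exists>y\<in>D. \<epsilon> * norm y < \<bar>blinfun_apply a y - blinfun_apply b y\<bar>"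
  shows "countable A"
proof (rule ccontr)
  assume unc: "\<not> countable A"
  define sl where "sl d t = {b \<in> A. t < blinfun_apply b d}" for d and t :: real
  \<comment> \<open>Only rational levels and points of the countable set \<open>D\<close> occur, so
    what is discarded is countable.\<close>
  define small where "small = (\<Union>(d, t)\<in>{(d, t). d \<in> D \<and> t \<in> \<rat> \<and> countable (sl d t)}. sl d t)"
  have "countable {(d, t). d \<in> D \<and> t \<in> \<rat> \<and> countable (sl d t)}"
    by (rule countable_subset[of _ "D \<times> \<rat>"]) (auto intro: D countable_SIGMA simp: countable_rat)
  then have cs: "countable small" unfolding small_def by (intro countable_UN) auto
  define A' where "A' = A - small"
  have A'ne: "A' \<noteq> {}" using unc cs unfolding A'_def by (metis Diff_eq_empty_iff countable_subset)
  have slice: "\<exists>b\<in>A'. \<exists>c\<in>A'. t < blinfun_apply b d \<and> t < blinfun_apply c d \<and>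
        (\<exists>y\<in>D. \<epsilon> * norm y < blinfun_apply b y - blinfun_apply c y)"
    if a: "a \<in> A'" "d \<in> D" "t < blinfun_apply a d" for a d t
  proof -
    obtain r where r: "r \<in> \<rat>" "t < r" "r < blinfun_apply a d" using Rats_dense_in_real[OF a(3)] by blast
    have "\<not> countable (sl d r)"
    proof
      assume "countable (sl d r)"
      then have "sl d r \<subseteq> small" using a(2) r(1) by (auto simp: small_def)
      moreover have "a \<in> sl d r" using a r by (auto simp: sl_def A'_def)
      ultimately show False using a(1) by (auto simp: A'_def)
    qed
    then have unc': "\<not> countable (sl d r - small)" using cs by (rule uncountable_minus_countable)
    then obtain b where b: "b \<in> sl d r - small" by (metis countable_empty equals0I)
    have "\<not> countable (sl d r - small - {b})" using unc' by (rule uncountable_minus_countable) simp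
    then obtain c where c: "c \<in> sl d r - small - {b}" by (metis countable_empty equals0I)
    have bcA: "b \<in> A'" "c \<in> A'" "t < blinfun_apply b d" "t < blinfun_apply c d" "b \<noteq> c"
      using b c r by (auto simp: sl_def A'_def)
    then obtain y where y: "y \<in> D" "\<epsilon> * norm y < \<bar>blinfun_apply b y - blinfun_apply c y\<bar>"
      using sep[of b c] by (auto simp: A'_def)
    show ?thesis
    proof (cases "blinfun_apply b y - blinfun_apply c y \<ge> 0")
      case True
      then show ?thesis using bcA y by (intro bexI[of _ b] bexI[of _ c]) auto
    next
      case False
      then show ?thesis using bcA y by (intro bexI[of _ c] bexI[of _ b]) auto
    qed
  qed
  have A'1: "\<And>a. a \<in> A' \<Longrightarrow> norm a \<le> 1" using A by (auto simp: A'_def)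
  obtain q :: "'b \<Rightarrow> real" where q: "sublinear q" "\<And>x. q x \<le> norm x"
    and nd: "\<And>x t \<eta>. t > 0 \<Longrightarrow> \<eta> > 0 \<Longrightarrow> \<exists>h. norm h = t \<and> \<epsilon> * t - \<eta> \<le> q (x + h) + q (x - h) - 2 * q x"
  proof (rule nowhere_differentiable_sublinear[OF D(3,2) A'ne A'1 \<epsilon>])
    fix a d t assume "a \<in> A'" "d \<in> D" "t < blinfun_apply a d"
    then show "\<exists>b\<in>A'. \<exists>c\<in>A'. t < blinfun_apply b d \<and> t < blinfun_apply c d \<and>
        (\<exists>y\<in>D. \<epsilon> * norm y < blinfun_apply b y - blinfun_apply c y)" by (rule slice)
  next
    fix q :: "'b \<Rightarrow> real" assume "sublinear q" "\<And>x. q x \<le> norm x"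
      "\<And>x t \<eta>. t > 0 \<Longrightarrow> \<eta> > 0 \<Longrightarrow> \<exists>h. norm h = t \<and> \<epsilon> * t - \<eta> \<le> q (x + h) + q (x - h) - 2 * q x"
    then show thesis by (rule that)
  qed
  have "q x - q y \<le> 1 * norm (x - y)" for x y using sublinear_diff[OF q(1), of x y] q(2)[of "x - y"] by simp
  then have "continuous_on UNIV q" by (rule continuous_on_one_sided_lipschitz) simp
  then obtain E where "UNIV \<subseteq> closure E" "\<And>x. x \<in> E \<Longrightarrow> q differentiable (at x)"
    using asp sublinear_convex_on[OF q(1)] unfolding asplund_space_def by (metis convex_UNIV open_UNIV)
  moreover have "E \<noteq> {}" using \<open>UNIV \<subseteq> closure E\<close> by auto
  ultimately obtain x where x: "q differentiable (at x)" by blast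
  obtain t where t: "t > 0" "\<And>h. norm h = t \<Longrightarrow> q (x + h) + q (x - h) - 2 * q x \<le> \<epsilon> / 4 * t"
    using differentiable_second_difference[OF x, of "\<epsilon> / 4"] \<epsilon> by auto
  obtain h where "norm h = t" "\<epsilon> * t - \<epsilon> * t / 2 \<le> q (x + h) + q (x - h) - 2 * q x"
    using nd[OF t(1), of "\<epsilon> * t / 2" x] \<epsilon> t(1) by auto
  then have "\<epsilon> * t \<le> 0" using t(2)[of h] by simp
  then show False using \<epsilon> t(1) by (simp add: mult_le_0_iff)
qed

text \<open>A maximal separated subset of the dual unit ball is a net for it in the seminorm given
  by the set. Passing from \<open>D\<close> to its closure \<open>E\<close> under rational
  combinations makes the closure a subspace, as the extension of functionals requires.\<close>

lemma asplund_separable_dual_on: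
  fixes D :: "'b::banach set"
  assumes asp: "asplund_space TYPE('b)" and D: "countable D"
  shows "separable_dual_on D"
proof -
  define ops where "ops i x y = of_rat (fst i) *\<^sub>R x + of_rat (snd i) *\<^sub>R y" for i :: "rat \<times> rat" and x y :: 'b
  obtain E where E: "countable E" "insert 0 D \<subseteq> E" "\<And>i x y. x \<in> E \<Longrightarrow> y \<in> E \<Longrightarrow> ops i x y \<in> E"
    using countable_operation_closure[of "insert 0 D" UNIV ops] D by auto
  have E0: "0 \<in> E" using E(2) by auto
  have "of_rat r *\<^sub>R x + of_rat s *\<^sub>R y \<in> E" if "x \<in> E" "y \<in> E" for r s x y
    using E(3)[OF that, of "(r, s)"] by (simp add: ops_def)
  then have sub: "subspace (closure E)" using E0 by (intro subspace_closure_rational) auto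
  have "\<exists>A. countable A \<and> (\<forall>x' :: 'b \<Rightarrow>\<^sub>L real. norm x' \<le> 1 \<longrightarrow>
      (\<exists>a\<in>A. \<forall>y\<in>E. \<bar>blinfun_apply a y - blinfun_apply x' y\<bar> \<le> \<epsilon> * norm y))" if \<epsilon>: "\<epsilon> > 0" for \<epsilon> :: real
  proof -
    define dd where "dd a b \<longleftrightarrow> (\<exists>y\<in>E. \<epsilon> * norm y < \<bar>blinfun_apply a y - blinfun_apply b y\<bar>)" for a b :: "'b \<Rightarrow>\<^sub>L real"
    have sym: "dd b a" if "dd a b" for a b using that by (auto simp: dd_def abs_minus_commute)
    obtain A where A: "A \<subseteq> {x'. norm x' \<le> 1}" "\<And>a b. a \<in> A \<Longrightarrow> b \<in> A \<Longrightarrow> a \<noteq> b \<Longrightarrow> dd a b"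
      "\<And>x'. x' \<in> {x'. norm x' \<le> 1} \<Longrightarrow> x' \<in> A \<or> (\<exists>a\<in>A. \<not> dd a x')"
    proof (rule exists_maximal_separated[of dd "{x'. norm x' \<le> 1}", OF sym])
      fix A assume "A \<subseteq> {x'. norm x' \<le> 1}" "\<And>a b. a \<in> A \<Longrightarrow> b \<in> A \<Longrightarrow> a \<noteq> b \<Longrightarrow> dd a b"
        "\<And>x'. x' \<in> {x'. norm x' \<le> 1} \<Longrightarrow> x' \<in> A \<or> (\<exists>a\<in>A. \<not> dd a x')"
      then show thesis by (rule that)
    qed
    have "countable A"
      by (rule asplund_countable_separated[OF asp E(1) E0 sub \<epsilon>]) (use A(1,2) in \<open>auto simp: dd_def\<close>)
    moreover have "\<exists>a\<in>A. \<forall>y\<in>E. \<bar>blinfun_apply a y - blinfun_apply x' y\<bar> \<le> \<epsilon> * norm y" if x1: "norm x' \<le> 1" for x'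
    proof -
      consider "x' \<in> A" | "\<exists>a\<in>A. \<not> dd a x'" using A(3)[of x'] x1 by auto
      then show ?thesis
      proof cases
        case 1 then show ?thesis using \<epsilon> by (intro bexI[of _ x']) auto
      next
        case 2 then show ?thesis by (auto simp: dd_def not_less)
      qed
    qed
    ultimately show ?thesis by blast
  qed
  then obtain A :: "real \<Rightarrow> ('b \<Rightarrow>\<^sub>L real) set" where A: "\<And>\<epsilon>. \<epsilon> > 0 \<Longrightarrow> countable (A \<epsilon>)"
    "\<And>\<epsilon> x'. \<epsilon> > 0 \<Longrightarrow> norm x' \<le> 1 \<Longrightarrow> \<exists>a\<in>A \<epsilon>. \<forall>y\<in>E. \<bar>blinfun_apply a y - blinfun_apply x' y\<bar> \<le> \<epsilon> * norm y"
    by metis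
  \<comment> \<open>The integer factors bring in functionals of any norm; the mesh
    \<open>1 / real (Suc k)\<close> is refined to compensate for the factor.\<close>
  define C where "C = (\<Union>k::nat. \<Union>m::nat. (\<lambda>a. real (Suc m) *\<^sub>R a) ` A (1 / real (Suc k)))"
  have "countable C" unfolding C_def using A(1) by (intro countable_UN countable_image) auto
  moreover have "\<exists>c\<in>C. \<forall>y\<in>D. \<bar>blinfun_apply x' y - blinfun_apply c y\<bar> \<le> \<epsilon> * norm y" if \<epsilon>: "\<epsilon> > 0" for x' and \<epsilon> :: real
  proof -
    obtain m :: nat where m: "norm x' < real m" using reals_Archimedean2 by blast
    obtain k :: nat where k: "real (Suc m) / \<epsilon> < real k" using reals_Archimedean2 by blast
    define z where "z = (1 / real (Suc m)) *\<^sub>R x'"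
    have "norm z \<le> 1" using m by (simp add: z_def)
    then obtain a where a: "a \<in> A (1 / real (Suc k))"
        "\<And>y. y \<in> E \<Longrightarrow> \<bar>blinfun_apply a y - blinfun_apply z y\<bar> \<le> 1 / real (Suc k) * norm y"
      using A(2)[of "1 / real (Suc k)" z] by auto
    have "\<bar>blinfun_apply x' y - blinfun_apply (real (Suc m) *\<^sub>R a) y\<bar> \<le> \<epsilon> * norm y" if y: "y \<in> D" for y
    proof -
      have xz: "blinfun_apply x' y = real (Suc m) * blinfun_apply z y" by (simp add: z_def blinfun.scaleR_left)
      have "\<bar>blinfun_apply x' y - blinfun_apply (real (Suc m) *\<^sub>R a) y\<bar>
          = real (Suc m) * \<bar>blinfun_apply a y - blinfun_apply z y\<bar>"
        unfolding xz blinfun.scaleR_left real_scaleR_def right_diff_distrib[symmetric]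
        by (simp add: abs_mult abs_minus_commute)
      also have "\<dots> \<le> real (Suc m) * (1 / real (Suc k) * norm y)"
        using y E(2) by (intro mult_left_mono a(2)) auto
      also have "\<dots> \<le> \<epsilon> * norm y"
      proof -
        have "real (Suc m) \<le> \<epsilon> * real (Suc k)" using k \<epsilon> by (simp add: field_simps)
        then have "real (Suc m) * (1 / real (Suc k)) \<le> \<epsilon>" by (simp add: field_simps)
        from mult_right_mono[OF this norm_ge_zero[of y]] show ?thesis by (simp only: mult.assoc)
      qed
      finally show ?thesis .
    qed
    moreover have "real (Suc m) *\<^sub>R a \<in> C" using a(1) unfolding C_def by blast
    ultimately show ?thesis by blast
  qed
  ultimately show ?thesis unfolding separable_dual_on_def by blast
qed

section \<open>Finite products\<close>

text \<open>The space of bounded continuous functions is known to be complete only for a metric domain; the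
  discrete metric induces the given topology of \<open>nat\<close>.\<close>

instantiation nat :: metric_space
begin

definition dist_nat :: "nat \<Rightarrow> nat \<Rightarrow> real" where
  "dist_nat m n = (if m = n then 0 else 1)"

definition uniformity_nat :: "(nat \<times> nat) filter" where
  "uniformity_nat = (INF e\<in>{0 <..}. principal {(x, y). dist x y < e})"

instance
proof
  have "(uniformity :: (nat \<times> nat) filter) \<le> principal {(x, y). dist x y < 1}"
    unfolding uniformity_nat_def by (rule INF_lower) simp
  moreover have "eventually (\<lambda>(x', y). x' = x \<longrightarrow> y \<in> U) (principal {(x, y). dist x y < 1})"
    if "x \<in> U" for x and U :: "nat set"
    using that by (auto simp: eventually_principal dist_nat_def split: if_splits)
  ultimately have "eventually (\<lambda>(x', y). x' = x \<longrightarrow> y \<in> U) uniformity" if "x \<in> U" for x and U :: "nat set"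
    using that by (blast intro: filter_leD)
  then show "open U \<longleftrightarrow> (\<forall>x\<in>U. \<forall>\<^sub>F (x', y) in uniformity. x' = x \<longrightarrow> y \<in> U)" for U :: "nat set"
    by (simp add: open_discrete)
qed (auto simp: dist_nat_def uniformity_nat_def)

end

instance bcontfun :: (metric_space, banach) banach ..

text \<open>The product of copies of \<open>'a\<close> indexed by a finite set of natural numbers, with the maximum
  norm, is realised as a subspace of the Banach space of bounded functions on \<open>nat\<close>.\<close>

definition tup :: "nat set \<Rightarrow> (nat \<Rightarrow> 'a::real_normed_vector) \<Rightarrow> nat \<Rightarrow>\<^sub>C 'a" where
  "tup I f = Bcontfun (\<lambda>i. if i \<in> I then f i else 0)"

definition supported :: "nat set \<Rightarrow> (nat \<Rightarrow>\<^sub>C 'a::real_normed_vector) set" where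
  "supported I = {h. \<forall>i. i \<notin> I \<longrightarrow> apply_bcontfun h i = 0}"

lemma tup_apply: "finite I \<Longrightarrow> apply_bcontfun (tup I f) i = (if i \<in> I then f i else 0)"
proof -
  assume I: "finite I"
  have "range (\<lambda>i. if i \<in> I then f i else 0) \<subseteq> insert 0 (f ` I)" by auto
  then have "finite (range (\<lambda>i. if i \<in> I then f i else 0))" using I by (meson finite.insertI finite_imageI finite_subset)
  then have "(\<lambda>i. if i \<in> I then f i else 0) \<in> bcontfun"
    by (simp add: bcontfun_def finite_imp_bounded)
  then show ?thesis by (simp add: tup_def Bcontfun_inverse)
qed

lemma tup_supported: "finite I \<Longrightarrow> tup I f \<in> supported I"
  by (simp add: supported_def tup_apply)

lemma tup_eq: "finite I \<Longrightarrow> h \<in> supported I \<Longrightarrow> tup I (apply_bcontfun h) = h"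
  by (auto intro!: bcontfun_eqI simp: supported_def tup_apply)

lemma tup_add: "finite I \<Longrightarrow> tup I (\<lambda>i. f i + g i) = tup I f + tup I g"
  and tup_scaleR: "finite I \<Longrightarrow> tup I (\<lambda>i. c *\<^sub>R f i) = c *\<^sub>R tup I f"
  by (auto intro!: bcontfun_eqI simp: tup_apply)

lemma norm_tup_le: "finite I \<Longrightarrow> 0 \<le> B \<Longrightarrow> (\<And>i. i \<in> I \<Longrightarrow> norm (f i) \<le> B) \<Longrightarrow> norm (tup I f) \<le> B"
  by (rule norm_bound) (simp add: tup_apply)

lemma norm_tup_single: "norm (tup {i} (\<lambda>_. x)) = norm x"
proof (rule antisym)
  show "norm (tup {i} (\<lambda>_. x)) \<le> norm x" by (rule norm_tup_le) auto
  show "norm x \<le> norm (tup {i} (\<lambda>_. x))" using norm_bounded[of "tup {i} (\<lambda>_. x)" i] by (simp add: tup_apply)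
qed

lemma subspace_supported: "subspace (supported I)"
  by (auto simp: subspace_def supported_def)

definition component :: "((nat \<Rightarrow>\<^sub>C 'a::real_normed_vector) \<Rightarrow>\<^sub>L real) \<Rightarrow> nat \<Rightarrow> 'a \<Rightarrow>\<^sub>L real" where
  "component x' i = Blinfun (\<lambda>x. blinfun_apply x' (tup {i} (\<lambda>_. x)))"

lemma component_apply: "blinfun_apply (component x' i) x = blinfun_apply x' (tup {i} (\<lambda>_. x))"
proof -
  have "bounded_linear (\<lambda>x. blinfun_apply x' (tup {i} (\<lambda>_. x)))"
  proof (rule bounded_linear_intro[where K = "norm x'"])
    show "norm (blinfun_apply x' (tup {i} (\<lambda>_. x))) \<le> norm x * norm x'" for x
      using norm_blinfun[of x' "tup {i} (\<lambda>_. x)"] by (simp add: norm_tup_single mult.commute)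
  qed (simp_all add: tup_add tup_scaleR blinfun.add_right blinfun.scaleR_right)
  then show ?thesis by (simp add: component_def bounded_linear_Blinfun_apply)
qed

lemma blinfun_tup:
  assumes "finite I"
  shows "blinfun_apply x' (tup I f) = (\<Sum>i\<in>I. blinfun_apply (component x' i) (f i))"
  using assms
proof (induction I rule: finite_induct)
  case empty
  have "tup {} f = 0" by (intro bcontfun_eqI) (simp add: tup_apply)
  then show ?case by (simp add: blinfun.zero_right)
next
  case (insert i I)
  then have "tup (insert i I) f = tup {i} (\<lambda>_. f i) + tup I f"
    by (intro bcontfun_eqI) (auto simp: tup_apply)
  then show ?case using insert by (simp add: blinfun.add_right component_apply)
qed

lemma blinfun_nearly_norming:
  fixes x' :: "'a::real_normed_vector \<Rightarrow>\<^sub>L real"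
  assumes "e > 0"
  shows "\<exists>x. norm x \<le> 1 \<and> norm x' - e \<le> blinfun_apply x' x"
proof (cases "norm x' - e \<le> 0")
  case True
  then show ?thesis by (intro exI[of _ 0]) (simp add: blinfun.zero_right)
next
  case False
  have "\<not> (\<forall>x. blinfun_apply x' x \<le> (norm x' - e) * norm x)"
    using blinfun_norm_leI[of "norm x' - e" x'] False assms by auto
  then obtain x where x: "(norm x' - e) * norm x < blinfun_apply x' x" by (auto simp: not_le)
  then have "x \<noteq> 0" by (auto simp: blinfun.zero_right)
  then show ?thesis using x
    by (intro exI[of _ "(1 / norm x) *\<^sub>R x"]) (simp add: blinfun.scaleR_right field_simps)
qed

text \<open>The dual of the maximum norm is the sum of the dual norms. Norms of functionals need not
  be attained, hence the \<open>d\<close> lost in each coordinate.\<close>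

lemma sum_norm_le:
  fixes x' :: "nat \<Rightarrow> 'a::real_normed_vector \<Rightarrow>\<^sub>L real"
  assumes I: "finite I" and le: "\<And>f. (\<And>i. i \<in> I \<Longrightarrow> norm (f i) \<le> 1) \<Longrightarrow> (\<Sum>i\<in>I. blinfun_apply (x' i) (f i)) \<le> B"
  shows "(\<Sum>i\<in>I. norm (x' i)) \<le> B"
proof (rule field_le_epsilon)
  fix e :: real assume e: "e > 0"
  define d where "d = e / (real (card I) + 1)"
  have d: "d > 0" using e by (simp add: d_def add_nonneg_pos)
  have "\<forall>i. \<exists>x. norm x \<le> 1 \<and> norm (x' i) - d \<le> blinfun_apply (x' i) x"
    using blinfun_nearly_norming[OF d] by blast
  then obtain f where f: "\<And>i. norm (f i) \<le> 1" "\<And>i. norm (x' i) - d \<le> blinfun_apply (x' i) (f i)"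
    by metis
  have "(\<Sum>i\<in>I. norm (x' i) - d) \<le> (\<Sum>i\<in>I. blinfun_apply (x' i) (f i))" by (intro sum_mono f)
  also have "\<dots> \<le> B" using f(1) by (rule le)
  finally have "(\<Sum>i\<in>I. norm (x' i)) \<le> B + real (card I) * d" by (simp add: sum_subtractf)
  also have "real (card I) * d \<le> e" using e by (simp add: d_def field_simps)
  finally show "(\<Sum>i\<in>I. norm (x' i)) \<le> B + e" by simp
qed

lemma bounded_linear_apply_bcontfun: "bounded_linear (\<lambda>h :: nat \<Rightarrow>\<^sub>C 'a::real_normed_vector. apply_bcontfun h i)"
  by (rule bounded_linear_intro[where K = 1]) (auto simp: norm_bounded)

text \<open>A functional on a finite product is the sum of its components, so approximating each
  component separately is enough.\<close>

lemma separable_dual_on_supported: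
  fixes D :: "(nat \<Rightarrow>\<^sub>C 'a::real_normed_vector) set"
  assumes I: "finite I" and D: "D \<subseteq> supported I"
    and sd: "\<And>i. i \<in> I \<Longrightarrow> separable_dual_on ((\<lambda>h. apply_bcontfun h i) ` D)"
  shows "separable_dual_on D"
proof -
  have "\<exists>C. i \<in> I \<longrightarrow> countable C \<and> (\<forall>x' :: 'a \<Rightarrow>\<^sub>L real. \<forall>\<epsilon>>0. \<exists>c\<in>C. \<forall>y\<in>D.
      \<bar>blinfun_apply x' (apply_bcontfun y i) - blinfun_apply c (apply_bcontfun y i)\<bar> \<le> \<epsilon> * norm (apply_bcontfun y i))" for i
    using sd[of i] unfolding separable_dual_on_def by auto
  then obtain C where C: "\<And>i. i \<in> I \<Longrightarrow> countable (C i)"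
    "\<And>i x' \<epsilon>. i \<in> I \<Longrightarrow> \<epsilon> > 0 \<Longrightarrow> \<exists>c\<in>C i. \<forall>y\<in>D. \<bar>blinfun_apply (x' :: 'a \<Rightarrow>\<^sub>L real) (apply_bcontfun y i)
       - blinfun_apply c (apply_bcontfun y i)\<bar> \<le> \<epsilon> * norm (apply_bcontfun y i)"
    by metis
  define F where "F c = Blinfun (\<lambda>h :: nat \<Rightarrow>\<^sub>C 'a. \<Sum>i\<in>I. blinfun_apply (c i) (apply_bcontfun h i))"
    for c :: "nat \<Rightarrow> 'a \<Rightarrow>\<^sub>L real"
  have F: "blinfun_apply (F c) h = (\<Sum>i\<in>I. blinfun_apply (c i) (apply_bcontfun h i))" for c h
    unfolding F_def
    by (subst bounded_linear_Blinfun_apply)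
      (auto intro!: bounded_linear_sum bounded_linear_compose[OF blinfun.bounded_linear_right] bounded_linear_apply_bcontfun)
  have "countable (F ` (PiE I C))" using I C(1) by (intro countable_image countable_PiE) auto
  moreover have "\<exists>c\<in>F ` (PiE I C). \<forall>y\<in>D. \<bar>blinfun_apply x' y - blinfun_apply c y\<bar> \<le> \<epsilon> * norm y"
    if \<epsilon>: "\<epsilon> > 0" for x' and \<epsilon> :: real
  proof -
    define d where "d = \<epsilon> / (real (card I) + 1)"
    have d: "d > 0" using \<epsilon> by (simp add: d_def add_nonneg_pos)
    have "\<exists>c. i \<in> I \<longrightarrow> c \<in> C i \<and> (\<forall>y\<in>D. \<bar>blinfun_apply (component x' i) (apply_bcontfun y i)
       - blinfun_apply c (apply_bcontfun y i)\<bar> \<le> d * norm (apply_bcontfun y i))" for i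
      using C(2)[OF _ d] by blast
    then obtain c where c: "\<And>i. i \<in> I \<Longrightarrow> c i \<in> C i"
      "\<And>i y. i \<in> I \<Longrightarrow> y \<in> D \<Longrightarrow> \<bar>blinfun_apply (component x' i) (apply_bcontfun y i)
       - blinfun_apply (c i) (apply_bcontfun y i)\<bar> \<le> d * norm (apply_bcontfun y i)" by metis
    have "\<bar>blinfun_apply x' y - blinfun_apply (F (restrict c I)) y\<bar> \<le> \<epsilon> * norm y" if y: "y \<in> D" for y
    proof -
      have "blinfun_apply x' y = (\<Sum>i\<in>I. blinfun_apply (component x' i) (apply_bcontfun y i))"
        using blinfun_tup[OF I, of x' "apply_bcontfun y"] tup_eq[OF I, of y] D y by auto
      then have "\<bar>blinfun_apply x' y - blinfun_apply (F (restrict c I)) y\<bar>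
          = \<bar>\<Sum>i\<in>I. blinfun_apply (component x' i) (apply_bcontfun y i) - blinfun_apply (c i) (apply_bcontfun y i)\<bar>"
        by (simp add: F sum_subtractf)
      also have "\<dots> \<le> (\<Sum>i\<in>I. \<bar>blinfun_apply (component x' i) (apply_bcontfun y i) - blinfun_apply (c i) (apply_bcontfun y i)\<bar>)"
        by (rule sum_abs)
      also have "\<dots> \<le> (\<Sum>i\<in>I. d * norm y)"
      proof (rule sum_mono)
        fix i assume i: "i \<in> I"
        show "\<bar>blinfun_apply (component x' i) (apply_bcontfun y i) - blinfun_apply (c i) (apply_bcontfun y i)\<bar> \<le> d * norm y"
          using c(2)[OF i y] mult_left_mono[OF norm_bounded[of y i] less_imp_le[OF d]] by linarith
      qed
      also have "\<dots> = (real (card I) * d) * norm y" by simp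
      also have "\<dots> \<le> \<epsilon> * norm y" using \<epsilon> by (intro mult_right_mono) (auto simp: d_def field_simps)
      finally show ?thesis .
    qed
    moreover have "restrict c I \<in> PiE I C" using c(1) by auto
    ultimately show ?thesis by blast
  qed
  ultimately show ?thesis unfolding separable_dual_on_def by blast
qed

section \<open>Multipliers\<close>

text \<open>A chain rule with error: \<open>m\<close> is a subgradient of \<open>p\<close> at
  \<open>v\<close> up to \<open>b / C0\<close>. The separation takes place in the target space of
  \<open>A\<close>, so the functional obtained acts there.\<close>

lemma sublinear_composite_multipliers:
  fixes p :: "'c::real_normed_vector \<Rightarrow> real" and A :: "'b::real_normed_vector \<Rightarrow> 'c"
  assumes p: "sublinear p" "\<And>w. p w \<le> norm w" and A: "linear A" and C0: "C0 > 0" and s: "s \<ge> 0" "b \<ge> 0"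
    and x': "\<And>h. - blinfun_apply x' h \<le> C0 * (p (v + A h) - p v) + s * norm h + b"
  obtains m :: "'c \<Rightarrow>\<^sub>L real" where "\<And>w. blinfun_apply m w \<le> p w" "p v - b / C0 \<le> blinfun_apply m v"
    "\<And>h. blinfun_apply x' h + C0 * blinfun_apply m (A h) \<le> s * norm h"
proof -
  define q where "q w = C0 * (p (v + w) - p v) + b" for w
  \<comment> \<open>The image under \<open>A\<close> of the epigraph of
    \<open>s * norm h + blinfun_apply x' h\<close>. A functional below \<open>c\<close> on it bounds
    the remainder in the source space by \<open>s\<close>.\<close>
  define K where "K = {(A h, c) | h c. s * norm h + blinfun_apply x' h \<le> c}"
  have pL: "p x - p y \<le> norm (x - y)" for x y using sublinear_diff[OF p(1), of x y] p(2)[of "x - y"] by simp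
  have qL: "q x - q y \<le> C0 * norm (x - y)" for x y
    using pL[of "v + x" "v + y"] C0 by (simp add: q_def right_diff_distrib[symmetric])
  have "convex_on UNIV (\<lambda>w. C0 * p (v + w) + (b - C0 * p v))"
    using C0 by (intro convex_on_add convex_on_cmul convex_on_shift[OF sublinear_convex_on[OF p(1)], of v])
      (simp_all add: convex_on_const)
  then have qc: "convex_on UNIV q" by (simp add: q_def[abs_def] algebra_simps)
  obtain y' where y': "\<And>w c. (w, c) \<in> K \<Longrightarrow> blinfun_apply y' w \<le> c" "\<And>w. - blinfun_apply y' w \<le> q w"
  proof (rule convex_sandwich[OF qc qL, of K])
    show "(0, 0) \<in> K" unfolding K_def using linear_0[OF A]
      by (auto intro!: exI[of _ 0] simp: blinfun.zero_right)
    show "(w + w', c + c') \<in> K" if w: "(w, c) \<in> K" "(w', c') \<in> K" for w c w' c'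
    proof -
      obtain h h' where h: "w = A h" "s * norm h + blinfun_apply x' h \<le> c"
          "w' = A h'" "s * norm h' + blinfun_apply x' h' \<le> c'"
        using w by (auto simp: K_def)
      have "s * norm (h + h') \<le> s * norm h + s * norm h'"
        using mult_left_mono[OF norm_triangle_ineq s(1), of h h'] by (simp add: distrib_left)
      then show ?thesis unfolding K_def using h linear_add[OF A, of h h']
        by (auto intro!: exI[of _ "h + h'"] simp: blinfun.add_right)
    qed
    show "(t *\<^sub>R w, t * c) \<in> K" if t: "t > 0" and w: "(w, c) \<in> K" for t w c
    proof -
      obtain h where h: "w = A h" "s * norm h + blinfun_apply x' h \<le> c" using w by (auto simp: K_def)
      have "t * (s * norm h + blinfun_apply x' h) \<le> t * c" using h(2) t by (intro mult_left_mono) auto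
      then show ?thesis unfolding K_def using h(1) linear_scale[OF A, of t h] t
        by (auto intro!: exI[of _ "t *\<^sub>R h"] simp: blinfun.scaleR_right algebra_simps)
    qed
    show "0 \<le> c + q w" if "(w, c) \<in> K" for w c
    proof -
      obtain h where h: "w = A h" "s * norm h + blinfun_apply x' h \<le> c" using \<open>(w, c) \<in> K\<close> by (auto simp: K_def)
      then show ?thesis using x'[of h] by (simp add: q_def)
    qed
  qed auto
  define m where "m = (- 1 / C0) *\<^sub>R y'"
  have m: "C0 * blinfun_apply m w = - blinfun_apply y' w" for w
    using C0 by (simp add: m_def blinfun.scaleR_left blinfun.minus_left)
  have mq: "C0 * blinfun_apply m w \<le> q w" for w using y'(2) m by simp
  show thesis
  proof (rule that)
    fix w
    \<comment> \<open>Testing at large multiples of \<open>w\<close> removes the additive error from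
      the domination by \<open>p\<close>.\<close>
    have "C0 * blinfun_apply m w \<le> C0 * p w + b / t" if t: "t > 0" for t
    proof -
      have "t * (C0 * blinfun_apply m w) \<le> q (t *\<^sub>R w)" using mq[of "t *\<^sub>R w"] by (simp add: blinfun.scaleR_right ac_simps)
      also have "\<dots> \<le> C0 * (t * p w) + b"
        unfolding q_def using sublinear_add[OF p(1), of v "t *\<^sub>R w"] sublinear_scaleR[OF p(1) t, of w] C0
        by (intro add_right_mono mult_left_mono) auto
      finally show ?thesis using t by (simp add: field_simps)
    qed
    note le = this
    have "C0 * blinfun_apply m w \<le> C0 * p w"
    proof (rule tendsto_lowerbound)
      show "((\<lambda>t. C0 * p w + b / t) \<longlongrightarrow> C0 * p w) at_top"
        using tendsto_add[OF tendsto_const[of "C0 * p w"] tendsto_divide_0[OF tendsto_const[of b]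
          filterlim_at_top_imp_at_infinity[OF filterlim_ident]]] by simp
      show "\<forall>\<^sub>F t in at_top. C0 * blinfun_apply m w \<le> C0 * p w + b / t"
        using eventually_gt_at_top[of 0] by eventually_elim (rule le)
    qed simp
    then show "blinfun_apply m w \<le> p w" using C0 by simp
  next
    have "C0 * blinfun_apply m (- v) \<le> - C0 * p v + b"
      using mq[of "- v"] sublinear_zero[OF p(1)] by (simp add: q_def)
    then show "p v - b / C0 \<le> blinfun_apply m v" using C0 by (simp add: blinfun.minus_right field_simps)
  next
    fix h
    have "blinfun_apply y' (A (- h)) \<le> s * norm (- h) + blinfun_apply x' (- h)"
      by (rule y'(1)) (auto simp: K_def)
    then show "blinfun_apply x' h + C0 * blinfun_apply m (A h) \<le> s * norm h"
      using m[of "A h"] by (simp add: blinfun.minus_right linear_neg[OF A])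
  qed
qed

section \<open>The maximum norm of gaps in rescaled coordinates\<close>

definition max_norm :: "nat set \<Rightarrow> (nat \<Rightarrow>\<^sub>C 'a::real_normed_vector) \<Rightarrow> real" where
  "max_norm J w = (MAX i\<in>J. norm (apply_bcontfun w i))"

text \<open>The linear part of the map that takes points \<open>\<kappa> i *\<^sub>R h i\<close> to
  the vectors whose maximum norm is minimised; the translations \<open>a i\<close> are added as a
  constant tuple.\<close>

definition gap :: "nat set \<Rightarrow> nat \<Rightarrow> (nat \<Rightarrow> real) \<Rightarrow> (nat \<Rightarrow>\<^sub>C 'a) \<Rightarrow> nat \<Rightarrow>\<^sub>C 'a::real_normed_vector" where
  "gap J n \<kappa> h = tup J (\<lambda>i. \<kappa> n *\<^sub>R apply_bcontfun h n - \<kappa> i *\<^sub>R apply_bcontfun h i)"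

lemma max_norm_le_iff: "finite J \<Longrightarrow> J \<noteq> {} \<Longrightarrow> max_norm J w \<le> B \<longleftrightarrow> (\<forall>i\<in>J. norm (apply_bcontfun w i) \<le> B)"
  unfolding max_norm_def by (subst Max_le_iff) auto

lemma norm_le_max_norm: "finite J \<Longrightarrow> i \<in> J \<Longrightarrow> norm (apply_bcontfun w i) \<le> max_norm J w"
  unfolding max_norm_def by (intro Max_ge) auto

lemma max_norm_nonneg: "finite J \<Longrightarrow> J \<noteq> {} \<Longrightarrow> 0 \<le> max_norm J w"
  using norm_le_max_norm norm_ge_zero order_trans by (metis ex_in_conv)

lemma max_norm_le_norm: "finite J \<Longrightarrow> J \<noteq> {} \<Longrightarrow> max_norm J w \<le> norm w"
  by (simp add: max_norm_le_iff norm_bounded)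

lemma sublinear_max_norm:
  assumes "finite J" "J \<noteq> {}"
  shows "sublinear (max_norm J)"
proof (rule sublinearI)
  fix x y :: "nat \<Rightarrow>\<^sub>C 'a"
  show "max_norm J (x + y) \<le> max_norm J x + max_norm J y"
    unfolding max_norm_le_iff[OF assms]
    using norm_le_max_norm[OF assms(1)] by (auto intro!: norm_triangle_le add_mono)
next
  fix t :: real and x :: "nat \<Rightarrow>\<^sub>C 'a" assume "t > 0"
  then show "max_norm J (t *\<^sub>R x) \<le> t * max_norm J x"
    unfolding max_norm_le_iff[OF assms]
    using norm_le_max_norm[OF assms(1)] by (auto intro!: mult_left_mono)
qed

lemma gap_apply: "finite J \<Longrightarrow> apply_bcontfun (gap J n \<kappa> h) i
    = (if i \<in> J then \<kappa> n *\<^sub>R apply_bcontfun h n - \<kappa> i *\<^sub>R apply_bcontfun h i else 0)"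
  by (simp add: gap_def tup_apply)

lemma linear_gap:
  assumes "finite J"
  shows "linear (gap J n \<kappa>)"
proof (rule linearI)
  show "gap J n \<kappa> (x + y) = gap J n \<kappa> x + gap J n \<kappa> y" for x y :: "nat \<Rightarrow>\<^sub>C 'a"
    by (intro bcontfun_eqI) (simp add: gap_apply[OF assms] algebra_simps)
  show "gap J n \<kappa> (c *\<^sub>R x) = c *\<^sub>R gap J n \<kappa> x" for c and x :: "nat \<Rightarrow>\<^sub>C 'a"
    by (intro bcontfun_eqI) (simp add: gap_apply[OF assms] algebra_simps)
qed

lemma norm_gap_le:
  assumes "finite J" "\<And>i. 0 \<le> \<kappa> i" "\<And>i. i \<in> J \<Longrightarrow> \<kappa> i \<le> B"
  shows "norm (gap J n \<kappa> h) \<le> (\<kappa> n + \<bar>B\<bar>) * norm h"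
  unfolding gap_def
proof (rule norm_tup_le[OF assms(1)])
  show "0 \<le> (\<kappa> n + \<bar>B\<bar>) * norm h" using assms(2)[of n] by simp
  fix i assume i: "i \<in> J"
  have "norm (\<kappa> n *\<^sub>R apply_bcontfun h n - \<kappa> i *\<^sub>R apply_bcontfun h i)
      \<le> \<kappa> n * norm (apply_bcontfun h n) + \<kappa> i * norm (apply_bcontfun h i)"
    using norm_triangle_ineq4[of "\<kappa> n *\<^sub>R apply_bcontfun h n" "\<kappa> i *\<^sub>R apply_bcontfun h i"] assms(2) by simp
  also have "\<dots> \<le> \<kappa> n * norm h + \<bar>B\<bar> * norm h"
    using assms(2)[of n] assms(2)[of i] assms(3)[OF i]
    by (intro add_mono mult_mono norm_bounded) auto
  finally show "norm (\<kappa> n *\<^sub>R apply_bcontfun h n - \<kappa> i *\<^sub>R apply_bcontfun h i) \<le> (\<kappa> n + \<bar>B\<bar>) * norm h"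
    by (simp add: distrib_right)
qed

text \<open>The multipliers are the normalised components of the functional \<open>m\<close> dominated by the maximum
  norm. Its total mass \<open>M\<close> is at most \<open>1\<close>, and at least \<open>1 - b / (C0 * max_norm J v)\<close> because \<open>m\<close> nearly
  attains the norm at \<open>v\<close>.\<close>

lemma multipliers_from_functional:
  fixes v :: "nat \<Rightarrow>\<^sub>C 'a::real_normed_vector" and NC :: "nat \<Rightarrow> ('a \<Rightarrow>\<^sub>L real) set"
  assumes J: "finite J" "J \<noteq> {}" "n \<notin> J" and \<kappa>: "\<And>i. \<kappa> i > 0" and v: "v \<in> supported J"
    and C0: "C0 > 0" and s: "s \<ge> 0" and b: "b \<ge> 0" "b < C0 * max_norm J v"
    and x': "\<And>h. - blinfun_apply x' h \<le> C0 * (max_norm J (v + gap J n \<kappa> h) - max_norm J v) + s * norm h + b"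
    and NC: "\<And>i c. i \<in> insert n J \<Longrightarrow> c > 0 \<Longrightarrow> c *\<^sub>R component x' i \<in> NC i"
  obtains X where "(\<Sum>i\<in>insert n J. X i) = 0" "(\<Sum>i\<in>J. norm (X i)) = 1"
    "C0 * (1 - b / (C0 * max_norm J v)) * (\<Sum>i\<in>insert n J. \<kappa> i * infdist (X i) (NC i)) \<le> s"
    "max_norm J v - b / C0 \<le> (\<Sum>i\<in>J. blinfun_apply (X i) (apply_bcontfun v i))"
    "(\<Sum>i\<in>J. blinfun_apply (X i) (apply_bcontfun v i)) \<le> max_norm J v"
proof -
  obtain m where m: "\<And>w. blinfun_apply m w \<le> max_norm J w" "max_norm J v - b / C0 \<le> blinfun_apply m v"
    "\<And>h. blinfun_apply x' h + C0 * blinfun_apply m (gap J n \<kappa> h) \<le> s * norm h"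
    using sublinear_composite_multipliers[OF sublinear_max_norm[OF J(1,2)] max_norm_le_norm[OF J(1,2)]
      linear_gap[OF J(1)] C0 s b(1) x'] by metis
  let ?m = "component m" and ?r = "max_norm J v"
  define M where "M = (\<Sum>i\<in>J. norm (?m i))"
  have mt: "blinfun_apply m (tup J f) = (\<Sum>i\<in>J. blinfun_apply (?m i) (f i))" for f by (rule blinfun_tup[OF J(1)])
  have mv: "blinfun_apply m v = (\<Sum>i\<in>J. blinfun_apply (?m i) (apply_bcontfun v i))"
    using mt[of "apply_bcontfun v"] tup_eq[OF J(1) v] by simp
  have M1: "M \<le> 1" unfolding M_def
  proof (rule sum_norm_le[OF J(1)])
    fix f :: "nat \<Rightarrow> 'a" assume f: "\<And>i. i \<in> J \<Longrightarrow> norm (f i) \<le> 1"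
    have "max_norm J (tup J f) \<le> 1" using f by (simp add: max_norm_le_iff[OF J(1,2)] tup_apply[OF J(1)])
    then show "(\<Sum>i\<in>J. blinfun_apply (?m i) (f i)) \<le> 1" using m(1)[of "tup J f"] by (simp add: mt)
  qed
  have r: "?r > 0" using b C0 by (metis le_less_trans zero_less_mult_pos)
  have rb: "0 < ?r - b / C0" using b(2) C0 by (simp add: field_simps)
  have mvM: "blinfun_apply m v \<le> M * ?r"
    unfolding mv M_def sum_distrib_right
  proof (rule sum_mono)
    fix i assume i: "i \<in> J"
    have "blinfun_apply (?m i) (apply_bcontfun v i) \<le> norm (?m i) * norm (apply_bcontfun v i)" by (rule blinfun_le_norm)
    also have "\<dots> \<le> norm (?m i) * ?r" by (intro mult_left_mono norm_le_max_norm J(1) i) simp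
    finally show "blinfun_apply (?m i) (apply_bcontfun v i) \<le> norm (?m i) * ?r" .
  qed
  have "0 < M * ?r" using mvM m(2) rb by linarith
  then have M0: "M > 0" using r by (simp add: zero_less_mult_iff)
  have Mb: "1 - b / (C0 * ?r) \<le> M"
  proof -
    have "(1 - b / (C0 * ?r)) * ?r = ?r - b / C0" using r by (simp add: left_diff_distrib)
    then have "(1 - b / (C0 * ?r)) * ?r \<le> M * ?r" using mvM m(2) by linarith
    then show ?thesis using r by simp
  qed
  define X where "X i = (if i = n then - (1 / M) *\<^sub>R (\<Sum>j\<in>J. ?m j) else (1 / M) *\<^sub>R ?m i)" for i
  have XJ: "X i = (1 / M) *\<^sub>R ?m i" if "i \<in> J" for i using that J(3) by (auto simp: X_def)
  have sX: "(\<Sum>i\<in>J. X i) = (1 / M) *\<^sub>R (\<Sum>i\<in>J. ?m i)" by (simp add: XJ scaleR_sum_right)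
  \<comment> \<open>The numbers \<open>\<kappa> i\<close> times these defects are the components of
    the remainder \<open>x' + C0 * m\<close> composed with \<open>gap\<close>, whose norm is at most
    \<open>s\<close>. The choice of \<open>X n\<close> makes this hold for \<open>i = n\<close>
    too.\<close>
  define z where "z i = (1 / \<kappa> i) *\<^sub>R component x' i - (C0 * M) *\<^sub>R X i" for i
  have zs: "(\<Sum>i\<in>insert n J. \<kappa> i * norm (z i)) \<le> s"
  proof -
    have "(\<Sum>i\<in>insert n J. norm (\<kappa> i *\<^sub>R z i)) \<le> s"
    proof (rule sum_norm_le)
      show "finite (insert n J)" using J by simp
      fix f :: "nat \<Rightarrow> 'a" assume f: "\<And>i. i \<in> insert n J \<Longrightarrow> norm (f i) \<le> 1"
      define h where "h = tup (insert n J) f"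
      have nh: "norm h \<le> 1" unfolding h_def using f J(1) by (intro norm_tup_le) auto
      have hi: "apply_bcontfun h i = f i" if "i \<in> insert n J" for i using that J(1) by (simp add: h_def tup_apply)
      have "blinfun_apply m (gap J n \<kappa> h) = (\<Sum>i\<in>J. blinfun_apply (?m i) (\<kappa> n *\<^sub>R f n - \<kappa> i *\<^sub>R f i))"
        unfolding gap_def mt by (intro sum.cong) (auto simp: hi)
      also have "\<dots> = \<kappa> n * blinfun_apply (\<Sum>i\<in>J. ?m i) (f n) - (\<Sum>i\<in>J. \<kappa> i * blinfun_apply (?m i) (f i))"
        by (simp add: blinfun.diff_right blinfun.scaleR_right sum_subtractf blinfun.sum_left sum_distrib_left)
      finally have mg: "blinfun_apply m (gap J n \<kappa> h) = \<dots>" .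
      have "(\<Sum>i\<in>insert n J. blinfun_apply (\<kappa> i *\<^sub>R z i) (f i))
          = (\<Sum>i\<in>insert n J. blinfun_apply (component x' i) (f i)) - (\<Sum>i\<in>insert n J. \<kappa> i * (C0 * M) * blinfun_apply (X i) (f i))"
        unfolding sum_subtractf[symmetric] using \<kappa>
        by (intro sum.cong) (auto simp: z_def blinfun.diff_left blinfun.scaleR_left algebra_simps less_imp_neq[OF \<kappa>, symmetric])
      also have "(\<Sum>i\<in>insert n J. blinfun_apply (component x' i) (f i)) = blinfun_apply x' h"
        unfolding h_def using J(1) by (simp add: blinfun_tup)
      also have "(\<Sum>i\<in>insert n J. \<kappa> i * (C0 * M) * blinfun_apply (X i) (f i)) = - (C0 * blinfun_apply m (gap J n \<kappa> h))"
      proof -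
        have "(\<Sum>i\<in>J. \<kappa> i * (C0 * M) * blinfun_apply (X i) (f i)) = C0 * (\<Sum>i\<in>J. \<kappa> i * blinfun_apply (?m i) (f i))"
          using M0 by (simp add: sum_distrib_left XJ blinfun.scaleR_left ac_simps)
        moreover have "\<kappa> n * (C0 * M) * blinfun_apply (X n) (f n) = - (C0 * (\<kappa> n * blinfun_apply (\<Sum>i\<in>J. ?m i) (f n)))"
          using M0 by (simp add: X_def blinfun.scaleR_left blinfun.minus_left)
        ultimately show ?thesis unfolding mg using J by (simp add: right_diff_distrib)
      qed
      finally have "(\<Sum>i\<in>insert n J. blinfun_apply (\<kappa> i *\<^sub>R z i) (f i)) \<le> s * norm h" using m(3)[of h] by simp
      also have "\<dots> \<le> s" using mult_left_mono[OF nh s] by simp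
      finally show "(\<Sum>i\<in>insert n J. blinfun_apply (\<kappa> i *\<^sub>R z i) (f i)) \<le> s" .
    qed
    then show ?thesis using less_imp_le[OF \<kappa>] by simp
  qed
  have dist: "C0 * M * infdist (X i) (NC i) \<le> norm (z i)" if i: "i \<in> insert n J" for i
  proof -
    \<comment> \<open>The cone contains this multiple of the component, and its distance to
      \<open>X i\<close> is \<open>norm (z i) / (C0 * M)\<close>.\<close>
    have "(1 / (C0 * M * \<kappa> i)) *\<^sub>R component x' i \<in> NC i" using C0 M0 \<kappa> by (intro NC i) auto
    then have "infdist (X i) (NC i) \<le> dist (X i) ((1 / (C0 * M * \<kappa> i)) *\<^sub>R component x' i)" by (rule infdist_le)
    also have "\<dots> = norm ((1 / (C0 * M)) *\<^sub>R z i)"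
      unfolding z_def scaleR_diff_right using C0 M0 by (simp add: dist_norm norm_minus_commute)
    finally have "infdist (X i) (NC i) \<le> norm (z i) / (C0 * M)" using C0 M0 by simp
    then show ?thesis using C0 M0 by (simp add: field_simps)
  qed
  show thesis
  proof (rule that)
    show "(\<Sum>i\<in>insert n J. X i) = 0" using J sX by (simp add: X_def)
    show "(\<Sum>i\<in>J. norm (X i)) = 1" using M0 by (simp add: XJ sum_divide_distrib[symmetric] M_def[symmetric])
    have D: "0 \<le> (\<Sum>i\<in>insert n J. \<kappa> i * infdist (X i) (NC i))"
      using less_imp_le[OF \<kappa>] by (intro sum_nonneg mult_nonneg_nonneg infdist_nonneg) auto
    have "C0 * (1 - b / (C0 * ?r)) * (\<Sum>i\<in>insert n J. \<kappa> i * infdist (X i) (NC i))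
        \<le> C0 * M * (\<Sum>i\<in>insert n J. \<kappa> i * infdist (X i) (NC i))"
      using Mb C0 D by (intro mult_right_mono mult_left_mono) auto
    also have "\<dots> = (\<Sum>i\<in>insert n J. \<kappa> i * (C0 * M * infdist (X i) (NC i)))"
      by (simp add: sum_distrib_left ac_simps)
    also have "\<dots> \<le> (\<Sum>i\<in>insert n J. \<kappa> i * norm (z i))"
      using less_imp_le[OF \<kappa>] by (intro sum_mono mult_left_mono dist) auto
    finally show "C0 * (1 - b / (C0 * ?r)) * (\<Sum>i\<in>insert n J. \<kappa> i * infdist (X i) (NC i)) \<le> s" using zs by linarith
    have Xv: "(\<Sum>i\<in>J. blinfun_apply (X i) (apply_bcontfun v i)) = blinfun_apply m v / M"
      by (simp add: mv XJ blinfun.scaleR_left sum_divide_distrib)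
    show "?r - b / C0 \<le> (\<Sum>i\<in>J. blinfun_apply (X i) (apply_bcontfun v i))"
    proof -
      have "(?r - b / C0) * M \<le> (?r - b / C0) * 1" using M1 rb by (intro mult_left_mono) auto
      then show ?thesis unfolding Xv using m(2) M0 by (simp add: pos_le_divide_eq)
    qed
    show "(\<Sum>i\<in>J. blinfun_apply (X i) (apply_bcontfun v i)) \<le> ?r"
      unfolding Xv using mvM M0 by (simp add: pos_divide_le_eq mult.commute)
  qed
qed

section \<open>Normal cones of products\<close>

lemma frechet_normal_coneI:
  assumes "frechet_normal S u x'"
  shows "x' \<in> frechet_normal_cone S u"
  unfolding frechet_normal_cone_def mem_Collect_eq Limsup_le_iff
proof (intro allI impI)
  fix y :: ereal assume "0 < y"
  then obtain e where e: "0 < e" "ereal e < y" using ereal_dense2[of 0 y] by (auto simp: zero_ereal_def)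
  then obtain d where d: "d > 0" "\<And>s. s \<in> S \<Longrightarrow> norm (s - u) < d \<Longrightarrow> blinfun_apply x' (s - u) \<le> e * norm (s - u)"
    using assms unfolding frechet_normal_def by blast
  have "ereal (blinfun_apply x' (s - u) / norm (s - u)) < y" if "s \<in> S" "s \<noteq> u" "dist s u < d" for s
  proof -
    have "blinfun_apply x' (s - u) / norm (s - u) \<le> e"
      using d(2)[OF that(1)] that(2,3) by (simp add: dist_norm pos_divide_le_eq)
    then show ?thesis using e(2) by (meson ereal_less_eq(3) le_less_trans)
  qed
  then show "\<forall>\<^sub>F s in at u within S. ereal (blinfun_apply x' (s - u) / norm (s - u)) < y"
    unfolding eventually_at using d(1) by blast
qed

lemma zero_in_clarke_tangent_cone: "0 \<in> clarke_tangent_cone S u"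
  by (auto simp: clarke_tangent_cone_def intro!: exI[of _ "\<lambda>_. 0"])

text \<open>The cone is defined with arbitrary base sequences, so the second direction may be
  applied from the points already displaced in the first; these still lie in \<open>S\<close> and
  converge to \<open>u\<close>.\<close>

lemma clarke_tangent_cone_add:
  assumes z: "z \<in> clarke_tangent_cone S u" "z' \<in> clarke_tangent_cone S u"
  shows "z + z' \<in> clarke_tangent_cone S u"
  unfolding clarke_tangent_cone_def mem_Collect_eq
proof (intro allI impI)
  fix x :: "nat \<Rightarrow> 'a" and t :: "nat \<Rightarrow> real"
  assume xt: "(\<forall>k. x k \<in> S) \<and> x \<longlonglongrightarrow> u \<and> (\<forall>k. 0 < t k) \<and> t \<longlonglongrightarrow> 0"
  then obtain y where y: "y \<longlonglongrightarrow> z" "\<And>k. x k + t k *\<^sub>R y k \<in> S"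
    using z(1) unfolding clarke_tangent_cone_def by blast
  have "(\<lambda>k. x k + t k *\<^sub>R y k) \<longlonglongrightarrow> u + 0 *\<^sub>R z" using xt y(1) by (intro tendsto_intros) auto
  then obtain y' where y': "y' \<longlonglongrightarrow> z'" "\<And>k. x k + t k *\<^sub>R y k + t k *\<^sub>R y' k \<in> S"
    using z(2) xt y(2) unfolding clarke_tangent_cone_def mem_Collect_eq
    by (metis (no_types, lifting) add.right_neutral scaleR_zero_left)
  show "\<exists>\<zeta>. \<zeta> \<longlonglongrightarrow> z + z' \<and> (\<forall>k. x k + t k *\<^sub>R \<zeta> k \<in> S)"
    using tendsto_add[OF y(1) y'(1)] y'(2)
    by (intro exI[of _ "\<lambda>k. y k + y' k"]) (simp add: scaleR_add_right add.assoc)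
qed

lemma clarke_tangent_cone_scaleR:
  assumes z: "z \<in> clarke_tangent_cone S u" and r: "r > 0"
  shows "r *\<^sub>R z \<in> clarke_tangent_cone S u"
  unfolding clarke_tangent_cone_def mem_Collect_eq
proof (intro allI impI)
  fix x :: "nat \<Rightarrow> 'a" and t :: "nat \<Rightarrow> real"
  assume xt: "(\<forall>k. x k \<in> S) \<and> x \<longlonglongrightarrow> u \<and> (\<forall>k. 0 < t k) \<and> t \<longlonglongrightarrow> 0"
  have "(\<lambda>k. r * t k) \<longlonglongrightarrow> 0" using xt by (intro tendsto_mult_right_zero) auto
  moreover have "\<forall>k. 0 < r * t k" using xt r by auto
  ultimately obtain y where y: "y \<longlonglongrightarrow> z" "\<And>k. x k + (r * t k) *\<^sub>R y k \<in> S"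
    using z xt unfolding clarke_tangent_cone_def mem_Collect_eq
    by (elim allE[of _ x] allE[of _ "\<lambda>k. r * t k"]) blast
  show "\<exists>\<zeta>. \<zeta> \<longlonglongrightarrow> r *\<^sub>R z \<and> (\<forall>k. x k + t k *\<^sub>R \<zeta> k \<in> S)"
    using tendsto_scaleR[OF tendsto_const[of r] y(1)] y(2)
    by (intro exI[of _ "\<lambda>k. r *\<^sub>R y k"]) (simp add: mult.commute)
qed

text \<open>A tuple \<open>w\<close> stands for the points \<open>\<kappa> i *\<^sub>R w i\<close> of the sets, so that a ball of radius \<open>1\<close> in the
  maximum norm corresponds to the product of balls of radii \<open>\<kappa> i\<close>.\<close>

definition scaled_product :: "nat set \<Rightarrow> (nat \<Rightarrow> real) \<Rightarrow> (nat \<Rightarrow> 'a set) \<Rightarrow> (nat \<Rightarrow>\<^sub>C 'a::real_normed_vector) set" where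
  "scaled_product I \<kappa> \<Omega> = {w \<in> supported I. \<forall>i\<in>I. \<kappa> i *\<^sub>R apply_bcontfun w i \<in> \<Omega> i}"

lemma closed_scaled_product:
  assumes "\<And>i. i \<in> I \<Longrightarrow> closed (\<Omega> i)"
  shows "closed (scaled_product I \<kappa> \<Omega>)"
proof -
  have c: "continuous_on UNIV (\<lambda>w :: nat \<Rightarrow>\<^sub>C 'a. \<kappa> i *\<^sub>R apply_bcontfun w i)" for \<kappa> :: "nat \<Rightarrow> real" and i
    by (intro continuous_on_scaleR continuous_on_const linear_continuous_on bounded_linear_apply_bcontfun)
  have "scaled_product I \<kappa> \<Omega> = (\<Inter>i\<in>- I. (\<lambda>w. 1 *\<^sub>R apply_bcontfun w i) -` {0})
      \<inter> (\<Inter>i\<in>I. (\<lambda>w. \<kappa> i *\<^sub>R apply_bcontfun w i) -` \<Omega> i)"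
    by (auto simp: scaled_product_def supported_def)
  moreover have "closed \<dots>"
    using assms c[of "\<lambda>_. 1"] c[of \<kappa>] by (intro closed_Int closed_INT ballI closed_vimage) auto
  ultimately show ?thesis by simp
qed

text \<open>Changing only the \<open>i\<close>-th coordinate of \<open>u\<close> stays inside the
  product, and the scaling by \<open>\<kappa> i\<close> affects only the radius.\<close>

lemma frechet_normal_component:
  assumes I: "finite I" "i \<in> I" and \<kappa>: "\<kappa> i > 0" and c: "c > 0" and u: "u \<in> scaled_product I \<kappa> \<Omega>"
    and x': "frechet_normal (scaled_product I \<kappa> \<Omega>) u x'"
  shows "c *\<^sub>R component x' i \<in> frechet_normal_cone (\<Omega> i) (\<kappa> i *\<^sub>R apply_bcontfun u i)"
proof (rule frechet_normal_coneI)
  let ?w = "\<kappa> i *\<^sub>R apply_bcontfun u i"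
  show "frechet_normal (\<Omega> i) ?w (c *\<^sub>R component x' i)"
    unfolding frechet_normal_def
  proof (intro allI impI)
    fix e :: real assume e: "e > 0"
    obtain d where d: "d > 0" "\<And>s. s \<in> scaled_product I \<kappa> \<Omega> \<Longrightarrow> norm (s - u) < d \<Longrightarrow>
        blinfun_apply x' (s - u) \<le> e / c * norm (s - u)"
      using x' divide_pos_pos[OF e c] unfolding frechet_normal_def by meson
    have "blinfun_apply (c *\<^sub>R component x' i) (x - ?w) \<le> e * norm (x - ?w)"
      if x: "x \<in> \<Omega> i" "norm (x - ?w) < d * \<kappa> i" for x
    proof -
      define y where "y = (1 / \<kappa> i) *\<^sub>R (x - ?w)"
      define s where "s = u + tup {i} (\<lambda>_. y)"
      have "s \<in> scaled_product I \<kappa> \<Omega>"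
        using u I(2) x(1) \<kappa> by (auto simp: scaled_product_def supported_def s_def tup_apply y_def scaleR_add_right)
      moreover have n: "norm (s - u) = norm (x - ?w) / \<kappa> i"
        using \<kappa> by (simp add: s_def norm_tup_single y_def)
      moreover have "norm (s - u) < d" unfolding n using x(2) \<kappa> by (simp add: pos_divide_less_eq)
      ultimately have "blinfun_apply x' (s - u) \<le> e / c * (norm (x - ?w) / \<kappa> i)" using d(2) by metis
      moreover have "blinfun_apply x' (s - u) = blinfun_apply (component x' i) (x - ?w) / \<kappa> i"
        by (simp add: s_def component_apply[symmetric] y_def blinfun.scaleR_right)
      ultimately show ?thesis using \<kappa> c by (simp add: blinfun.scaleR_left field_simps)
    qed
    then show "\<exists>\<delta>>0. \<forall>s\<in>\<Omega> i. norm (s - ?w) < \<delta> \<longrightarrow> blinfun_apply (c *\<^sub>R component x' i) (s - ?w) \<le> e * norm (s - ?w)"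
      using d(1) \<kappa> by (intro exI[of _ "d * \<kappa> i"]) auto
  qed
qed

section \<open>Functions of class C1 and the penalised minimum\<close>

lemma class_C1_deriv:
  assumes "\<phi> \<in> class_C1" "r > 0"
  shows "(\<phi> has_real_derivative deriv \<phi> r) (at r)" "deriv \<phi> r > 0" "isCont (deriv \<phi>) r"
proof -
  show "(\<phi> has_real_derivative deriv \<phi> r) (at r)" "deriv \<phi> r > 0"
    using assms by (auto simp: class_C1_def DERIV_deriv_iff_real_differentiable)
  show "isCont (deriv \<phi>) r"
    using assms by (auto simp: class_C1_def continuous_on_eq_continuous_at)
qed

lemma class_C1_less_iff:
  assumes "\<phi> \<in> class_C1" "0 \<le> x" "0 \<le> y"
  shows "\<phi> x < \<phi> y \<longleftrightarrow> x < y"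
  using assms strict_mono_on_less[of "{0..}" \<phi> x y] by (simp add: class_C1_def)

text \<open>The inverse is meaningful only on the range of \<open>\<phi>\<close>; \<open>y\<close>
  belongs to it by the intermediate value theorem, as \<open>\<phi>\<close> starts at
  \<open>0\<close> and is unbounded.\<close>

lemma class_C1_less_inverse:
  assumes \<phi>: "\<phi> \<in> class_C1" and r: "0 \<le> r" "\<phi> r < y"
  shows "r < the_inv_into {0..} \<phi> y"
proof -
  have "filterlim \<phi> at_top at_top" "\<phi> 0 = 0" and c: "continuous_on {0..} \<phi>" and m: "strict_mono_on {0..} \<phi>"
    and nn: "\<phi> \<in> {0..} \<rightarrow> {0..}"
    using \<phi> by (auto simp: class_C1_def)
  then have "\<forall>\<^sub>F t in at_top. y \<le> \<phi> t" by (simp add: filterlim_at_top)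
  then obtain b where b: "b \<ge> 0" "y \<le> \<phi> b"
    by (metis eventually_at_top_linorder linorder_le_cases)
  have "0 \<le> y" using nn r by (auto simp: Pi_iff intro: order_trans[OF _ less_imp_le])
  then obtain t where t: "0 \<le> t" "t \<le> b" "\<phi> t = y"
    using IVT'[of \<phi> 0 y b] b \<open>\<phi> 0 = 0\<close> continuous_on_subset[OF c, of "{0..b}"] by auto
  have "the_inv_into {0..} \<phi> y = t"
    using the_inv_into_f_f[OF strict_mono_on_imp_inj_on[OF m], of t] t by simp
  then show ?thesis using class_C1_less_iff[OF \<phi>, of r t] r t by simp
qed

text \<open>Ekeland's inequality has slope \<open>\<epsilon>1\<close>, and the difference
  \<open>\<epsilon>2 - \<epsilon>1\<close> absorbs the first-order remainder of
  \<open>\<phi>\<close> at \<open>P w\<close>. The result is free of \<open>\<phi>\<close> except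
  for one number, so convexity of \<open>P\<close> is no longer hidden by the composition.\<close>

lemma penalized_local_minimum:
  fixes P :: "'b::banach \<Rightarrow> real"
  assumes \<phi>: "\<phi> \<in> class_C1" and S: "closed S" "u0 \<in> S"
    and P: "\<And>x y. P x - P y \<le> La * norm (x - y)" "La \<ge> 0" "\<And>z. z \<in> S \<Longrightarrow> 0 < P z"
    and low: "\<And>z. z \<in> S \<Longrightarrow> b \<le> \<phi> (P z)" and u0: "\<phi> (P u0) < b + \<epsilon>" and \<epsilon>: "\<epsilon> > 0"
  obtains w \<epsilon>2 \<rho> where "w \<in> S" "norm (w - u0) < 1" "P w \<le> P u0" "0 < \<epsilon>2" "\<epsilon>2 < \<epsilon>" "\<rho> > 0"
    "\<And>z. z \<in> S \<Longrightarrow> norm (z - w) \<le> \<rho> \<Longrightarrow> deriv \<phi> (P w) * P w \<le> deriv \<phi> (P w) * P z + \<epsilon>2 * norm (z - w)"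
proof -
  \<comment> \<open>The slope \<open>\<epsilon>1\<close> must exceed the excess of the starting
    value over \<open>b\<close> for \<open>w\<close> to stay at distance below \<open>1\<close>. The
    second argument of the maximum keeps \<open>s\<close> positive when that excess is zero.\<close>
  define s where "s = max (\<phi> (P u0) - b) (\<epsilon> / 2)"
  define \<epsilon>1 where "\<epsilon>1 = (s + \<epsilon>) / 2"
  define \<epsilon>2 where "\<epsilon>2 = (\<epsilon>1 + \<epsilon>) / 2"
  have s: "0 < s" "s < \<epsilon>" using u0 \<epsilon> by (auto simp: s_def)
  have \<epsilon>12: "s < \<epsilon>1" "\<epsilon>1 < \<epsilon>2" "\<epsilon>2 < \<epsilon>" using s by (auto simp: \<epsilon>1_def \<epsilon>2_def)
  have "continuous_on {0..} \<phi>" using \<phi> by (simp add: class_C1_def)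
  then have cont: "continuous_on S (\<lambda>z. \<phi> (P z))"
    using P(3) by (intro continuous_on_compose2[OF _ continuous_on_one_sided_lipschitz[OF P(1,2)]]) (auto intro: less_imp_le)
  obtain w where w: "w \<in> S" "\<phi> (P w) + \<epsilon>1 * norm (w - u0) \<le> \<phi> (P u0)"
    "\<And>z. z \<in> S \<Longrightarrow> \<phi> (P w) \<le> \<phi> (P z) + \<epsilon>1 * norm (z - w)"
    using ekeland[OF S cont low, of \<epsilon>1] s \<epsilon>12 by auto
  have "\<epsilon>1 * norm (w - u0) \<le> s" using w(2) low[OF w(1)] by (simp add: s_def)
  then have "\<epsilon>1 * norm (w - u0) < \<epsilon>1 * 1" using \<epsilon>12(1) by linarith
  then have wu: "norm (w - u0) < 1" using s(1) \<epsilon>12(1) by (simp add: mult_less_cancel_left)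
  have "0 \<le> \<epsilon>1 * norm (w - u0)" using s \<epsilon>12 by simp
  then have "\<phi> (P w) \<le> \<phi> (P u0)" using w(2) by linarith
  then have Pw: "P w \<le> P u0"
    using class_C1_less_iff[OF \<phi>, of "P u0" "P w"] P(3)[OF w(1)] P(3)[OF S(2)] by (simp add: not_less[symmetric] less_imp_le)
  define C0 where "C0 = deriv \<phi> (P w)"
  \<comment> \<open>Division by \<open>La + 1\<close> instead of \<open>La\<close> covers the case
    \<open>La = 0\<close>.\<close>
  define k where "k = (\<epsilon>2 - \<epsilon>1) / (La + 1)"
  have k: "k > 0" "k * La \<le> \<epsilon>2 - \<epsilon>1" using \<epsilon>12 P(2) by (auto simp: k_def field_simps)
  have "(\<phi> has_derivative (\<lambda>h. C0 * h)) (at (P w))"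
    using class_C1_deriv(1)[OF \<phi> P(3)[OF w(1)]] by (simp add: has_field_derivative_def C0_def)
  then obtain d where d: "d > 0" "\<And>y. norm (y - P w) < d \<Longrightarrow>
      norm (\<phi> y - \<phi> (P w) - C0 * (y - P w)) \<le> k * norm (y - P w)"
    using k(1) unfolding has_derivative_at_alt by blast
  define \<rho> where "\<rho> = d / (2 * (La + 1))"
  have \<rho>: "\<rho> > 0" "La * \<rho> < d"
  proof -
    show "\<rho> > 0" using d(1) P(2) by (simp add: \<rho>_def)
    have "La * d < (2 * (La + 1)) * d" using d(1) P(2) by (intro mult_strict_right_mono) auto
    then show "La * \<rho> < d" using P(2) by (simp add: \<rho>_def field_simps)
  qed
  have "C0 * P w \<le> C0 * P z + \<epsilon>2 * norm (z - w)" if z: "z \<in> S" "norm (z - w) \<le> \<rho>" for z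
  proof -
    have Pz: "norm (P z - P w) \<le> La * norm (z - w)"
      using P(1)[of z w] P(1)[of w z] by (simp add: abs_le_iff norm_minus_commute)
    also have "\<dots> \<le> La * \<rho>" using z(2) P(2) by (intro mult_left_mono)
    finally have "norm (P z - P w) < d" using \<rho>(2) by simp
    then have "\<phi> (P z) - \<phi> (P w) - C0 * (P z - P w) \<le> k * norm (P z - P w)"
      using d(2)[of "P z"] by (auto dest: abs_le_D1)
    also have "\<dots> \<le> k * (La * norm (z - w))" using Pz k(1) by (intro mult_left_mono) auto
    also have "\<dots> \<le> (\<epsilon>2 - \<epsilon>1) * norm (z - w)"
      using mult_right_mono[OF k(2) norm_ge_zero[of "z - w"]] by (simp add: mult.assoc)
    finally show ?thesis using w(3)[OF z(1)] by (simp add: algebra_simps)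
  qed
  then show thesis using that[of w \<epsilon>2 \<rho>] w(1) wu Pw \<epsilon>12 s(1) \<rho>(1) by (simp add: C0_def)
qed

text \<open>All coordinates can be moved tangentially with one sequence of step sizes, so the
  product of the tangent cones consists of directions in which \<open>g\<close> does not fall below
  \<open>g w\<close>. This product is a convex cone, and the sandwich theorem separates.\<close>

lemma clarke_normal_exists:
  fixes g :: "(nat \<Rightarrow>\<^sub>C 'a::real_normed_vector) \<Rightarrow> real"
  assumes I: "finite I" and \<kappa>: "\<And>i. \<kappa> i > 0" and w: "w \<in> scaled_product I \<kappa> \<Omega>"
    and cg: "convex_on UNIV g" and L: "L \<ge> 0" and Lg: "\<And>x y. g x - g y \<le> L * norm (x - y)"
    and r: "r > 0" and min: "\<And>z. z \<in> scaled_product I \<kappa> \<Omega> \<Longrightarrow> norm (z - w) \<le> r \<Longrightarrow> g w \<le> g z"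
  obtains x' where "\<And>h. - blinfun_apply x' h \<le> g (w + h) - g w"
    "\<And>i c. i \<in> I \<Longrightarrow> c > 0 \<Longrightarrow>
      c *\<^sub>R component x' i \<in> clarke_normal_cone (\<Omega> i) (\<kappa> i *\<^sub>R apply_bcontfun w i)"
proof -
  let ?T = "\<lambda>i. clarke_tangent_cone (\<Omega> i) (\<kappa> i *\<^sub>R apply_bcontfun w i)"
  define K where "K = {(z, 0 :: real) | z. z \<in> supported I \<and> (\<forall>i\<in>I. \<kappa> i *\<^sub>R apply_bcontfun z i \<in> ?T i)}"
  have main: "g w \<le> g (w + z)" if zs: "z \<in> supported I" and zT: "\<And>i. i \<in> I \<Longrightarrow> \<kappa> i *\<^sub>R apply_bcontfun z i \<in> ?T i" for z
  proof -
    define t where "t k = inverse (real (Suc k))" for k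
    have t: "t \<longlonglongrightarrow> 0" "\<And>k. 0 < t k" "\<And>k. t k \<le> 1"
      unfolding t_def by (rule LIMSEQ_inverse_real_of_nat) (auto simp: field_simps)
    have "\<exists>y. i \<in> I \<longrightarrow> (y \<longlonglongrightarrow> \<kappa> i *\<^sub>R apply_bcontfun z i \<and>
        (\<forall>k. \<kappa> i *\<^sub>R apply_bcontfun w i + t k *\<^sub>R y k \<in> \<Omega> i))" for i
    proof (cases "i \<in> I")
      case True
      have "(\<lambda>_::nat. \<kappa> i *\<^sub>R apply_bcontfun w i) \<longlonglongrightarrow> \<kappa> i *\<^sub>R apply_bcontfun w i" by simp
      then show ?thesis using zT[OF True] t w True unfolding clarke_tangent_cone_def scaled_product_def mem_Collect_eq
        by (elim allE[of _ "\<lambda>_. \<kappa> i *\<^sub>R apply_bcontfun w i"] allE[of _ t]) blast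
    qed simp
    then obtain y where y: "\<And>i. i \<in> I \<Longrightarrow> y i \<longlonglongrightarrow> \<kappa> i *\<^sub>R apply_bcontfun z i"
      "\<And>i k. i \<in> I \<Longrightarrow> \<kappa> i *\<^sub>R apply_bcontfun w i + t k *\<^sub>R y i k \<in> \<Omega> i" by metis
    define q where "q k = tup I (\<lambda>i. (1 / \<kappa> i) *\<^sub>R y i k)" for k
    have qi: "apply_bcontfun (q k) i = (if i \<in> I then (1 / \<kappa> i) *\<^sub>R y i k else 0)" for k i
      using I by (simp add: q_def tup_apply)
    have qz: "q \<longlonglongrightarrow> z"
    proof (rule LIM_zero_cancel, rule Lim_null_comparison)
      show "\<forall>\<^sub>F k in sequentially. norm (q k - z) \<le> (\<Sum>i\<in>I. norm ((1 / \<kappa> i) *\<^sub>R y i k - apply_bcontfun z i))"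
      proof (intro always_eventually allI norm_bound)
        fix k j
        show "norm (apply_bcontfun (q k - z) j) \<le> (\<Sum>i\<in>I. norm ((1 / \<kappa> i) *\<^sub>R y i k - apply_bcontfun z i))"
        proof (cases "j \<in> I")
          case True
          have "norm ((1 / \<kappa> j) *\<^sub>R y j k - apply_bcontfun z j) \<le> (\<Sum>i\<in>I. norm ((1 / \<kappa> i) *\<^sub>R y i k - apply_bcontfun z i))"
            by (rule member_le_sum[OF True]) (auto simp: I)
          then show ?thesis using True by (simp add: qi)
        next
          case False
          then show ?thesis using zs by (simp add: qi supported_def sum_nonneg)
        qed
      qed
      have "(\<lambda>k. \<Sum>i\<in>I. norm ((1 / \<kappa> i) *\<^sub>R y i k - apply_bcontfun z i)) \<longlonglongrightarrow> (\<Sum>i\<in>I. norm ((1 / \<kappa> i) *\<^sub>R (\<kappa> i *\<^sub>R apply_bcontfun z i) - apply_bcontfun z i))"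
        using y(1) by (intro tendsto_intros)
      then show "(\<lambda>k. \<Sum>i\<in>I. norm ((1 / \<kappa> i) *\<^sub>R y i k - apply_bcontfun z i)) \<longlonglongrightarrow> 0"
        using \<kappa> by (simp add: less_imp_neq[OF \<kappa>, symmetric])
    qed
    have inS: "w + t k *\<^sub>R q k \<in> scaled_product I \<kappa> \<Omega>" for k
      using w y(2) \<kappa> by (auto simp: scaled_product_def supported_def qi scaleR_add_right less_imp_neq[OF \<kappa>, symmetric])
    have "(\<lambda>k. norm (t k *\<^sub>R q k)) \<longlonglongrightarrow> norm (0 *\<^sub>R z)" using t(1) qz by (intro tendsto_intros)
    then have "\<forall>\<^sub>F k in sequentially. norm (t k *\<^sub>R q k) < r" using r by (intro order_tendstoD(2)) auto
    then have "\<forall>\<^sub>F k in sequentially. g w \<le> g (w + q k)"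
    proof eventually_elim
      case (elim k)
      have "g w \<le> g (w + t k *\<^sub>R q k)" using elim by (intro min inS) auto
      \<comment> \<open>Convexity carries the inequality from the short step to the full step
        \<open>q k\<close>, so no directional derivative is needed before passing to the
        limit.\<close>
      also have "w + t k *\<^sub>R q k = (1 - t k) *\<^sub>R w + t k *\<^sub>R (w + q k)" by (simp add: algebra_simps)
      also have "g \<dots> \<le> (1 - t k) * g w + t k * g (w + q k)"
        using convex_onD[OF cg, of "t k" w "w + q k"] t(2)[of k] t(3)[of k] by simp
      finally have "t k * g w \<le> t k * g (w + q k)" by (simp add: algebra_simps)
      then show ?case using t(2)[of k] by simp
    qed
    moreover have "(\<lambda>k. g (w + q k)) \<longlonglongrightarrow> g (w + z)"
      by (intro continuous_on_tendsto_compose[OF continuous_on_one_sided_lipschitz[OF Lg L, of UNIV]] tendsto_intros qz) auto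
    ultimately show ?thesis by (intro tendsto_lowerbound) auto
  qed
  have qc: "convex_on UNIV (\<lambda>h. g (w + h) - g w)"
    using subgradient_bound_convex[OF cg, of 0 w] by (simp add: subgradient_bound_def[abs_def])
  have qL: "(g (w + h) - g w) - (g (w + h') - g w) \<le> L * norm (h - h')" for h h' using Lg[of "w + h" "w + h'"] by simp
  obtain x' where x': "\<And>z c. (z, c) \<in> K \<Longrightarrow> blinfun_apply x' z \<le> c" "\<And>h. - blinfun_apply x' h \<le> g (w + h) - g w"
  proof (rule convex_sandwich[OF qc qL, of K])
    show "(0, 0) \<in> K" using zero_in_clarke_tangent_cone by (auto simp: K_def supported_def)
    show "(s + s', c + c') \<in> K" if "(s, c) \<in> K" "(s', c') \<in> K" for s c s' c'
      using that subspace_add[OF subspace_supported] by (auto simp: K_def scaleR_add_right intro: clarke_tangent_cone_add)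
    show "(t *\<^sub>R s, t * c) \<in> K" if "t > 0" "(s, c) \<in> K" for t s c
    proof -
      have "\<kappa> i *\<^sub>R t *\<^sub>R x = t *\<^sub>R \<kappa> i *\<^sub>R x" for i and x :: 'a by (simp add: mult.commute)
      then show ?thesis using that subspace_scale[OF subspace_supported]
        by (auto simp: K_def simp del: scaleR_scaleR intro: clarke_tangent_cone_scaleR)
    qed
    show "0 \<le> c + (g (w + s) - g w)" if "(s, c) \<in> K" for s c
      using that main by (auto simp: K_def)
  qed auto
  have "c *\<^sub>R component x' i \<in> clarke_normal_cone (\<Omega> i) (\<kappa> i *\<^sub>R apply_bcontfun w i)" if i: "i \<in> I" and c: "c > 0" for i c
    unfolding clarke_normal_cone_def mem_Collect_eq
  proof
    fix z assume z: "z \<in> ?T i"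
    define y where "y = tup {i} (\<lambda>_. (1 / \<kappa> i) *\<^sub>R z)"
    have "(y, 0) \<in> K" using i z \<kappa>[of i] zero_in_clarke_tangent_cone
      by (auto simp: K_def y_def tup_apply supported_def)
    then have "blinfun_apply (component x' i) ((1 / \<kappa> i) *\<^sub>R z) \<le> 0"
      using x'(1) unfolding y_def component_apply by blast
    then have "blinfun_apply (component x' i) z \<le> 0" using \<kappa>[of i] by (simp add: blinfun.scaleR_right divide_le_0_iff)
    then show "blinfun_apply (c *\<^sub>R component x' i) z \<le> 0" using c by (simp add: blinfun.scaleR_left mult_nonneg_nonpos)
  qed
  then show thesis using that x'(2) by blast
qed

section \<open>Assembly of the two multiplier rules\<close>

theorem theorem4p1:
  fixes n :: nat and \<Omega> :: "nat \<Rightarrow> 'a::banach set" and xbar :: 'a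
    and a :: "nat \<Rightarrow> 'a" and \<epsilon> lam \<eta> :: real and \<phi> :: "real \<Rightarrow> real"
  assumes "n \<ge> 2"
    and "\<forall>i\<in>{1..n}. closed (\<Omega> i)"
    and "xbar \<in> (\<Inter>i\<in>{1..n}. \<Omega> i)"
    and "\<epsilon> > 0"
    and "\<phi> \<in> class_C1"
    and "(\<Inter>i\<in>{1..n-1}. (\<lambda>x. x - a i) ` \<Omega> i) \<inter> \<Omega> n = {}"
    and "\<phi> (MAX i\<in>{1..n-1}. norm (a i))
           < \<phi> (sets_dist n ((\<lambda>i. (\<lambda>x. x - a i) ` \<Omega> i)(n := \<Omega> n))) + \<epsilon>"
    and "lam > 0" and "\<eta> > 0"
  shows
    "(\<exists>(\<omega> :: nat \<Rightarrow> 'a) (x' :: nat \<Rightarrow> 'a \<Rightarrow>\<^sub>L real).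
        (\<forall>i\<in>{1..n-1}. \<omega> i \<in> \<Omega> i \<inter> ball xbar lam) \<and>
        \<omega> n \<in> \<Omega> n \<inter> ball xbar \<eta> \<and>
        0 < (MAX i\<in>{1..n-1}. norm (\<omega> n + a i - \<omega> i)) \<and>
        (MAX i\<in>{1..n-1}. norm (\<omega> n + a i - \<omega> i)) \<le> (MAX i\<in>{1..n-1}. norm (a i)) \<and>
        (\<Sum>i=1..n. x' i) = 0 \<and>
        (\<Sum>i=1..n-1. norm (x' i)) = 1 \<and>
        deriv \<phi> (MAX i\<in>{1..n-1}. norm (\<omega> n + a i - \<omega> i)) *
          (lam * (\<Sum>i=1..n-1. infdist (x' i) (clarke_normal_cone (\<Omega> i) (\<omega> i)))
           + \<eta> * infdist (x' n) (clarke_normal_cone (\<Omega> n) (\<omega> n))) < \<epsilon> \<and>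
        (\<Sum>i=1..n-1. blinfun_apply (x' i) (\<omega> n + a i - \<omega> i))
          = (MAX i\<in>{1..n-1}. norm (\<omega> n + a i - \<omega> i)))
     \<and>
     (asplund_space TYPE('a) \<longrightarrow>
      (\<forall>\<tau>\<in>{0<..<1}.
       \<exists>(\<omega> :: nat \<Rightarrow> 'a) (x' :: nat \<Rightarrow> 'a \<Rightarrow>\<^sub>L real).
        (\<forall>i\<in>{1..n-1}. \<omega> i \<in> \<Omega> i \<inter> ball xbar lam) \<and>
        \<omega> n \<in> \<Omega> n \<inter> ball xbar \<eta> \<and>
        0 < (MAX i\<in>{1..n-1}. norm (\<omega> n + a i - \<omega> i)) \<and>
        (MAX i\<in>{1..n-1}. norm (\<omega> n + a i - \<omega> i))
          < the_inv_into {0..} \<phi>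
              (\<phi> (sets_dist n ((\<lambda>i. (\<lambda>x. x - a i) ` \<Omega> i)(n := \<Omega> n))) + \<epsilon>) \<and>
        (\<Sum>i=1..n. x' i) = 0 \<and>
        (\<Sum>i=1..n-1. norm (x' i)) = 1 \<and>
        deriv \<phi> (MAX i\<in>{1..n-1}. norm (\<omega> n + a i - \<omega> i)) *
          (lam * (\<Sum>i=1..n-1. infdist (x' i) (frechet_normal_cone (\<Omega> i) (\<omega> i)))
           + \<eta> * infdist (x' n) (frechet_normal_cone (\<Omega> n) (\<omega> n))) < \<epsilon> \<and>
        (\<Sum>i=1..n-1. blinfun_apply (x' i) (\<omega> n + a i - \<omega> i))
          > \<tau> * (MAX i\<in>{1..n-1}. norm (\<omega> n + a i - \<omega> i))))"
proof -
  define d where "d = sets_dist n ((\<lambda>i. (\<lambda>x. x - a i) ` \<Omega> i)(n := \<Omega> n))"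
  define J where "J = {1..n-1}"
  \<comment> \<open>The prescribed radii, so that the open unit ball around \<open>u0\<close>
    encodes all ball conditions, and \<open>lam\<close> and \<open>\<eta>\<close> reappear as
    weights of the distances to the normal cones.\<close>
  define \<kappa> where "\<kappa> i = (if i = n then \<eta> else lam)" for i
  define abar where "abar = tup J a"
  define S where "S = scaled_product {1..n} \<kappa> \<Omega>"
  define u0 where "u0 = tup {1..n} (\<lambda>i. (1 / \<kappa> i) *\<^sub>R xbar)"
  let ?V = "\<lambda>w. abar + gap J n \<kappa> w"
  define P where "P w = max_norm J (?V w)" for w
  define om where "om w i = \<kappa> i *\<^sub>R apply_bcontfun w i" for w :: "nat \<Rightarrow>\<^sub>C 'a" and i
  define La where "La = \<eta> + lam"
  note n = assms(1) and eps = assms(4) and \<phi> = assms(5) and lam = assms(8) and \<eta> = assms(9)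
  have J: "finite J" "J \<noteq> {}" "n \<notin> J" and I: "insert n J = {1..n}"
    using n by (auto simp: J_def)
  have JI: "J \<subseteq> {1..n}" using I by auto
  have \<kappa>: "\<kappa> i > 0" for i using lam \<eta> by (simp add: \<kappa>_def)
  have \<kappa>J: "\<kappa> i = lam" if "i \<in> J" for i using that J(3) by (auto simp: \<kappa>_def)
  have vi: "apply_bcontfun (?V w) i = om w n + a i - om w i" if "i \<in> J" for w i
    using that J(1) by (simp add: abar_def tup_apply gap_apply om_def)
  have P: "P w = (MAX i\<in>{1..n-1}. norm (om w n + a i - om w i))" for w
    unfolding P_def max_norm_def J_def[symmetric] by (intro arg_cong[where f = Max] image_cong refl) (simp only: vi)
  have Pa: "max_norm J abar = (MAX i\<in>{1..n-1}. norm (a i))"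
    unfolding max_norm_def J_def[symmetric] abar_def using J(1)
    by (intro arg_cong[where f = Max] image_cong) (auto simp: tup_apply)
  have P0: "0 \<le> P w" for w unfolding P_def by (rule max_norm_nonneg[OF J(1,2)])
  have vsup: "?V w \<in> supported J" for w
    unfolding abar_def gap_def by (intro subspace_add[OF subspace_supported] tup_supported J(1))
  have omu0: "om u0 i = xbar" if "i \<in> {1..n}" for i
    using that \<kappa>[of i] by (simp add: om_def u0_def tup_apply)
  have Pu0: "P u0 = (MAX i\<in>{1..n-1}. norm (a i))"
    unfolding P using omu0 n by (intro arg_cong[where f = Max] image_cong) auto
  have inS: "om w i \<in> \<Omega> i" if "w \<in> S" "i \<in> {1..n}" for w i
    using that by (auto simp: S_def scaled_product_def om_def)
  have "om u0 i \<in> \<Omega> i" if "i \<in> {1..n}" for i using assms(3) that by (simp add: omu0)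
  then have S: "closed S" "u0 \<in> S"
    using assms(2) closed_scaled_product[of "{1..n}" \<Omega> \<kappa>]
    by (auto simp: S_def om_def scaled_product_def u0_def tup_supported)
  have PL: "P x - P y \<le> La * norm (x - y)" for x y
  proof -
    have "P x - P y \<le> max_norm J (gap J n \<kappa> x - gap J n \<kappa> y)"
      using sublinear_diff[OF sublinear_max_norm[OF J(1,2)], of "?V x" "?V y"]
      by (simp add: P_def)
    also have "\<dots> \<le> norm (gap J n \<kappa> (x - y))"
      using max_norm_le_norm[OF J(1,2)] by (simp add: linear_diff[OF linear_gap[OF J(1)]])
    also have "\<dots> \<le> La * norm (x - y)"
      using norm_gap_le[OF J(1), of \<kappa> lam n "x - y"] \<kappa>J \<kappa> lam less_imp_le[OF \<kappa>]
      by (simp add: La_def \<kappa>_def)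
    finally show ?thesis .
  qed
  have La: "La \<ge> 0" using lam \<eta> by (simp add: La_def)
  have Pc: "convex_on UNIV P"
  proof (rule convex_onI)
    fix t :: real and x y :: "nat \<Rightarrow>\<^sub>C 'a" assume t: "0 < t" "t < 1"
    have "abar + gap J n \<kappa> ((1 - t) *\<^sub>R x + t *\<^sub>R y)
        = (1 - t) *\<^sub>R (?V x) + t *\<^sub>R (?V y)"
      unfolding linear_add[OF linear_gap[OF J(1)]] linear_scale[OF linear_gap[OF J(1)]]
      by (simp add: algebra_simps)
    then show "P ((1 - t) *\<^sub>R x + t *\<^sub>R y) \<le> (1 - t) * P x + t * P y"
      using convex_onD[OF sublinear_convex_on[OF sublinear_max_norm[OF J(1,2)]], of t
          "?V x" "?V y"] t by (simp add: P_def)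
  qed auto
  \<comment> \<open>If all gaps vanished, \<open>om z n\<close> would be a common point of the
    translated sets.\<close>
  have Ppos: "0 < P z" if z: "z \<in> S" for z
  proof (rule ccontr)
    assume "\<not> 0 < P z"
    then have "norm (apply_bcontfun (?V z) i) \<le> 0" if "i \<in> J" for i
      using norm_le_max_norm[OF J(1) that, of "?V z"] unfolding P_def by linarith
    then have e: "om z n = om z i - a i" if "i \<in> J" for i using that vi[of i z] by (auto simp: algebra_simps)
    have "om z n \<in> (\<lambda>x. x - a i) ` \<Omega> i" if "i \<in> J" for i
      using e[OF that] inS[OF z subsetD[OF JI that]] by (rule image_eqI)
    then have "om z n \<in> (\<Inter>i\<in>{1..n-1}. (\<lambda>x. x - a i) ` \<Omega> i) \<inter> \<Omega> n"
      using inS[OF z, of n] n by (auto simp: J_def)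
    then show False using assms(6) by auto
  qed
  define DS where "DS = {MAX i\<in>{1..n-1}. norm (u n - u i) | u. \<forall>i\<in>{1..n}. u i \<in> ((\<lambda>i. (\<lambda>x. x - a i) ` \<Omega> i)(n := \<Omega> n)) i}"
  have dDS: "d = Inf DS" by (simp add: d_def sets_dist_def DS_def)
  have PDS: "P z \<in> DS" if z: "z \<in> S" for z
    unfolding DS_def mem_Collect_eq
  proof (intro exI[of _ "\<lambda>i. if i = n then om z n else om z i - a i"] conjI ballI)
    show "P z = (MAX i\<in>{1..n-1}. norm ((if n = n then om z n else om z n - a n) - (if i = n then om z n else om z i - a i)))"
      unfolding P using J by (intro arg_cong[where f = Max] image_cong) (auto simp: J_def algebra_simps)
    show "(if i = n then om z n else om z i - a i) \<in> ((\<lambda>i. (\<lambda>x. x - a i) ` \<Omega> i)(n := \<Omega> n)) i" if "i \<in> {1..n}" for i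
      using inS[OF z that] by auto
  qed
  have DS0: "0 \<le> x" if x: "x \<in> DS" for x
  proof -
    obtain u :: "nat \<Rightarrow> 'a" where "x = (MAX i\<in>J. norm (u n - u i))" using x unfolding DS_def J_def by blast
    moreover obtain j where "j \<in> J" using J(2) by auto
    ultimately have "norm (u n - u j) \<le> x" using J(1) by (auto intro!: Max_ge)
    then show ?thesis using norm_ge_zero order_trans by blast
  qed
  have d0: "0 \<le> d" unfolding dDS using DS0 PDS[OF S(2)] by (intro cInf_greatest) auto
  have low: "\<phi> d \<le> \<phi> (P z)" if "z \<in> S" for z
  proof -
    have "d \<le> P z" unfolding dDS using PDS[OF that] DS0 by (intro cInf_lower bdd_belowI)
    then show ?thesis using class_C1_less_iff[OF \<phi> P0 d0, of z] by linarith
  qed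
  have u0e: "\<phi> (P u0) < \<phi> d + \<epsilon>" using assms(7) by (simp add: Pu0 d_def)
  obtain w \<epsilon>2 \<rho> where w: "w \<in> S" "norm (w - u0) < 1" "P w \<le> P u0" and \<epsilon>2: "0 < \<epsilon>2" "\<epsilon>2 < \<epsilon>" and \<rho>: "\<rho> > 0"
    and wmin: "\<And>z. z \<in> S \<Longrightarrow> norm (z - w) \<le> \<rho> \<Longrightarrow> deriv \<phi> (P w) * P w \<le> deriv \<phi> (P w) * P z + \<epsilon>2 * norm (z - w)"
    using penalized_local_minimum[where \<phi> = \<phi> and P = P, OF \<phi> S PL La Ppos low u0e eps] by blast
  define C0 where "C0 = deriv \<phi> (P w)"
  have C0: "C0 > 0" unfolding C0_def by (rule class_C1_deriv(2)[OF \<phi> Ppos[OF w(1)]])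
  \<comment> \<open>The linearised objective is convex, and \<open>w\<close> minimises it over
    \<open>S\<close> within distance \<open>\<rho>\<close>.\<close>
  define g where "g z = C0 * P z + \<epsilon>2 * norm (z - w)" for z
  have "convex_on UNIV (\<lambda>z. C0 * P z + \<epsilon>2 * norm (- w + z))"
    using C0 \<epsilon>2 by (intro convex_on_add convex_on_cmul convex_on_shift[OF convex_on_norm_UNIV, of "- w"] Pc) auto
  then have gc: "convex_on UNIV g" by (simp add: g_def[abs_def])
  have gL: "g x - g y \<le> (C0 * La + \<epsilon>2) * norm (x - y)" for x y
  proof -
    have "C0 * (P x - P y) \<le> C0 * (La * norm (x - y))" using PL C0 by (intro mult_left_mono) auto
    moreover have "\<epsilon>2 * (norm (x - w) - norm (y - w)) \<le> \<epsilon>2 * norm (x - y)"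
      using norm_triangle_ineq2[of "x - w" "y - w"] \<epsilon>2 by (intro mult_left_mono) auto
    ultimately show ?thesis by (simp add: g_def algebra_simps)
  qed
  have L: "C0 * La + \<epsilon>2 \<ge> 0" using C0 La \<epsilon>2 by simp
  have gmin: "g w \<le> g z" if "z \<in> S" "norm (z - w) \<le> \<rho>" for z using wmin[OF that] by (simp add: g_def C0_def)
  have gd: "g (u + h) - g u \<le> C0 * (max_norm J ((?V u) + gap J n \<kappa> h) - max_norm J (?V u))
      + \<epsilon>2 * norm h" for u h
  proof -
    have "\<epsilon>2 * (norm (u + h - w) - norm (u - w)) \<le> \<epsilon>2 * norm h"
      using norm_triangle_ineq2[of "u + h - w" "u - w"] \<epsilon>2 by (intro mult_left_mono) auto
    then show ?thesis by (simp add: g_def P_def linear_add[OF linear_gap[OF J(1)]] algebra_simps)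
  qed
  have ball: "om u i \<in> \<Omega> i \<inter> ball xbar (\<kappa> i)" if u: "u \<in> S" "norm (u - u0) < 1" and i: "i \<in> {1..n}" for u i
  proof -
    have "om u i - xbar = \<kappa> i *\<^sub>R apply_bcontfun (u - u0) i"
      using omu0[OF i] by (simp add: om_def scaleR_diff_right)
    then have "norm (om u i - xbar) = \<kappa> i * norm (apply_bcontfun (u - u0) i)" using \<kappa>[of i] by simp
    also have "\<dots> \<le> \<kappa> i * norm (u - u0)" using \<kappa>[of i] by (intro mult_left_mono norm_bounded) auto
    also have "\<dots> < \<kappa> i" using u(2) \<kappa>[of i] by simp
    finally show ?thesis using inS[OF u(1) i] by (simp add: dist_norm norm_minus_commute)
  qed
  have balls: "(\<forall>i\<in>{1..n-1}. om u i \<in> \<Omega> i \<inter> ball xbar lam) \<and> om u n \<in> \<Omega> n \<inter> ball xbar \<eta>"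
    if "u \<in> S" "norm (u - u0) < 1" for u
  proof (intro conjI ballI)
    fix i assume "i \<in> {1..n-1}"
    then have i: "i \<in> J" by (simp add: J_def)
    show "om u i \<in> \<Omega> i \<inter> ball xbar lam" using ball[OF that subsetD[OF JI i]] unfolding \<kappa>J[OF i] .
  next
    have "n \<in> {1..n}" using n by simp
    from ball[OF that this] show "om u n \<in> \<Omega> n \<inter> ball xbar \<eta>" by (simp add: \<kappa>_def)
  qed
  have sums: "(\<Sum>i\<in>insert n J. \<kappa> i * f i) = lam * (\<Sum>i=1..n-1. f i) + \<eta> * f n" for f :: "nat \<Rightarrow> real"
  proof -
    have "(\<Sum>i\<in>insert n J. \<kappa> i * f i) = \<kappa> n * f n + (\<Sum>i\<in>J. \<kappa> i * f i)" using J by simp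
    also have "(\<Sum>i\<in>J. \<kappa> i * f i) = (\<Sum>i\<in>J. lam * f i)" by (intro sum.cong) (simp_all add: \<kappa>J)
    finally show ?thesis unfolding J_def[symmetric] by (simp add: sum_distrib_left \<kappa>_def)
  qed
  have fJ: "(\<Sum>i\<in>J. blinfun_apply (X i) (apply_bcontfun (?V u) i))
      = (\<Sum>i=1..n-1. blinfun_apply (X i) (om u n + a i - om u i))" for X :: "nat \<Rightarrow> 'a \<Rightarrow>\<^sub>L real" and u
    unfolding J_def[symmetric] by (intro sum.cong refl) (simp only: vi)
  show ?thesis
    unfolding d_def[symmetric]
  proof (intro conjI impI ballI, goal_cases)
    case 1
    obtain x' where x': "\<And>h. - blinfun_apply x' h \<le> g (w + h) - g w"
      "\<And>i c. i \<in> {1..n} \<Longrightarrow> c > 0 \<Longrightarrow> c *\<^sub>R component x' i \<in> clarke_normal_cone (\<Omega> i) (om w i)"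
    proof (rule clarke_normal_exists[of "{1..n}" \<kappa> w \<Omega> g "C0 * La + \<epsilon>2" \<rho>])
      show "w \<in> scaled_product {1..n} \<kappa> \<Omega>" using w(1) by (simp only: S_def)
      show "g w \<le> g z" if "z \<in> scaled_product {1..n} \<kappa> \<Omega>" "norm (z - w) \<le> \<rho>" for z
        using gmin[of z] that by (simp only: S_def)
      fix x' assume 1: "\<And>h. - blinfun_apply x' h \<le> g (w + h) - g w"
        and 2: "\<And>i c. i \<in> {1..n} \<Longrightarrow> c > 0 \<Longrightarrow>
          c *\<^sub>R component x' i \<in> clarke_normal_cone (\<Omega> i) (\<kappa> i *\<^sub>R apply_bcontfun w i)"
      show thesis by (rule that[OF 1]) (simp only: om_def 2)
    qed (use \<kappa> gc L gL \<rho> in auto)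
    \<comment> \<open>The additive error is zero, so the lower and upper bounds on the pairing
      coincide and give the equality of (i).\<close>
    have b: "- blinfun_apply x' h \<le> C0 * (max_norm J ((?V w) + gap J n \<kappa> h)
        - max_norm J (?V w)) + \<epsilon>2 * norm h + 0" for h
      using x'(1)[of h] gd[of w h] by linarith
    have b0: "0 < C0 * max_norm J (?V w)" using C0 Ppos[OF w(1)] by (simp add: P_def)
    have NC: "c *\<^sub>R component x' i \<in> clarke_normal_cone (\<Omega> i) (om w i)" if "i \<in> insert n J" "c > 0" for i c
      using x'(2) that I by simp
    obtain X where X: "(\<Sum>i\<in>insert n J. X i) = 0" "(\<Sum>i\<in>J. norm (X i)) = 1"
      "C0 * (1 - 0 / (C0 * max_norm J (?V w)))
        * (\<Sum>i\<in>insert n J. \<kappa> i * infdist (X i) (clarke_normal_cone (\<Omega> i) (om w i))) \<le> \<epsilon>2"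
      "max_norm J (?V w) - 0 / C0 \<le> (\<Sum>i\<in>J. blinfun_apply (X i) (apply_bcontfun (?V w) i))"
      "(\<Sum>i\<in>J. blinfun_apply (X i) (apply_bcontfun (?V w) i)) \<le> max_norm J (?V w)"
      by (rule multipliers_from_functional[OF J \<kappa> vsup C0 less_imp_le[OF \<epsilon>2(1)] order_refl b0 b NC])
        (assumption | rule that)+
    have eq: "(\<Sum>i\<in>J. blinfun_apply (X i) (apply_bcontfun (?V w) i)) = P w"
      using X(4,5) by (simp add: P_def)
    have lt: "C0 * (lam * (\<Sum>i=1..n-1. infdist (X i) (clarke_normal_cone (\<Omega> i) (om w i)))
           + \<eta> * infdist (X n) (clarke_normal_cone (\<Omega> n) (om w n))) < \<epsilon>"
      using X(3) \<epsilon>2(2) unfolding sums by simp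
    show ?case
      using balls[OF w(1,2)] Ppos[OF w(1)] w(3)[unfolded Pu0] X(1)[unfolded I] X(2)[unfolded J_def]
        eq[unfolded fJ] lt[unfolded C0_def] unfolding P
      by (intro exI[of _ "om w"] exI[of _ X]) blast
  next
    case (2 \<tau>)
    then have asp: "asplund_space TYPE('a)" and \<tau>: "0 < \<tau>" "\<tau> < 1" by auto
    define r0 where "r0 = P w"
    have r0: "r0 > 0" unfolding r0_def by (rule Ppos[OF w(1)])
    \<comment> \<open>A factor strictly between \<open>1\<close> and
      \<open>\<epsilon> / \<epsilon>2\<close>. It is the permitted growth of
      \<open>deriv \<phi>\<close> when the point moves from \<open>w\<close> to
      \<open>u\<close>.\<close>
    define \<theta> where "\<theta> = (1 + \<epsilon> / \<epsilon>2) / 2"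
    have \<theta>: "\<theta> > 1" "\<theta> * \<epsilon>2 < \<epsilon>" using \<epsilon>2 by (auto simp: \<theta>_def field_simps)
    have "(deriv \<phi> \<longlongrightarrow> C0) (nhds r0)"
      using class_C1_deriv(3)[OF \<phi> r0] by (simp add: isCont_def tendsto_at_iff_tendsto_nhds C0_def r0_def)
    moreover have "C0 < \<theta> * C0" using C0 \<theta>(1) by simp
    ultimately have e1: "\<forall>\<^sub>F r in nhds r0. deriv \<phi> r < \<theta> * C0" by (rule order_tendstoD(2))
    have "(\<phi> \<longlongrightarrow> \<phi> r0) (nhds r0)"
      using DERIV_isCont[OF class_C1_deriv(1)[OF \<phi> r0]] by (simp add: isCont_def tendsto_at_iff_tendsto_nhds)
    moreover have "\<phi> r0 < \<phi> d + \<epsilon>"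
      using u0e w(3) class_C1_less_iff[OF \<phi> P0 P0, of u0 w] by (simp add: r0_def)
    ultimately have e2: "\<forall>\<^sub>F r in nhds r0. \<phi> r < \<phi> d + \<epsilon>" by (rule order_tendstoD(2))
    have e3: "\<forall>\<^sub>F r in nhds r0. r0 / 2 < r" using eventually_nhds_in_open[of "{r0 / 2<..}" r0] r0 by simp
    have "\<forall>\<^sub>F r in nhds r0. deriv \<phi> r < \<theta> * C0 \<and> \<phi> r < \<phi> d + \<epsilon> \<and> r0 / 2 < r"
      using e1 e2 e3 by eventually_elim auto
    then obtain \<delta> where \<delta>: "\<delta> > 0" "\<And>r. \<bar>r - r0\<bar> < \<delta> \<Longrightarrow> deriv \<phi> r < \<theta> * C0 \<and> \<phi> r < \<phi> d + \<epsilon> \<and> r0 / 2 < r"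
      unfolding eventually_nhds_metric dist_real_def by blast
    have C0r0: "C0 * r0 \<noteq> 0" using C0 r0 by simp
    \<comment> \<open>All requirements on \<open>\<beta>\<close> hold in the limit at
      \<open>0\<close>, this first one because \<open>\<theta> * \<epsilon>2 < \<epsilon>\<close>.
      The others provide \<open>\<tau>\<close>, the closeness of \<open>P u\<close> to
      \<open>P w\<close>, and the ball conditions for \<open>u\<close>.\<close>
    have "((\<lambda>\<beta>. \<theta> * (\<epsilon>2 + \<beta>) - \<epsilon> * (1 - 2 * \<beta> / (C0 * r0))) \<longlongrightarrow> \<theta> * (\<epsilon>2 + 0) - \<epsilon> * (1 - 2 * 0 / (C0 * r0))) (at_right 0)"
      by (intro tendsto_intros C0r0)
    then have f1: "\<forall>\<^sub>F \<beta> in at_right 0. \<theta> * (\<epsilon>2 + \<beta>) - \<epsilon> * (1 - 2 * \<beta> / (C0 * r0)) < 0"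
      using \<theta>(2) by (intro order_tendstoD(2)) auto
    have "((\<lambda>\<beta>. 1 - 2 * \<beta> / (C0 * r0)) \<longlongrightarrow> 1 - 2 * 0 / (C0 * r0)) (at_right 0)"
      by (intro tendsto_intros C0r0)
    then have f2: "\<forall>\<^sub>F \<beta> in at_right 0. \<tau> < 1 - 2 * \<beta> / (C0 * r0)"
      using \<tau>(2) by (intro order_tendstoD(1)) auto
    have "((\<lambda>\<beta>. La * \<beta>) \<longlongrightarrow> La * 0) (at_right 0)" by (intro tendsto_intros)
    then have f3: "\<forall>\<^sub>F \<beta> in at_right 0. La * \<beta> < \<delta>" using \<delta>(1) by (intro order_tendstoD(2)) auto
    have "((\<lambda>\<beta>. \<beta>) \<longlongrightarrow> (0 :: real)) (at_right 0)" by (intro tendsto_intros)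
    then have f4: "\<forall>\<^sub>F \<beta> in at_right 0. \<beta> < 1 - norm (w - u0)" using w(2) by (intro order_tendstoD(2)) auto
    have f5: "\<forall>\<^sub>F \<beta> in at_right 0. (0 :: real) < \<beta>" by (rule eventually_at_right_less)
    have "\<forall>\<^sub>F \<beta> in at_right 0. \<theta> * (\<epsilon>2 + \<beta>) - \<epsilon> * (1 - 2 * \<beta> / (C0 * r0)) < 0 \<and> \<tau> < 1 - 2 * \<beta> / (C0 * r0)
        \<and> La * \<beta> < \<delta> \<and> \<beta> < 1 - norm (w - u0) \<and> 0 < \<beta>"
      using f1 f2 f3 f4 f5 by eventually_elim auto
    then obtain \<beta> where \<beta>: "\<theta> * (\<epsilon>2 + \<beta>) < \<epsilon> * (1 - 2 * \<beta> / (C0 * r0))" "\<tau> < 1 - 2 * \<beta> / (C0 * r0)"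
        "La * \<beta> < \<delta>" "\<beta> < 1 - norm (w - u0)" "0 < \<beta>"
      using eventually_happens'[OF trivial_limit_at_right_real] by fastforce
    have sd: "separable_dual_on D" if "countable D" "D \<subseteq> supported {1..n}" for D :: "(nat \<Rightarrow>\<^sub>C 'a) set"
      using that by (intro separable_dual_on_supported[of "{1..n}"] asplund_separable_dual_on[OF asp]) auto
    have SE: "S \<subseteq> supported {1..n}" by (auto simp: S_def scaled_product_def)
    obtain u x' where u: "u \<in> S" "norm (u - w) < \<beta>" and fn: "frechet_normal S u x'"
      and x': "\<And>h. - blinfun_apply x' h \<le> subgradient_bound g \<beta> u h"
      using fuzzy_minimum[OF subspace_supported SE S(1) w(1) sd gc L gL \<rho> gmin \<beta>(5)] by blast
    define r where "r = max_norm J (?V u)"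
    have rP: "r = P u" by (simp add: r_def P_def)
    have "\<bar>r - r0\<bar> \<le> La * norm (u - w)"
      using PL[of u w] PL[of w u] by (simp add: rP r0_def abs_le_iff norm_minus_commute)
    also have "\<dots> \<le> La * \<beta>" using u(2) La by (intro mult_left_mono) auto
    finally have rr: "deriv \<phi> r < \<theta> * C0" "\<phi> r < \<phi> d + \<epsilon>" "r0 / 2 < r" using \<delta>(2)[of r] \<beta>(3) by auto
    have rpos: "r > 0" unfolding rP by (rule Ppos[OF u(1)])
    have "norm (u - u0) \<le> norm (u - w) + norm (w - u0)" using norm_triangle_ineq[of "u - w" "w - u0"] by simp
    then have nu: "norm (u - u0) < 1" using u(2) \<beta>(4) by simp
    \<comment> \<open>The loss factor from normalising the multipliers at \<open>u\<close>. The
      number \<open>Q0\<close> bounds it from below by using \<open>r0 / 2 < r\<close>, and unlike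
      \<open>Q\<close> it does not depend on \<open>u\<close>, so \<open>\<beta>\<close> could be
      chosen beforehand.\<close>
    define Q where "Q = 1 - \<beta> / (C0 * r)"
    define Q0 where "Q0 = 1 - 2 * \<beta> / (C0 * r0)"
    have "\<beta> / (C0 * r) \<le> \<beta> / (C0 * (r0 / 2))"
      using \<beta>(5) C0 rr(3) r0 rpos by (intro divide_left_mono mult_left_mono mult_pos_pos) auto
    then have Q: "Q0 \<le> Q" by (simp add: Q_def Q0_def mult.commute)
    have Q0: "\<tau> < Q0" "\<theta> * (\<epsilon>2 + \<beta>) < \<epsilon> * Q0" using \<beta>(1,2) by (simp_all add: Q0_def)
    have "0 < Q" using Q Q0 \<tau> by linarith
    then have b0: "\<beta> < C0 * max_norm J (?V u)" using C0 rpos by (simp add: Q_def r_def[symmetric])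
    have b: "- blinfun_apply x' h \<le> C0 * (max_norm J ((?V u) + gap J n \<kappa> h)
        - max_norm J (?V u)) + (\<epsilon>2 + \<beta>) * norm h + \<beta>" for h
      using x'[of h] gd[of u h] by (simp add: subgradient_bound_def distrib_right)
    have NC: "c *\<^sub>R component x' i \<in> frechet_normal_cone (\<Omega> i) (om u i)" if "i \<in> insert n J" "c > 0" for i c
      unfolding om_def using that I fn u(1) \<kappa> unfolding S_def by (intro frechet_normal_component[of "{1..n}"]) auto
    have s0: "0 \<le> \<epsilon>2 + \<beta>" using \<epsilon>2 \<beta> by simp
    obtain X where X: "(\<Sum>i\<in>insert n J. X i) = 0" "(\<Sum>i\<in>J. norm (X i)) = 1"
      "C0 * (1 - \<beta> / (C0 * max_norm J (?V u)))
        * (\<Sum>i\<in>insert n J. \<kappa> i * infdist (X i) (frechet_normal_cone (\<Omega> i) (om u i))) \<le> \<epsilon>2 + \<beta>"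
      "max_norm J (?V u) - \<beta> / C0 \<le> (\<Sum>i\<in>J. blinfun_apply (X i) (apply_bcontfun (?V u) i))"
      by (rule multipliers_from_functional[OF J \<kappa> vsup C0 s0 less_imp_le[OF \<beta>(5)] b0 b NC])
        (assumption | rule that)+
    define \<Sigma> where "\<Sigma> = (\<Sum>i\<in>insert n J. \<kappa> i * infdist (X i) (frechet_normal_cone (\<Omega> i) (om u i)))"
    have \<Sigma>0: "0 \<le> \<Sigma>"
      unfolding \<Sigma>_def using less_imp_le[OF \<kappa>] by (intro sum_nonneg mult_nonneg_nonneg infdist_nonneg) auto
    have "deriv \<phi> r * \<Sigma> < \<epsilon>"
    proof -
      have "C0 * Q0 * \<Sigma> \<le> C0 * Q * \<Sigma>" using Q C0 \<Sigma>0 by (intro mult_right_mono mult_left_mono) auto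
      also have "\<dots> \<le> \<epsilon>2 + \<beta>" using X(3) by (simp add: Q_def r_def \<Sigma>_def)
      finally have "\<theta> * (C0 * Q0 * \<Sigma>) \<le> \<theta> * (\<epsilon>2 + \<beta>)" using \<theta>(1) by (intro mult_left_mono) auto
      then have "(\<theta> * C0 * \<Sigma>) * Q0 < \<epsilon> * Q0" using Q0(2) by (simp add: ac_simps)
      then have "\<theta> * C0 * \<Sigma> < \<epsilon>" using Q0(1) \<tau>(1) by (simp add: mult_less_cancel_right)
      moreover have "deriv \<phi> r * \<Sigma> \<le> \<theta> * C0 * \<Sigma>" using rr(1) \<Sigma>0 by (intro mult_right_mono) auto
      ultimately show ?thesis by simp
    qed
    then have lt: "deriv \<phi> (P u) * (lam * (\<Sum>i=1..n-1. infdist (X i) (frechet_normal_cone (\<Omega> i) (om u i)))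
           + \<eta> * infdist (X n) (frechet_normal_cone (\<Omega> n) (om u n))) < \<epsilon>"
      unfolding \<Sigma>_def sums rP .
    have "\<tau> * r < Q * r" using Q Q0(1) rpos by (intro mult_strict_right_mono) auto
    also have "Q * r = r - \<beta> / C0" using rpos by (simp add: Q_def left_diff_distrib)
    finally have gt: "\<tau> * P u < (\<Sum>i=1..n-1. blinfun_apply (X i) (om u n + a i - om u i))"
      using X(4) unfolding fJ r_def[symmetric] rP by linarith
    have inv: "P u < the_inv_into {0..} \<phi> (\<phi> d + \<epsilon>)"
      using class_C1_less_inverse[OF \<phi> _ rr(2)] rpos by (simp add: rP)
    show ?case
      using balls[OF u(1) nu] Ppos[OF u(1)] inv X(1)[unfolded I] X(2)[unfolded J_def] lt gt unfolding P
      by (intro exI[of _ "om u"] exI[of _ X]) blast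
  qed
qed

end
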